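(* Let $\mathbb{K}$ be a field of characteristic $0$ and $\lambda\in\mathbb{K}$ nonzero. Let $(A,\{\mu_k\}_{k=1}^\infty)$ be an $A_\infty$-algebra, $(B,\{\nu_k\}_{k=1}^\infty,\{\eta_k\}_{k=1}^\infty)$ an $A_\infty$-representation of it, and let $P=\sum_{k\ge1}P_k\in\mathrm{Hom}_0(\mathbb{K}[T_\bullet]\otimes\overline{T}(B),A)$ be a homotopy relative averaging operator of weight $\lambda$. Then the graded vector space $B$ inherits a $Triass_\infty$-algebra structure with operations $\{\pi_k^P:\mathbb{K}[T_k]\otimes B^{\otimes k}\to B\}_{k=1}^\infty$ given by $$\pi_k^P(T;x_1,\dots,x_k)=\big(e^{\{\![-,P]\!\}}\pi\big)(T;x_1,\dots,x_k)$$ for all $k\ge1$, $T\in T_k$ and $x_1,\dots,x_k\in B$.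
   Context: An $A_\infty$-algebra is a graded vector space $A=\bigoplus_{i\in\mathbb{Z}}A_i$ with degree $1$ linear maps $\mu_k:A^{\otimes k}\to A$, $k\ge1$, such that for all $n\ge1$ and homogeneous $a_1,\dots,a_n$: $$\sum_{k+l=n+1}\sum_{i=1}^k(-1)^{|a_1|+\cdots+|a_{i-1}|}\mu_k(a_1,\dots,a_{i-1},\mu_l(a_i,\dots,a_{i+l-1}),a_{i+l},\dots,a_n)=0.$$ $\mathcal{A}^{k,l}$ is the direct sum of all $(k+l)$-fold tensor products of $A$'s and $B$'s with $A$ appearing $k$ times and $B$ appearing $l$ times. An $A_\infty$-representation of $(A,\{\mu_k\})$ is an $A_\infty$-algebra $(B,\{\nu_k\})$ with degree $1$ maps $\eta_k:\mathcal{A}^{k-1,1}\oplus\mathcal{A}^{k-2,2}\oplus\cdots\oplus\mathcal{A}^{1,k-1}\to B$ ($\eta_1=0$) such that the same identities hold when some (not all) of the $a_j$ are in $B$ and the operations are replaced by the appropriate $\nu$'s or $\eta$'s; equivalently, the maps $\mu_k+\nu_k+\eta_k$ make $A\oplus B$ an $A_\infty$-algebra. Trees. For $n\ge1$, $T_n$ is the set of planar rooted trees with $n+1$ leaves in which every internal vertex has at least two incoming edges; $T_0=\{|\}$. Leaves are labelled $0,\dots,n$ from left to right; deleting a leaf suppresses a vertex left with a single incoming edge. For $k,l\ge1$, $1\le i\le k$, $T\in T_{k+l-1}$: $R_0^{k;i,l}(T)\in T_k$ is obtained by deleting the leaves $i,\dots,i+l-2$, and $R_i^{k;i,l}(T)\in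 T_l$ by deleting all leaves except $i-1,\dots,i+l-1$. Every $T\in T_k$ ($k\ge1$) is uniquely a grafting $T=T^1\vee\cdots\vee T^l$, $l\ge2$, with $T^j\in T_{i_j-1}$ (roots joined, left to right, to a new root vertex), where $i_1+\dots+i_l=k+1$. A $Triass_\infty$-algebra is a graded vector space $D$ with degree $1$ linear maps $\pi_k:\mathbb{K}[T_k]\otimes D^{\otimes k}\to D$, $k\ge1$ (trees in degree $0$), such that for all $n\ge1$, $T\in T_n$ and homogeneous $x_1,\dots,x_n\in D$: $$\sum_{k+l=n+1}\sum_{i=1}^k(-1)^{|x_1|+\cdots+|x_{i-1}|}\pi_k\big(R_0^{k;i,l}(T);x_1,\dots,x_{i-1},\pi_l(R_i^{k;i,l}(T);x_i,\dots,x_{i+l-1}),x_{i+l},\dots,x_n\big)=0.$$ Graded Lie algebra. For a graded vector space $D$, $\mathrm{Hom}_n(\mathbb{K}[T_\bullet]\otimes\overline{T}(D),D)$ is the space of sums $\varpi=\sum_{k\ge1}\varpi_k$ of degree $n$ linear maps $\varpi_k:\mathbb{K}[T_k]\otimes D^{\otimes k}\to D$. For $\pi$ of degree $m$ and $\varpi$ of degree $n$, $\{\![\pi,\varpi]\!\}=\sum_{r\ge1}\sum_{k+l=r+1}(\pi_k\diamond\varpi_l-(-1)^{mn}\varpi_l\diamond\pi_k)$, where $$(\pi_k\diamond\varpi_l)(T;x_1,\dots,x_r)=\sum_{i=1}^k(-1)^{n(|x_1|+\cdots+|x_{i-1}|)}\pi_k\big(R_0^{k;i,l}(T);x_1,\dots,x_{i-1},\varpi_l(R_i^{k;i,l}(T);x_i,\dots,x_{i+l-1}),x_{i+l},\dots,x_r\big).$$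 Let $\mathfrak{g}$ be the resulting graded Lie algebra for $D=A\oplus B$; $\mathfrak{a}=\bigoplus_n\mathrm{Hom}_n(\mathbb{K}[T_\bullet]\otimes\overline{T}(B),A)\subset\mathfrak{g}$ consists of the sums of maps $\mathbb{K}[T_k]\otimes B^{\otimes k}\to A$ (extended by zero); $p:\mathfrak{g}\to\mathfrak{g}$ is the projection onto $\mathfrak{a}$. The element $\pi=\sum_k\pi_k\in\mathfrak{g}$ of degree $1$ is $$\pi_k(T;(a_1,x_1),\dots,(a_k,x_k))=\big(\mu_k(a_1,\dots,a_k),\ \lambda^{l-2}(\eta_k+\nu_k)(c_1,\dots,c_k)\big)\quad\text{for }T=T^1\vee\cdots\vee T^l,$$ with $c_j=x_j$ if $j\in\{i_1,i_1+i_2,\dots,i_1+\cdots+i_{l-1}\}$ and $c_j=a_j$ otherwise; it satisfies $\{\![\pi,\pi]\!\}=0$. Homotopy relative averaging operator of weight $\lambda$: a degree $0$ element $P\in\mathfrak{a}$ that is a Maurer-Cartan element of the $L_\infty$-algebra on $\mathfrak{a}$ with $l_k(\gamma_1,\dots,\gamma_k)=p\{\![\cdots\{\![\pi,\gamma_1]\!\},\dots,\gamma_k]\!\}$, i.e. $\sum_{k\ge1}\frac1{k!}l_k(P,\dots,P)=0$; equivalently $p\big(e^{\{\![-,P]\!\}}\pi\big)=0$, where $e^{\{\![-,P]\!\}}\pi=\pi+\{\![\pi,P]\!\}+\frac1{2!}\{\![\{\![\pi,P]\!\},P]\!\}+\cdots$ (a finite sum in each arity). *)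

theory Defs
  imports "HOL-Analysis.Product_Vector" "HOL-Library.Groups_Big_Fun"
begin

section \<open>Planar rooted trees\<close>

datatype ptree = Leaf | Node "ptree list"

fun subtrees :: "ptree \<Rightarrow> ptree list" where
  "subtrees Leaf = []"
| "subtrees (Node ts) = ts"

fun leaves :: "ptree \<Rightarrow> nat" where
  "leaves Leaf = 1"
| "leaves (Node ts) = sum_list (map leaves ts)"

fun reduced :: "ptree \<Rightarrow> bool" where
  "reduced Leaf \<longleftrightarrow> True"
| "reduced (Node ts) \<longleftrightarrow> 2 \<le> length ts \<and> (\<forall>t\<in>set ts. reduced t)"

definition trees :: "nat \<Rightarrow> ptree set" where
  "trees n = {T. reduced T \<and> leaves T = n + 1}"

text \<open>Restoring a vertex after the deletion of leaves: a vertex left with one incoming edge is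
  suppressed, one left with none disappears together with its outgoing edge.\<close>

fun regraft :: "ptree list \<Rightarrow> ptree option" where
  "regraft [] = None"
| "regraft [t] = Some t"
| "regraft ts = Some (Node ts)"

text \<open>The number \<open>m\<close> is the label of the leftmost leaf of the (sub)tree; \<open>S\<close> is the set
  of labels to be deleted.\<close>

fun prune :: "nat set \<Rightarrow> nat \<Rightarrow> ptree \<Rightarrow> ptree option"
  and prune_list :: "nat set \<Rightarrow> nat \<Rightarrow> ptree list \<Rightarrow> ptree list" where
  "prune S m Leaf = (if m \<in> S then None else Some Leaf)"
| "prune S m (Node ts) = regraft (prune_list S m ts)"
| "prune_list S m [] = []"
| "prune_list S m (t # ts) =
     (case prune S m t of None \<Rightarrow> [] | Some u \<Rightarrow> [u]) @ prune_list S (m + leaves t) ts"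

definition delete_leaves :: "nat set \<Rightarrow> ptree \<Rightarrow> ptree" where
  "delete_leaves S T = the (prune S 0 T)"

text \<open>\<open>R0 i l\<close> and \<open>Ri i l\<close> are the maps $R_0^{k;i,l}$ and $R_i^{k;i,l}$; as formulas they
  do not involve \<open>k\<close>.\<close>

definition R0 :: "nat \<Rightarrow> nat \<Rightarrow> ptree \<Rightarrow> ptree" where
  "R0 i l T = delete_leaves {i..<i + l - 1} T"

definition Ri :: "nat \<Rightarrow> nat \<Rightarrow> ptree \<Rightarrow> ptree" where
  "Ri i l T = delete_leaves (- {i - 1..i + l - 1}) T"


section \<open>Graded vector spaces and graded multilinear maps\<close>

text \<open>The whole type \<open>'v\<close> with scalar multiplication \<open>s\<close> is the internal direct sum of the
  subspaces \<open>G i\<close>.\<close>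

definition is_decomposition :: "(int \<Rightarrow> 'v::ab_group_add set) \<Rightarrow> 'v \<Rightarrow> (int \<Rightarrow> 'v) \<Rightarrow> bool" where
  "is_decomposition G v c \<longleftrightarrow> (\<forall>i. c i \<in> G i) \<and> finite {i. c i \<noteq> 0} \<and> v = Sum_any c"

definition graded_vector_space ::
  "('k::field \<Rightarrow> 'v::ab_group_add \<Rightarrow> 'v) \<Rightarrow> (int \<Rightarrow> 'v set) \<Rightarrow> bool" where
  "graded_vector_space s G \<longleftrightarrow>
     vector_space s \<and> (\<forall>i. module.subspace s (G i)) \<and> (\<forall>v. \<exists>!c. is_decomposition G v c)"

definition component :: "(int \<Rightarrow> 'v::ab_group_add set) \<Rightarrow> 'v \<Rightarrow> int \<Rightarrow> 'v" where
  "component G v = (THE c. is_decomposition G v c)"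

definition homogeneous :: "(int \<Rightarrow> 'v set) \<Rightarrow> int list \<Rightarrow> 'v list \<Rightarrow> bool" where
  "homogeneous G ds xs \<longleftrightarrow> list_all2 (\<lambda>d x. x \<in> G d) ds xs"

text \<open>A linear map of degree \<open>d\<close> from the \<open>k\<close>-th tensor power of \<open>'v\<close> to \<open>'w\<close> is given by
  its values on lists of length \<open>k\<close>.\<close>

definition graded_multilinear ::
  "('k::field \<Rightarrow> 'v::ab_group_add \<Rightarrow> 'v) \<Rightarrow> (int \<Rightarrow> 'v set) \<Rightarrow>
   ('k \<Rightarrow> 'w::ab_group_add \<Rightarrow> 'w) \<Rightarrow> (int \<Rightarrow> 'w set) \<Rightarrow> int \<Rightarrow> nat \<Rightarrow> ('v list \<Rightarrow> 'w) \<Rightarrow> bool" where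
  "graded_multilinear s G s' G' d k f \<longleftrightarrow>
     (\<forall>xs. length xs = k \<longrightarrow> (\<forall>j<k. Vector_Spaces.linear s s' (\<lambda>v. f (xs[j := v])))) \<and>
     (\<forall>ds xs. length xs = k \<longrightarrow> homogeneous G ds xs \<longrightarrow> f xs \<in> G' (sum_list ds + d))"

text \<open>\<open>insert_op i l g [x\<^sub>1, \<dots>, x\<^sub>n]
  = [x\<^sub>1, \<dots>, x\<^bsub>i-1\<^esub>, g [x\<^sub>i, \<dots>, x\<^bsub>i+l-1\<^esub>], x\<^bsub>i+l\<^esub>, \<dots>, x\<^sub>n]\<close> for \<open>1 \<le> i\<close>.\<close>

definition insert_op :: "nat \<Rightarrow> nat \<Rightarrow> ('v list \<Rightarrow> 'v) \<Rightarrow> 'v list \<Rightarrow> 'v list" where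
  "insert_op i l g xs = take (i - 1) xs @ g (take l (drop (i - 1) xs)) # drop (i + l - 1) xs"

definition arity_splits :: "nat \<Rightarrow> (nat \<times> nat) set" where
  "arity_splits n = {(k, l). 1 \<le> k \<and> 1 \<le> l \<and> k + l = n + 1}"


section \<open>A-infinity algebras and their representations\<close>

definition a_infinity_algebra ::
  "('k::field \<Rightarrow> 'v::ab_group_add \<Rightarrow> 'v) \<Rightarrow> (int \<Rightarrow> 'v set) \<Rightarrow> (nat \<Rightarrow> 'v list \<Rightarrow> 'v) \<Rightarrow> bool" where
  "a_infinity_algebra s G \<mu> \<longleftrightarrow>
     graded_vector_space s G \<and>
     (\<forall>k\<ge>1. graded_multilinear s G s G 1 k (\<mu> k)) \<and>
     (\<forall>n\<ge>1. \<forall>ds xs. length xs = n \<longrightarrow> homogeneous G ds xs \<longrightarrow>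
        (\<Sum>(k, l)\<in>arity_splits n. \<Sum>i=1..k.
           s ((-1) powi sum_list (take (i - 1) ds)) (\<mu> k (insert_op i l (\<mu> l) xs))) = 0)"

text \<open>A tensor monomial with factors in \<open>A\<close> or \<open>B\<close> is a word over the sum type \<open>'a + 'b\<close>;
  the words with both kinds of letters make up the domain of \<open>\<eta>\<close>. As there is no such word of
  length one, the component of \<open>\<eta>\<close> of arity one plays no role (it is zero by convention).\<close>

definition mixed_word :: "('a + 'b) list \<Rightarrow> bool" where
  "mixed_word w \<longleftrightarrow> (\<exists>x\<in>set w. isl x) \<and> (\<exists>x\<in>set w. \<not> isl x)"

definition sum_grading :: "(int \<Rightarrow> 'a set) \<Rightarrow> (int \<Rightarrow> 'b set) \<Rightarrow> int \<Rightarrow> ('a + 'b) set" where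
  "sum_grading GA GB i = Inl ` GA i \<union> Inr ` GB i"

definition mixed_graded_multilinear ::
  "('k::field \<Rightarrow> 'a::ab_group_add \<Rightarrow> 'a) \<Rightarrow> (int \<Rightarrow> 'a set) \<Rightarrow>
   ('k \<Rightarrow> 'b::ab_group_add \<Rightarrow> 'b) \<Rightarrow> (int \<Rightarrow> 'b set) \<Rightarrow> int \<Rightarrow> nat \<Rightarrow> (('a + 'b) list \<Rightarrow> 'b) \<Rightarrow> bool"
  where
  "mixed_graded_multilinear sA GA sB GB d k f \<longleftrightarrow>
     (\<forall>w. length w = k \<longrightarrow> mixed_word w \<longrightarrow>
        (\<forall>j<k. if isl (w ! j)
               then Vector_Spaces.linear sA sB (\<lambda>a. f (w[j := Inl a]))
               else Vector_Spaces.linear sB sB (\<lambda>b. f (w[j := Inr b])))) \<and>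
     (\<forall>ds w. length w = k \<longrightarrow> mixed_word w \<longrightarrow> homogeneous (sum_grading GA GB) ds w \<longrightarrow>
        f w \<in> GB (sum_list ds + d))"

text \<open>The operation \<open>\<eta> + \<nu>\<close> on words with at least one letter in \<open>B\<close>, and
  \<open>\<mu> + \<nu> + \<eta>\<close> on all words.\<close>

definition eta_plus_nu ::
  "(nat \<Rightarrow> 'b list \<Rightarrow> 'b) \<Rightarrow> (nat \<Rightarrow> ('a + 'b) list \<Rightarrow> 'b) \<Rightarrow> nat \<Rightarrow> ('a + 'b) list \<Rightarrow> 'b" where
  "eta_plus_nu \<nu> \<eta> k w = (if \<forall>x\<in>set w. \<not> isl x then \<nu> k (map projr w) else \<eta> k w)"

definition total_op ::
  "(nat \<Rightarrow> 'a list \<Rightarrow> 'a) \<Rightarrow> (nat \<Rightarrow> 'b list \<Rightarrow> 'b) \<Rightarrow> (nat \<Rightarrow> ('a + 'b) list \<Rightarrow> 'b) \<Rightarrow>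
   nat \<Rightarrow> ('a + 'b) list \<Rightarrow> 'a + 'b" where
  "total_op \<mu> \<nu> \<eta> k w =
     (if \<forall>x\<in>set w. isl x then Inl (\<mu> k (map projl w)) else Inr (eta_plus_nu \<nu> \<eta> k w))"

text \<open>In the identities the outer word always contains a letter in \<open>B\<close>, whence
  \<open>eta_plus_nu\<close> as outer operation.\<close>

definition a_infinity_representation ::
  "('k::field \<Rightarrow> 'a::ab_group_add \<Rightarrow> 'a) \<Rightarrow> (int \<Rightarrow> 'a set) \<Rightarrow> (nat \<Rightarrow> 'a list \<Rightarrow> 'a) \<Rightarrow>
   ('k \<Rightarrow> 'b::ab_group_add \<Rightarrow> 'b) \<Rightarrow> (int \<Rightarrow> 'b set) \<Rightarrow> (nat \<Rightarrow> 'b list \<Rightarrow> 'b) \<Rightarrow>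
   (nat \<Rightarrow> ('a + 'b) list \<Rightarrow> 'b) \<Rightarrow> bool" where
  "a_infinity_representation sA GA \<mu> sB GB \<nu> \<eta> \<longleftrightarrow>
     a_infinity_algebra sB GB \<nu> \<and>
     (\<forall>k\<ge>1. mixed_graded_multilinear sA GA sB GB 1 k (\<eta> k)) \<and>
     (\<forall>n\<ge>1. \<forall>ds w. length w = n \<longrightarrow> mixed_word w \<longrightarrow> homogeneous (sum_grading GA GB) ds w \<longrightarrow>
        (\<Sum>(k, l)\<in>arity_splits n. \<Sum>i=1..k.
           sB ((-1) powi sum_list (take (i - 1) ds))
              (eta_plus_nu \<nu> \<eta> k (insert_op i l (total_op \<mu> \<nu> \<eta> l) w))) = 0)"


section \<open>Triass-infinity algebras\<close>

text \<open>A linear map on the tensor product of the span of \<open>trees k\<close> with the \<open>k\<close>-th tensor power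
  of \<open>'v\<close> is given by its values \<open>\<pi> k T xs\<close> for \<open>T \<in> trees k\<close> and \<open>length xs = k\<close>; all other
  values are irrelevant.\<close>

type_synonym ('v, 'w) tree_ops = "nat \<Rightarrow> ptree \<Rightarrow> 'v list \<Rightarrow> 'w"

definition tree_hom ::
  "('k::field \<Rightarrow> 'v::ab_group_add \<Rightarrow> 'v) \<Rightarrow> (int \<Rightarrow> 'v set) \<Rightarrow>
   ('k \<Rightarrow> 'w::ab_group_add \<Rightarrow> 'w) \<Rightarrow> (int \<Rightarrow> 'w set) \<Rightarrow> int \<Rightarrow> ('v, 'w) tree_ops \<Rightarrow> bool" where
  "tree_hom s G s' G' d \<phi> \<longleftrightarrow>
     (\<forall>k\<ge>1. \<forall>T\<in>trees k. graded_multilinear s G s' G' d k (\<phi> k T))"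

definition triass_infinity_algebra ::
  "('k::field \<Rightarrow> 'v::ab_group_add \<Rightarrow> 'v) \<Rightarrow> (int \<Rightarrow> 'v set) \<Rightarrow> ('v, 'v) tree_ops \<Rightarrow> bool" where
  "triass_infinity_algebra s G \<pi> \<longleftrightarrow>
     graded_vector_space s G \<and>
     tree_hom s G s G 1 \<pi> \<and>
     (\<forall>n\<ge>1. \<forall>T\<in>trees n. \<forall>ds xs. length xs = n \<longrightarrow> homogeneous G ds xs \<longrightarrow>
        (\<Sum>(k, l)\<in>arity_splits n. \<Sum>i=1..k.
           s ((-1) powi sum_list (take (i - 1) ds))
             (\<pi> k (R0 i l T) (insert_op i l (\<pi> l (Ri i l T)) xs))) = 0)"


section \<open>The graded Lie bracket\<close>

text \<open>The linear operator with \<open>x \<mapsto> (-1)\<^bsup>n |x|\<^esup> x\<close> on homogeneous \<open>x\<close>. Applying it to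
  \<open>x\<^sub>1, \<dots>, x\<^bsub>i-1\<^esub>\<close> is the linear extension of the sign
  \<open>(-1)\<^bsup>n (|x\<^sub>1| + \<dots> + |x\<^bsub>i-1\<^esub>|)\<^esup>\<close>; see \<open>diamond_homogeneous\<close> below.\<close>

definition sign_op ::
  "('k::field \<Rightarrow> 'v::ab_group_add \<Rightarrow> 'v) \<Rightarrow> (int \<Rightarrow> 'v set) \<Rightarrow> int \<Rightarrow> 'v \<Rightarrow> 'v" where
  "sign_op s G n v = Sum_any (\<lambda>d. s ((-1) powi (n * d)) (component G v d))"

text \<open>\<open>diamond s G n k l \<pi> \<phi>\<close> is $\pi_k \diamond \varphi_l$ for \<open>\<phi>\<close> of degree \<open>n\<close>.\<close>

definition diamond ::
  "('k::field \<Rightarrow> 'v::ab_group_add \<Rightarrow> 'v) \<Rightarrow> (int \<Rightarrow> 'v set) \<Rightarrow> int \<Rightarrow> nat \<Rightarrow> nat \<Rightarrow>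
   ('v, 'v) tree_ops \<Rightarrow> ('v, 'v) tree_ops \<Rightarrow> ptree \<Rightarrow> 'v list \<Rightarrow> 'v" where
  "diamond s G n k l \<pi> \<phi> T xs =
     (\<Sum>i=1..k. \<pi> k (R0 i l T)
        (insert_op i l (\<phi> l (Ri i l T))
           (map (sign_op s G n) (take (i - 1) xs) @ drop (i - 1) xs)))"

text \<open>The bracket of \<open>\<pi>\<close> of degree \<open>m\<close> and \<open>\<phi>\<close> of degree \<open>n\<close>.\<close>

definition bracket ::
  "('k::field \<Rightarrow> 'v::ab_group_add \<Rightarrow> 'v) \<Rightarrow> (int \<Rightarrow> 'v set) \<Rightarrow> int \<Rightarrow> int \<Rightarrow>
   ('v, 'v) tree_ops \<Rightarrow> ('v, 'v) tree_ops \<Rightarrow> ('v, 'v) tree_ops" where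
  "bracket s G m n \<pi> \<phi> r T xs =
     (\<Sum>(k, l)\<in>arity_splits r.
        diamond s G n k l \<pi> \<phi> T xs - s ((-1) powi (m * n)) (diamond s G m l k \<phi> \<pi> T xs))"

text \<open>\<open>iterated_bracket s G m \<pi> [(n\<^sub>1, \<gamma>\<^sub>1), \<dots>, (n\<^sub>k, \<gamma>\<^sub>k)]\<close> is the bracket
  \<open>{\<dots>{{\<pi>, \<gamma>\<^sub>1}, \<gamma>\<^sub>2} \<dots>, \<gamma>\<^sub>k}\<close>, where \<open>\<pi>\<close> has degree \<open>m\<close> and \<open>\<gamma>\<^sub>i\<close> has degree \<open>n\<^sub>i\<close>.\<close>

fun iterated_bracket ::
  "('k::field \<Rightarrow> 'v::ab_group_add \<Rightarrow> 'v) \<Rightarrow> (int \<Rightarrow> 'v set) \<Rightarrow> int \<Rightarrow>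
   ('v, 'v) tree_ops \<Rightarrow> (int \<times> ('v, 'v) tree_ops) list \<Rightarrow> ('v, 'v) tree_ops" where
  "iterated_bracket s G m \<pi> [] = \<pi>"
| "iterated_bracket s G m \<pi> ((n, \<gamma>) # \<gamma>s) = iterated_bracket s G (m + n) (bracket s G m n \<pi> \<gamma>) \<gamma>s"


section \<open>Homotopy relative averaging operators\<close>

abbreviation prod_scale ::
  "('k::field \<Rightarrow> 'a::ab_group_add \<Rightarrow> 'a) \<Rightarrow> ('k \<Rightarrow> 'b::ab_group_add \<Rightarrow> 'b) \<Rightarrow> 'k \<Rightarrow> 'a \<times> 'b \<Rightarrow> 'a \<times> 'b"
  where "prod_scale sA sB \<equiv> module_prod.scale sA sB"

abbreviation prod_grading :: "(int \<Rightarrow> 'a set) \<Rightarrow> (int \<Rightarrow> 'b set) \<Rightarrow> int \<Rightarrow> ('a \<times> 'b) set" where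
  "prod_grading GA GB \<equiv> \<lambda>i. GA i \<times> GB i"

definition extend_by_zero :: "('b, 'a) tree_ops \<Rightarrow> ('a::zero \<times> 'b::zero, 'a \<times> 'b) tree_ops" where
  "extend_by_zero P k T ys = (P k T (map snd ys), 0)"

definition proj_abelian ::
  "('a::zero \<times> 'b::zero, 'a \<times> 'b) tree_ops \<Rightarrow> ('a \<times> 'b, 'a \<times> 'b) tree_ops" where
  "proj_abelian \<phi> = extend_by_zero (\<lambda>k T xs. fst (\<phi> k T (map (Pair 0) xs)))"

text \<open>For \<open>T = T\<^sup>1 \<or> \<dots> \<or> T\<^sup>l\<close> with \<open>i\<^sub>j\<close> the number of leaves of \<open>T\<^sup>j\<close>, the set
  \<open>{i\<^sub>1, i\<^sub>1 + i\<^sub>2, \<dots>, i\<^sub>1 + \<dots> + i\<^bsub>l-1\<^esub>}\<close>.\<close>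

definition graft_positions :: "ptree \<Rightarrow> nat set" where
  "graft_positions T =
     {sum_list (map leaves (take m (subtrees T))) | m. 1 \<le> m \<and> m < length (subtrees T)}"

text \<open>The weight $\lambda$ is called \<open>wt\<close>. For \<open>T \<in> trees k\<close> with \<open>1 \<le> k\<close> the word
  has at least one letter in \<open>B\<close>.\<close>

definition pi_element ::
  "('k::field \<Rightarrow> 'b \<Rightarrow> 'b) \<Rightarrow> 'k \<Rightarrow> (nat \<Rightarrow> 'a list \<Rightarrow> 'a) \<Rightarrow> (nat \<Rightarrow> 'b list \<Rightarrow> 'b) \<Rightarrow>
   (nat \<Rightarrow> ('a + 'b) list \<Rightarrow> 'b) \<Rightarrow> ('a \<times> 'b, 'a \<times> 'b) tree_ops" where
  "pi_element sB wt \<mu> \<nu> \<eta> k T ys =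
     (\<mu> k (map fst ys),
      sB (wt ^ (length (subtrees T) - 2))
         (eta_plus_nu \<nu> \<eta> k
            (map (\<lambda>j. if j \<in> graft_positions T then Inr (snd (ys ! (j - 1)))
                      else Inl (fst (ys ! (j - 1)))) [1..<k + 1])))"

text \<open>The operation \<open>l\<^sub>k\<close> of the L-infinity algebra, on arguments paired with their degrees;
  \<open>\<pi>\<close> has degree one.\<close>

definition derived_bracket ::
  "('k::field \<Rightarrow> 'a::ab_group_add \<Rightarrow> 'a) \<Rightarrow> (int \<Rightarrow> 'a set) \<Rightarrow>
   ('k \<Rightarrow> 'b::ab_group_add \<Rightarrow> 'b) \<Rightarrow> (int \<Rightarrow> 'b set) \<Rightarrow> ('a \<times> 'b, 'a \<times> 'b) tree_ops \<Rightarrow>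
   (int \<times> ('a \<times> 'b, 'a \<times> 'b) tree_ops) list \<Rightarrow> ('a \<times> 'b, 'a \<times> 'b) tree_ops" where
  "derived_bracket sA GA sB GB \<pi> \<gamma>s =
     proj_abelian (iterated_bracket (prod_scale sA sB) (prod_grading GA GB) 1 \<pi> \<gamma>s)"

text \<open>The two series below are evaluated pointwise, where they have only finitely many nonzero
  terms.\<close>

definition maurer_cartan ::
  "('k::field_char_0 \<Rightarrow> 'a::ab_group_add \<Rightarrow> 'a) \<Rightarrow> (int \<Rightarrow> 'a set) \<Rightarrow>
   ('k \<Rightarrow> 'b::ab_group_add \<Rightarrow> 'b) \<Rightarrow> (int \<Rightarrow> 'b set) \<Rightarrow> ('a \<times> 'b, 'a \<times> 'b) tree_ops \<Rightarrow>
   ('a \<times> 'b, 'a \<times> 'b) tree_ops \<Rightarrow> bool" where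
  "maurer_cartan sA GA sB GB \<pi> P \<longleftrightarrow>
     (\<forall>n\<ge>1. \<forall>T\<in>trees n. \<forall>ys. length ys = n \<longrightarrow>
        Sum_any (\<lambda>k. if k \<ge> 1
          then prod_scale sA sB (1 / fact k)
                 (derived_bracket sA GA sB GB \<pi> (replicate k (0, P)) n T ys)
          else 0) = 0)"

definition exp_twist ::
  "('k::field_char_0 \<Rightarrow> 'a::ab_group_add \<Rightarrow> 'a) \<Rightarrow> (int \<Rightarrow> 'a set) \<Rightarrow>
   ('k \<Rightarrow> 'b::ab_group_add \<Rightarrow> 'b) \<Rightarrow> (int \<Rightarrow> 'b set) \<Rightarrow> ('a \<times> 'b, 'a \<times> 'b) tree_ops \<Rightarrow>
   ('a \<times> 'b, 'a \<times> 'b) tree_ops \<Rightarrow> ('a \<times> 'b, 'a \<times> 'b) tree_ops" where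
  "exp_twist sA GA sB GB \<pi> P n T ys =
     Sum_any (\<lambda>k. prod_scale sA sB (1 / fact k)
       (iterated_bracket (prod_scale sA sB) (prod_grading GA GB) 1 \<pi> (replicate k (0, P)) n T ys))"

definition homotopy_rel_averaging_operator ::
  "('k::field_char_0 \<Rightarrow> 'a::ab_group_add \<Rightarrow> 'a) \<Rightarrow> (int \<Rightarrow> 'a set) \<Rightarrow> (nat \<Rightarrow> 'a list \<Rightarrow> 'a) \<Rightarrow>
   ('k \<Rightarrow> 'b::ab_group_add \<Rightarrow> 'b) \<Rightarrow> (int \<Rightarrow> 'b set) \<Rightarrow> (nat \<Rightarrow> 'b list \<Rightarrow> 'b) \<Rightarrow>
   (nat \<Rightarrow> ('a + 'b) list \<Rightarrow> 'b) \<Rightarrow> 'k \<Rightarrow> ('b, 'a) tree_ops \<Rightarrow> bool" where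
  "homotopy_rel_averaging_operator sA GA \<mu> sB GB \<nu> \<eta> wt P \<longleftrightarrow>
     tree_hom sB GB sA GA 0 P \<and>
     maurer_cartan sA GA sB GB (pi_element sB wt \<mu> \<nu> \<eta>) (extend_by_zero P)"


section \<open>The sign convention of the diamond product\<close>

lemma sign_op_homogeneous:
  assumes "graded_vector_space s G" and "x \<in> G d"
  shows "sign_op s G n x = s ((-1) powi (n * d)) x"
proof -
  interpret vector_space s using assms(1) by (simp add: graded_vector_space_def)
  have sub: "module.subspace s (G i)" for i
    using assms(1) by (simp add: graded_vector_space_def)
  let ?c = "\<lambda>i. if i = d then x else 0"
  have fin: "finite {i. ?c i \<noteq> 0}" by (rule finite_subset[of _ "{d}"]) auto
  have "Sum_any ?c = x"
    using Sum_any.expand_superset[of "{d}" ?c] by auto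
  then have "is_decomposition G x ?c"
    using fin assms(2) sub subspace_0 by (auto simp: is_decomposition_def)
  moreover have "\<exists>!c. is_decomposition G x c"
    using assms(1) by (simp add: graded_vector_space_def)
  ultimately have comp: "component G x = ?c"
    unfolding component_def by (rule the1_equality[rotated])
  have "{i. s ((-1) powi (n * i)) (?c i) \<noteq> 0} \<subseteq> {d}" by auto
  then have "Sum_any (\<lambda>i. s ((-1) powi (n * i)) (?c i))
      = (\<Sum>i\<in>{d}. s ((-1) powi (n * i)) (?c i))"
    by (intro Sum_any.expand_superset) auto
  then show ?thesis by (simp only: sign_op_def comp) simp
qed

lemma graded_multilinear_scale_prefix:
  assumes "graded_vector_space s G" and "graded_multilinear s G s G d k f"
    and "length zs = k" and "length cs \<le> k"
  shows "f (map2 s cs zs @ drop (length cs) zs) = s (prod_list cs) (f zs)"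
  using assms(4)
proof (induction cs rule: rev_induct)
  case Nil
  interpret vector_space s using assms(1) by (simp add: graded_vector_space_def)
  show ?case by simp
next
  case (snoc c cs)
  interpret vector_space s using assms(1) by (simp add: graded_vector_space_def)
  let ?m = "length cs"
  let ?ws = "map2 s cs zs @ drop ?m zs"
  have m: "?m < k" "?m < length zs" using snoc.prems assms(3) by auto
  have len: "length ?ws = k" using m assms(3) by simp
  have zs: "zs = take ?m zs @ zs ! ?m # drop (Suc ?m) zs" using m by (simp add: id_take_nth_drop)
  have "length (take ?m zs) = ?m" using m by simp
  then have z: "zip (cs @ [c]) zs = zip cs zs @ [(c, zs ! ?m)]"
    by (subst (1 2) zs) (simp only: zip_append zip_Cons_Cons zip_append1 zip_append2, simp)
  have eq: "map2 s (cs @ [c]) zs @ drop (length (cs @ [c])) zs = ?ws[?m := s c (zs ! ?m)]"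
    using m by (simp add: z list_update_append Cons_nth_drop_Suc[symmetric])
  have id: "?ws[?m := zs ! ?m] = ?ws"
    using m by (simp add: list_update_append Cons_nth_drop_Suc[symmetric])
  have "Vector_Spaces.linear s s (\<lambda>v. f (?ws[?m := v]))"
    using assms(2) len m(1) unfolding graded_multilinear_def by blast
  then interpret L: Vector_Spaces.linear s s "\<lambda>v. f (?ws[?m := v])" .
  have "f (?ws[?m := s c (zs ! ?m)]) = s c (f ?ws)"
    using L.scale[of c "zs ! ?m"] id by simp
  then show ?case using snoc eq by (simp add: mult.commute)
qed

lemma diamond_homogeneous:
  fixes s :: "'k::field \<Rightarrow> 'v::ab_group_add \<Rightarrow> 'v"
  assumes "graded_vector_space s G"
    and "\<And>i. i \<in> {1..k} \<Longrightarrow> graded_multilinear s G s G m k (\<pi> k (R0 i l T))"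
    and "length xs + 1 = k + l" and "1 \<le> l" and "homogeneous G ds xs"
  shows "diamond s G n k l \<pi> \<phi> T xs =
    (\<Sum>i=1..k. s ((-1) powi (n * sum_list (take (i - 1) ds)))
       (\<pi> k (R0 i l T) (insert_op i l (\<phi> l (Ri i l T)) xs)))"
  unfolding diamond_def
proof (rule sum.cong)
  fix i assume i: "i \<in> {1..k}"
  let ?c = "\<lambda>d. (-1 :: 'k) powi (n * d)"
  let ?zs = "insert_op i l (\<phi> l (Ri i l T)) xs" and ?cs = "map ?c (take (i - 1) ds)"
  have ik: "i - 1 \<le> k" "i - 1 < length ?zs" "i - 1 \<le> length xs"
    using i assms(3,4) by (auto simp: insert_op_def)
  have lds: "length ds = length xs" using assms(5) by (simp add: homogeneous_def list_all2_lengthD)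
  have lzs: "length ?zs = k" using i assms(3,4) by (auto simp: insert_op_def)
  have lcs: "length ?cs = i - 1" using i assms(3,4) lds by auto
  have "map (sign_op s G n) (take (i - 1) xs) = map2 s ?cs (take (i - 1) xs)"
  proof (rule nth_equalityI)
    show "length (map (sign_op s G n) (take (i - 1) xs)) = length (map2 s ?cs (take (i - 1) xs))"
      using lds by simp
  next
    fix j assume "j < length (map (sign_op s G n) (take (i - 1) xs))"
    then have j: "j < i - 1" "j < length xs" by auto
    have "xs ! j \<in> G (ds ! j)"
      using assms(5) j lds by (simp add: homogeneous_def list_all2_conv_all_nth)
    then show "map (sign_op s G n) (take (i - 1) xs) ! j = map2 s ?cs (take (i - 1) xs) ! j"
      using j lds sign_op_homogeneous[OF assms(1)] by simp
  qed
  moreover have "map2 s ?cs (take (i - 1) xs) = map2 s ?cs ?zs"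
    using ik lds by (intro nth_equalityI) (auto simp: insert_op_def nth_append)
  moreover have "insert_op i l g (ps @ drop (i - 1) xs) = ps @ drop (i - 1) (insert_op i l g xs)"
    if ps: "length ps = i - 1" for ps g
  proof -
    have "length (take (i - 1) xs) = i - 1" using i assms(3,4) by auto
    moreover have "i + l - 1 = l + (i - 1)" using i by auto
    ultimately show ?thesis using ps by (simp add: insert_op_def)
  qed
  moreover have "length (map (sign_op s G n) (take (i - 1) xs)) = i - 1" using i assms(3,4) by auto
  ultimately have "insert_op i l (\<phi> l (Ri i l T))
      (map (sign_op s G n) (take (i - 1) xs) @ drop (i - 1) xs) =
      map2 s ?cs ?zs @ drop (length ?cs) ?zs"
    using lcs by (simp only:)
  moreover have "prod_list (map ?c es) = ?c (sum_list es)" for es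
    by (induction es) (simp_all add: power_int_add distrib_left)
  ultimately show "\<pi> k (R0 i l T) (insert_op i l (\<phi> l (Ri i l T))
      (map (sign_op s G n) (take (i - 1) xs) @ drop (i - 1) xs)) =
      s ((-1) powi (n * sum_list (take (i - 1) ds))) (\<pi> k (R0 i l T) ?zs)"
    using graded_multilinear_scale_prefix[OF assms(1) assms(2)[OF i] lzs, of ?cs] lcs ik by simp
qed simp

end

theory Submission
  imports Defs
begin

text \<open>
  The identities of a \<open>Triass\<^sub>\<infinity>\<close>-algebra at a tree \<open>T\<close> involve \<open>T\<close> only through its restrictions to
  sets of leaves. Marking each argument with the interval of leaves that it occupies therefore turns tree
  operations into operations on words of letters, for which the insertion product satisfies the usual
  pre-Lie identity and the bracket satisfies the Jacobi identity.

  For the iterated brackets \<open>\<pi>\<^sub>a\<close> of \<open>\<pi>\<close> with \<open>P\<close>, bracketing with \<open>P\<close> takes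
  \<open>S\<^sub>m = \<Sum>\<^bsub>a+b=m\<^esub> [\<pi>\<^sub>a, \<pi>\<^sub>b] / (a! b!)\<close> to \<open>(m + 1) S\<^bsub>m+1\<^esub>\<close>, and \<open>S\<^sub>0 = [\<pi>, \<pi>] = 0\<close> restates the
  axioms of the algebra and its representation. Hence the exponential \<open>E\<close> of \<open>\<pi>\<close> satisfies
  \<open>[E, E] = \<Sum> S\<^sub>m = 0\<close>. It is a finite sum in each arity, since every bracket with \<open>P\<close> replaces an
  input from \<open>A\<close> by inputs from \<open>B\<close> or an output in \<open>B\<close> by one in \<open>A\<close>. The Maurer-Cartan equation says
  that \<open>E\<close> maps words in \<open>B\<close> to \<open>B\<close>, so that \<open>[E, E] = 0\<close> restricts to \<open>B\<close>.
\<close>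

section \<open>Insertion of operations into words\<close>

text \<open>The axioms speak of homogeneous entries, but a degree is not a function of a vector
  (zero has every degree). With a formal degree on each letter all signs become a matter of labels,
  and the pre-Lie identity holds for arbitrary additive maps. The grading enters only through the
  comparison with \<open>diamond\<close>, whose signs use actual degrees. A contracted block keeps
  just its two outer leaves, so iterating \<open>R0\<close> and \<open>Ri\<close> amounts to
  restricting one fixed tree, and no relations among these maps have to be proved. The weight enters
  through cuts between neighbouring subtrees of the root: \<open>l\<close> branches have
  \<open>l - 1\<close> cuts. If the inserted block contains cuts, they merge into a single one of
  the outer tree, which makes the exponent \<open>l - 2\<close> additive. Characteristic zero is
  used three times: for the factorials, for dividing by \<open>m + 1\<close> in the recursion, and
  for dividing by 2 at the end, since [E, E] is twice the composition of E with itself.\<close>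

definition sg :: "int \<Rightarrow> 'v::ab_group_add \<Rightarrow> 'v" where
  "sg n v = (if even n then v else - v)"

lemma sg_simps [simp]: "sg 0 v = v" "sg n 0 = 0" "sg m (sg n v) = sg (m + n) v"
  by (auto simp: sg_def)

lemma sg_add: "sg n (u + v) = sg n u + sg n v"
  by (auto simp: sg_def)

lemma sg_diff: "sg n (u - v) = sg n u - sg n v"
  by (auto simp: sg_def)

lemma sg_cong: "even (m - n) \<Longrightarrow> sg m v = sg n v"
  by (auto simp: sg_def)

text \<open>A letter is a vector together with the leaf labels at which its interval starts and ends and a
  formal degree, which alone determines the signs. An operation on words acts on the vectors;
  \<open>contract\<close> adds the label.\<close>

type_synonym 'v letter = "(nat \<times> nat \<times> int) \<times> 'v"

definition src :: "'v letter \<Rightarrow> nat" where "src x = fst (fst x)"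
definition tgt :: "'v letter \<Rightarrow> nat" where "tgt x = fst (snd (fst x))"
definition dg :: "'v letter \<Rightarrow> int" where "dg x = snd (snd (fst x))"

lemma letter_sel [simp]: "src ((p, q, d), x) = p" "tgt ((p, q, d), x) = q" "dg ((p, q, d), x) = d"
  by (auto simp: src_def tgt_def dg_def)

abbreviation degs :: "'v letter list \<Rightarrow> int" where "degs w \<equiv> sum_list (map dg w)"

definition label :: "int \<Rightarrow> 'v letter list \<Rightarrow> nat \<times> nat \<times> int" where
  "label n v = (src (hd v), tgt (last v), degs v + n)"

definition contract :: "int \<Rightarrow> ('v letter list \<Rightarrow> 'v) \<Rightarrow> 'v letter list \<Rightarrow> 'v letter" where
  "contract n g v = (label n v, g v)"

text \<open>This is the deconcatenation coproduct, empty parts included, followed by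
  \<open>\<Phi>\<close>. Recursion on the word keeps index arithmetic out of the inductions.\<close>

fun cuts :: "('x list \<Rightarrow> 'x list \<Rightarrow> 'w::ab_group_add) \<Rightarrow> 'x list \<Rightarrow> 'w" where
  "cuts \<Phi> [] = \<Phi> [] []"
| "cuts \<Phi> (x # xs) = \<Phi> [] (x # xs) + cuts (\<lambda>u w. \<Phi> (x # u) w) xs"

text \<open>This is the coderivation extending \<open>g\<close>, with the Koszul sign for passing
  the letters on the left, followed by \<open>F\<close>. The first letter either opens the block or
  precedes it; blocks are nonempty.\<close>

fun insertions :: "int \<Rightarrow> ('v letter list \<Rightarrow> 'v) \<Rightarrow> ('v letter list \<Rightarrow> 'w::ab_group_add) \<Rightarrow>
    'v letter list \<Rightarrow> 'w" where
  "insertions n g F [] = 0"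
| "insertions n g F (x # xs) = cuts (\<lambda>u w. F (contract n g (x # u) # w)) xs
     + sg (n * dg x) (insertions n g (\<lambda>z. F (x # z)) xs)"

definition slot_additive :: "('v::ab_group_add letter list \<Rightarrow> 'w::ab_group_add) \<Rightarrow> bool" where
  "slot_additive F \<longleftrightarrow> (\<forall>u l x y w. F (u @ (l, x + y) # w) = F (u @ (l, x) # w) + F (u @ (l, y) # w))"

lemma cuts_cong:
  "(\<And>u w. u @ w = xs \<Longrightarrow> \<Phi> u w = \<Psi> u w) \<Longrightarrow> cuts \<Phi> xs = cuts \<Psi> xs"
proof (induction xs arbitrary: \<Phi> \<Psi>)
  case (Cons x xs)
  have "cuts (\<lambda>u. \<Phi> (x # u)) xs = cuts (\<lambda>u. \<Psi> (x # u)) xs"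
    by (rule Cons.IH) (simp add: Cons.prems)
  then show ?case by (simp add: Cons.prems)
qed simp

lemma cuts_add: "cuts (\<lambda>u w. \<Phi> u w + \<Psi> u w) xs = cuts \<Phi> xs + cuts \<Psi> xs"
  by (induction xs arbitrary: \<Phi> \<Psi>) (simp_all add: algebra_simps)

lemma cuts_additive:
  assumes "\<And>x y. f (x + y) = f x + f y"
  shows "f (cuts \<Phi> xs) = cuts (\<lambda>u w. f (\<Phi> u w)) xs"
  by (induction xs arbitrary: \<Phi>) (simp_all add: assms)

lemma additive_sg:
  fixes f :: "'v::ab_group_add \<Rightarrow> 'w::ab_group_add"
  assumes "\<And>x y. f (x + y) = f x + f y"
  shows "f (sg n x) = sg n (f x)"
proof -
  interpret additive f by (unfold_locales) (rule assms)
  show ?thesis by (simp add: sg_def minus)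
qed

lemma cuts_sg: "cuts (\<lambda>u w. sg n (\<Phi> u w)) xs = sg n (cuts \<Phi> xs)"
  by (rule cuts_additive[symmetric]) (rule sg_add)

text \<open>Both sides run over all ways of cutting the word into three parts.\<close>

lemma cuts_coassoc:
  "cuts (\<lambda>u w. cuts (\<lambda>u' w'. \<Psi> u u' w') w) xs = cuts (\<lambda>u w. cuts (\<lambda>u' w'. \<Psi> u' w' w) u) xs"
proof (induction xs arbitrary: \<Psi>)
  case (Cons x xs)
  show ?case
    by (simp add: Cons cuts_add add.assoc)
qed simp

lemma insertions_cong:
  assumes "\<And>u v w. u @ v @ w = xs \<Longrightarrow> v \<noteq> [] \<Longrightarrow>
      F (u @ contract n g v # w) = G (u @ contract n h v # w)"
  shows "insertions n g F xs = insertions n h G xs"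
  using assms
proof (induction xs arbitrary: F G)
  case (Cons x xs)
  have "cuts (\<lambda>u w. F (contract n g (x # u) # w)) xs = cuts (\<lambda>u w. G (contract n h (x # u) # w)) xs"
    using Cons.prems[of "[]"] by (intro cuts_cong) simp
  moreover have "insertions n g (\<lambda>z. F (x # z)) xs = insertions n h (\<lambda>z. G (x # z)) xs"
    using Cons.prems[of "x # u" for u] by (intro Cons.IH) simp
  ultimately show ?case by simp
qed simp

lemma insertions_add:
  "insertions n g (\<lambda>z. F z + G z) xs = insertions n g F xs + insertions n g G xs"
  by (induction xs arbitrary: F G) (simp_all add: cuts_add sg_add algebra_simps)

lemma insertions_additive:
  assumes "\<And>x y. f (x + y) = f x + f y"
  shows "f (insertions n g F xs) = insertions n g (\<lambda>z. f (F z)) xs"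
proof -
  interpret additive f by (unfold_locales) (rule assms)
  show ?thesis
    by (induction xs arbitrary: F) (simp_all add: assms zero cuts_additive[of f] additive_sg[of f])
qed

lemma insertions_sg: "insertions n g (\<lambda>z. sg m (F z)) xs = sg m (insertions n g F xs)"
  by (rule insertions_additive[symmetric]) (rule sg_add)

text \<open>\<open>insertions\<close> is a coderivation with respect to deconcatenation.\<close>

lemma insertions_cuts:
  "insertions n g (cuts \<Phi>) xs =
     cuts (\<lambda>u w. insertions n g (\<lambda>y. \<Phi> y w) u + sg (n * degs u) (insertions n g (\<Phi> u) w)) xs"
proof (induction xs arbitrary: \<Phi>)
  case (Cons x xs)
  show ?case
    by (simp add: cuts_add insertions_add Cons sg_add cuts_coassoc[of "\<lambda>u u'. \<Phi> (contract n g (x # u) # u')"]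
        cuts_sg distrib_left flip: sg_simps(3))
qed simp

text \<open>An inner contraction moves neither end of the outer block and shifts its degree by
  \<open>n\<close>. Hence contracting in two steps leaves the same label as one contraction by a
  composite of degree \<open>m + n\<close>.\<close>

lemma label_contract:
  "v \<noteq> [] \<Longrightarrow> label m (u @ contract n g v # w) = label (m + n) (u @ v @ w)"
  by (cases u; cases w) (auto simp: label_def contract_def src_def tgt_def dg_def hd_append last_append)

section \<open>The graded commutator of insertions and the pre-Lie identity\<close>

definition word_bracket :: "int \<Rightarrow> int \<Rightarrow> ('v letter list \<Rightarrow> 'v) \<Rightarrow> ('v letter list \<Rightarrow> 'v) \<Rightarrow>
    'v letter list \<Rightarrow> 'v::ab_group_add" where
  "word_bracket m n g h w = insertions n h g w - sg (m * n) (insertions m g h w)"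

lemma slot_additive_Cons: "slot_additive F \<Longrightarrow> slot_additive (\<lambda>z. F (x # z))"
  unfolding slot_additive_def by (metis append_Cons)

lemma slot_additive_hd: "slot_additive F \<Longrightarrow> F ((l, x + y) # w) = F ((l, x) # w) + F ((l, y) # w)"
  unfolding slot_additive_def by (metis append_Nil)

text \<open>The outer block opens with \<open>x\<close>, and the inner block lies within it: it
  contains \<open>x\<close> in the first summand and comes after \<open>x\<close> in the second.
  Additivity of \<open>F\<close> in the contracted slot collects both into one composite
  operation.\<close>

lemma nested_insertions:
  assumes "slot_additive F"
  shows "cuts (\<lambda>u w. cuts (\<lambda>u' w'. F (contract m g (contract n h (x # u) # u') # w')) w) xs
     + sg (n * dg x) (cuts (\<lambda>u w. insertions n h (\<lambda>y. F (contract m g (x # y) # w)) u) xs)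
   = cuts (\<lambda>u w. F ((label (m + n) (x # u), insertions n h g (x # u)) # w)) xs"
proof -
  have add: "F ((l, a + b) # w) = F ((l, a) # w) + F ((l, b) # w)" for l a b w
    using slot_additive_hd[OF assms] .
  have "F ((label (m + n) (x # u), insertions n h g (x # u)) # w)
    = cuts (\<lambda>u' w'. F (contract m g (contract n h (x # u') # w') # w)) u
    + sg (n * dg x) (insertions n h (\<lambda>y. F (contract m g (x # y) # w)) u)" for u w
  proof -
    let ?f = "\<lambda>v. F ((label (m + n) (x # u), v) # w)"
    have "?f (cuts (\<lambda>u' w'. g (contract n h (x # u') # w')) u)
      = cuts (\<lambda>u' w'. ?f (g (contract n h (x # u') # w'))) u"
      by (rule cuts_additive) (rule add)
    also have "\<dots> = cuts (\<lambda>u' w'. F (contract m g (contract n h (x # u') # w') # w)) u"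
      using label_contract[of "x # _" m "[]" n h]
      by (intro cuts_cong) (auto simp: contract_def[of m])
    finally have 1: "?f (cuts (\<lambda>u' w'. g (contract n h (x # u') # w')) u) = \<dots>" .
    have "?f (sg (n * dg x) (insertions n h (\<lambda>y. g (x # y)) u))
      = sg (n * dg x) (insertions n h (\<lambda>y. ?f (g (x # y))) u)"
      by (subst additive_sg[of ?f]) (simp_all add: add insertions_additive[of ?f])
    also have "insertions n h (\<lambda>y. ?f (g (x # y))) u
      = insertions n h (\<lambda>y. F (contract m g (x # y) # w)) u"
      using label_contract[of _ m "x # _" n h]
      by (intro insertions_cong) (auto simp: contract_def[of m])
    finally show ?thesis using 1 by (simp add: add)
  qed
  then show ?thesis
    by (simp add: cuts_add cuts_coassoc[of "\<lambda>u u' w. F (contract m g (contract n h (x # u) # u') # w)"] cuts_sg)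
qed

text \<open>Two successive insertions are nested or disjoint. Disjoint ones occur in both orders
  with signs differing by \<open>sg (m * n)\<close> and cancel in the commutator; nested ones form
  the bracket. In other words, a commutator of coderivations is a coderivation.\<close>

theorem insertions_pre_lie:
  assumes "slot_additive F"
  shows "insertions (m + n) (word_bracket m n g h) F xs =
    insertions n h (insertions m g F) xs - sg (m * n) (insertions m g (insertions n h F) xs)"
  using assms
proof (induction xs arbitrary: F)
  case (Cons x xs)
  have add: "F ((l, a + b) # w) = F ((l, a) # w) + F ((l, b) # w)" for l a b w
    using slot_additive_hd[OF Cons.prems] .
  \<comment> \<open>In \<open>D\<close> the block of \<open>h\<close> opens with \<open>x\<close>
    and that of \<open>g\<close> lies to its right, which costs the sign for passing the contracted
    letter. In \<open>N\<close> the outer block opens with \<open>x\<close> and contains the inner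
    one. The remaining terms leave \<open>x\<close> untouched and belong to the induction
    hypothesis.\<close>
  define D where "D m n g h = cuts (\<lambda>u w. sg (m * (degs (x # u) + n)) (insertions m g (\<lambda>z. F (contract n h (x # u) # z)) w)) xs"
    for m n g h
  define N where "N m n g h = cuts (\<lambda>u w. F ((label (m + n) (x # u), insertions n h g (x # u)) # w)) xs" for m n g h
  have expand: "insertions n h (insertions m g F) (x # xs) =
     N m n g h + D m n g h + sg (m * n) (D n m h g)
     + sg ((m + n) * dg x) (insertions n h (insertions m g (\<lambda>z. F (x # z))) xs)" for m n g h
  proof -
    have "sg (n * dg x) (cuts (\<lambda>u w. sg (n * degs u) (insertions n h (\<lambda>z. F (contract m g (x # u) # z)) w)) xs)
        = sg (m * n) (D n m h g)"
      unfolding D_def cuts_sg[symmetric] sg_simps by (intro cuts_cong sg_cong) (simp add: algebra_simps)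
    moreover have "cuts (\<lambda>u w. sg (m * dg (contract n h (x # u)))
        (insertions m g (\<lambda>z. F (contract n h (x # u) # z)) w)) xs = D m n g h"
      by (simp add: D_def contract_def label_def)
    moreover have "N m n g h =
        cuts (\<lambda>u w. cuts (\<lambda>u' w'. F (contract m g (contract n h (x # u) # u') # w')) w) xs
        + sg (n * dg x) (cuts (\<lambda>u w. insertions n h (\<lambda>y. F (contract m g (x # y) # w)) u) xs)"
      unfolding N_def by (rule nested_insertions[OF Cons.prems, symmetric])
    ultimately show ?thesis
      by (simp add: cuts_add insertions_add insertions_sg insertions_cuts sg_add distrib_right)
        (simp add: algebra_simps)
  qed
  have "F ((l, a - sg i b) # w) = F ((l, a) # w) - sg i (F ((l, b) # w))" for l a b w i
  proof -
    interpret additive "\<lambda>v. F ((l, v) # w)" by (unfold_locales) (rule add)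
    show ?thesis by (simp add: diff additive_sg[of "\<lambda>v. F ((l, v) # w)", OF add])
  qed
  then have "F ((label (m + n) (x # u), word_bracket m n g h (x # u)) # w)
    = F ((label (m + n) (x # u), insertions n h g (x # u)) # w)
      - sg (m * n) (F ((label (n + m) (x # u), insertions m g h (x # u)) # w))" for u w
    by (simp only: word_bracket_def add.commute)
  then have "cuts (\<lambda>u w. F (contract (m + n) (word_bracket m n g h) (x # u) # w)) xs =
    N m n g h - sg (m * n) (N n m h g)"
    using cuts_add[of "\<lambda>u w. F ((label (m + n) (x # u), word_bracket m n g h (x # u)) # w)"
      "\<lambda>u w. sg (m * n) (F ((label (n + m) (x # u), insertions m g h (x # u)) # w))" xs]
    by (simp add: contract_def N_def cuts_sg algebra_simps)
  then have "insertions (m + n) (word_bracket m n g h) F (x # xs) = N m n g h - sg (m * n) (N n m h g)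
      + sg ((m + n) * dg x) (insertions n h (insertions m g (\<lambda>z. F (x # z))) xs)
      - sg (m * n + (m + n) * dg x) (insertions m g (insertions n h (\<lambda>z. F (x # z))) xs)"
    by (simp add: Cons.IH[OF slot_additive_Cons[OF Cons.prems]] sg_diff add.commute[of "m * n"])
  moreover have "sg (m * n + n * m) v = v" for v :: 'b by (simp add: sg_def)
  moreover have "sg (m * n + (n + m) * dg x) v = sg (m * n + (m + n) * dg x) v" for v :: 'b
    by (simp add: add.commute)
  ultimately show ?case
    unfolding expand[of n h m g] expand[of m g n h] by (simp only: sg_add sg_simps) (simp add: algebra_simps)
qed (simp)

section \<open>Restriction of trees to sets of leaves\<close>

lemma leaves_pos: "reduced T \<Longrightarrow> 0 < leaves T"
proof (induction T rule: leaves.induct)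
  case (2 ts)
  then obtain t where "t \<in> set ts" by (cases ts) auto
  with 2 have "0 < leaves t" by simp
  then show ?case using member_le_sum_list[of "leaves t" "map leaves ts"] \<open>t \<in> set ts\<close> by simp
qed simp

lemma prune_regraft: "regraft us = Some T \<Longrightarrow> prune S m T = regraft (prune_list S m us)"
  by (cases us rule: regraft.cases) (auto split: option.splits)

lemma leaves_regraft: "regraft us = Some T \<Longrightarrow> leaves T = sum_list (map leaves us)"
  by (cases us rule: regraft.cases) auto

lemma regraft_None: "regraft us = None \<longleftrightarrow> us = []"
  by (cases us rule: regraft.cases) auto

text \<open>Here \<open>c\<close> is the relabelling of the surviving leaves.\<close>

lemma prune_prune_aux:
  assumes c: "\<And>x. c (Suc x) = (if x \<in> S then c x else Suc (c x))"
  shows "Option.bind (prune S m T) (prune S' (c m)) = prune (S \<union> {x. c x \<in> S'}) m T \<and>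
      c (m + leaves T) = c m + (case prune S m T of None \<Rightarrow> 0 | Some T' \<Rightarrow> leaves T')"
    and "prune_list S' (c m) (prune_list S m ts) = prune_list (S \<union> {x. c x \<in> S'}) m ts \<and>
      c (m + sum_list (map leaves ts)) = c m + sum_list (map leaves (prune_list S m ts))"
using c proof (induction S m T and S m ts rule: prune_prune_list.induct)
  case (1 S m) then show ?case by auto
next
  case (2 S m ts)
  then show ?case
    by (auto simp: regraft_None prune_regraft leaves_regraft split: option.splits bind_splits)
next
  case (3 S m)
  then show ?case by simp
next
  case (4 S m t ts)
  then show ?case
    by (auto split: option.splits bind_splits simp: add.assoc)
qed

lemma reduced_regraft: "regraft us = Some T \<Longrightarrow> (\<forall>u\<in>set us. reduced u) \<Longrightarrow> reduced T"
  by (cases us rule: regraft.cases) auto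

lemma reduced_prune:
  "reduced T \<Longrightarrow> prune S m T = Some T' \<Longrightarrow> reduced T'"
  "\<forall>t\<in>set ts. reduced t \<Longrightarrow> u \<in> set (prune_list S m ts) \<Longrightarrow> reduced u"
proof (induction S m T and S m ts arbitrary: T' and u rule: prune_prune_list.induct)
  case (2 S m ts)
  have "\<forall>u\<in>set (prune_list S m ts). reduced u" using 2 by simp
  then show ?case using 2(3) reduced_regraft by simp
qed (auto split: option.splits if_splits)

lemma prune_none_deleted:
  "reduced T \<Longrightarrow> S \<inter> {m..<m + leaves T} = {} \<Longrightarrow> prune S m T = Some T"
  "\<forall>t\<in>set ts. reduced t \<Longrightarrow> S \<inter> {m..<m + sum_list (map leaves ts)} = {} \<Longrightarrow> prune_list S m ts = ts"
proof (induction S m T and S m ts rule: prune_prune_list.induct)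
  case (2 S m ts)
  moreover have "regraft ts = Some (Node ts)" using 2 by (cases ts rule: regraft.cases) auto
  ultimately show ?case by auto
next
  case (4 S m t ts)
  then have "S \<inter> {m..<m + leaves t} = {}"
     "S \<inter> {m + leaves t..<m + leaves t + sum_list (map leaves ts)} = {}" by auto
  with 4 show ?case by simp
qed auto

section \<open>Iterated restriction of a fixed tree\<close>

definition restr :: "ptree \<Rightarrow> nat list \<Rightarrow> ptree" where
  "restr T ps = delete_leaves (- set ps) T"

lemma restr_all: "T \<in> trees n \<Longrightarrow> restr T [0..<Suc n] = T"
  unfolding restr_def delete_leaves_def trees_def
  by (subst prune_none_deleted) auto

text \<open>Counting the kept labels below \<open>x\<close> is a relabelling of the kind that
  \<open>prune_prune_aux\<close> asks for.\<close>

lemma card_below_Suc: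
  "card {y \<in> A. y < Suc x} = (if x \<notin> A then card {y \<in> A. y < x} else Suc (card {y \<in> A. y < x}))"
proof -
  have "{y \<in> A. y < Suc x} = (if x \<in> A then insert x {y \<in> A. y < x} else {y \<in> A. y < x})"
    by (auto simp: less_Suc_eq)
  then show ?thesis by simp
qed

text \<open>The relabelling at \<open>n + 1\<close> counts all kept labels, hence the remaining
  leaves. As at least one is kept, pruning does not return \<open>None\<close>.\<close>

lemma prune_restr:
  assumes "T \<in> trees n" and "set ps \<subseteq> {..n}" and "ps \<noteq> []"
  shows "prune (- set ps) 0 T = Some (restr T ps)"
    and "leaves (restr T ps) = card (set ps)"
proof -
  let ?c = "\<lambda>x. card {y \<in> set ps. y < x}"
  have c: "?c (Suc x) = (if x \<in> - set ps then ?c x else Suc (?c x))" for x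
    using card_below_Suc[of "set ps" x] by simp
  have "{y \<in> set ps. y < n + 1} = set ps" using assms(2) by auto
  then have *: "card (set ps) = (case prune (- set ps) 0 T of None \<Rightarrow> 0 | Some T' \<Rightarrow> leaves T')"
    using prune_prune_aux(1)[of ?c "- set ps" 0 T, OF c] assms(1) by (simp add: trees_def)
  moreover have "card (set ps) \<noteq> 0" using assms(3) by simp
  ultimately show "prune (- set ps) 0 T = Some (restr T ps)"
    by (auto simp: restr_def delete_leaves_def split: option.splits)
  with * show "leaves (restr T ps) = card (set ps)" by simp
qed

lemma restr_in_trees:
  assumes "T \<in> trees n" and "set ps \<subseteq> {..n}" and "sorted_wrt (<) ps" and "length ps = Suc k"
  shows "restr T ps \<in> trees k"
proof -
  have "ps \<noteq> []" using assms(4) by auto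
  note p = prune_restr[OF assms(1,2) this]
  have "distinct ps" using assms(3) strict_sorted_iff by blast
  then show ?thesis
    using p assms(1,4) reduced_prune(1)[OF _ p(1)] by (auto simp: trees_def distinct_card)
qed

lemma card_below_nth:
  fixes ps :: "nat list"
  assumes "sorted_wrt (<) ps" and "j < length ps"
  shows "card {y \<in> set ps. y < ps ! j} = j"
proof -
  have "{y \<in> set ps. y < ps ! j} = set (take j ps)"
  proof (intro equalityI subsetI)
    fix y assume "y \<in> {y \<in> set ps. y < ps ! j}"
    then obtain i where i: "i < length ps" "y = ps ! i" "ps ! i < ps ! j" by (auto simp: in_set_conv_nth)
    then have "i < j" using sorted_wrt_nth_less[OF assms(1), of j i]
      by (metis linorder_neqE_nat order_less_asym order_less_irrefl)
    with i show "y \<in> set (take j ps)" by (auto simp: in_set_conv_nth)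
  next
    fix y assume "y \<in> set (take j ps)"
    then obtain i where "i < j" "y = ps ! i" by (auto simp: in_set_conv_nth)
    then show "y \<in> {y \<in> set ps. y < ps ! j}"
      using assms(2) sorted_wrt_nth_less[OF assms(1)] by simp
  qed
  moreover have "distinct (take j ps)" using assms(1) strict_sorted_iff distinct_take by blast
  ultimately show ?thesis using assms(2) by (simp add: distinct_card)
qed

text \<open>Two deletions merge into one by \<open>prune_prune_aux\<close>. By
  \<open>card_below_nth\<close> the leaf \<open>ps ! j\<close> is relabelled \<open>j\<close>, so a
  condition on positions in \<open>ps\<close> describes the second deletion.\<close>

lemma delete_restr:
  assumes "T \<in> trees n" and "set ps \<subseteq> {..n}" and "sorted_wrt (<) ps" and "ps \<noteq> []"
    and "\<And>j. j < length ps \<Longrightarrow> ps ! j \<in> set qs \<longleftrightarrow> j \<notin> S" and "set qs \<subseteq> set ps"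
  shows "delete_leaves S (restr T ps) = restr T qs"
proof -
  let ?c = "\<lambda>x. card {y \<in> set ps. y < x}"
  have c: "?c (Suc x) = (if x \<in> - set ps then ?c x else Suc (?c x))" for x
    using card_below_Suc[of "set ps" x] by simp
  have "- set ps \<union> {x. ?c x \<in> S} = - set qs"
  proof -
    have "x \<in> - set ps \<union> {x. ?c x \<in> S} \<longleftrightarrow> x \<in> - set qs" for x
    proof (cases "x \<in> set ps")
      case True
      then obtain j where "j < length ps" "x = ps ! j" by (auto simp: in_set_conv_nth)
      then show ?thesis using assms(5)[of j] card_below_nth[OF assms(3), of j] by simp
    next
      case False
      then show ?thesis using assms(6) by auto
    qed
    then show ?thesis by blast
  qed
  then have "prune S 0 (restr T ps) = prune (- set qs) 0 T"
    using prune_prune_aux(1)[of ?c "- set ps" 0 T S, OF c] prune_restr[OF assms(1,2,4)] by simp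
  then show ?thesis by (simp add: delete_leaves_def restr_def)
qed

lemma nth_in_set_take_iff:
  "distinct ps \<Longrightarrow> j < length ps \<Longrightarrow> ps ! j \<in> set (take i ps) \<longleftrightarrow> j < i"
  by (auto simp: in_set_conv_nth nth_eq_iff_index_eq intro!: exI[of _ j])

lemma nth_in_set_drop_iff:
  assumes "distinct ps" and "j < length ps"
  shows "ps ! j \<in> set (drop i ps) \<longleftrightarrow> i \<le> j"
proof -
  have "set (take i ps) \<inter> set (drop i ps) = {}"
    using assms(1) by (simp add: set_take_disj_set_drop_if_distinct)
  moreover have "ps ! j \<in> set (take i ps) \<union> set (drop i ps)"
    using assms(2) by (metis append_take_drop_id nth_mem set_append)
  ultimately show ?thesis using nth_in_set_take_iff[OF assms, of i] by auto
qed

text \<open>A block of \<open>l\<close> intervals beginning with the \<open>i\<close>-th one has the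
  end points at positions \<open>i - 1\<close> to \<open>i + l - 1\<close>. The inner ones,
  \<open>i\<close> to \<open>i + l - 2\<close>, are those that \<open>R0\<close> deletes;
  \<open>Ri\<close> keeps all \<open>l + 1\<close>.\<close>

lemma R0_restr:
  assumes "T \<in> trees n" and "set ps \<subseteq> {..n}" and "sorted_wrt (<) ps"
    and "1 \<le> i" and "1 \<le> l" and "i + l \<le> length ps"
  shows "R0 i l (restr T ps) = restr T (take i ps @ drop (i + l - 1) ps)"
  unfolding R0_def
proof (rule delete_restr[OF assms(1-3)])
  show "ps \<noteq> []" using assms by auto
  have "distinct ps" using assms(3) strict_sorted_iff by blast
  then show "ps ! j \<in> set (take i ps @ drop (i + l - 1) ps) \<longleftrightarrow> j \<notin> {i..<i + l - 1}"
    if "j < length ps" for j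
    using that by (auto simp: nth_in_set_take_iff nth_in_set_drop_iff)
qed (auto dest: in_set_takeD in_set_dropD)

lemma Ri_restr:
  assumes "T \<in> trees n" and "set ps \<subseteq> {..n}" and "sorted_wrt (<) ps"
    and "1 \<le> i" and "1 \<le> l" and "i + l \<le> length ps"
  shows "Ri i l (restr T ps) = restr T (take (Suc l) (drop (i - 1) ps))"
  unfolding Ri_def
proof (rule delete_restr[OF assms(1-3)])
  show "ps \<noteq> []" using assms by auto
  have d: "distinct ps" using assms(3) strict_sorted_iff by blast
  fix j assume j: "j < length ps"
  let ?qs = "take (Suc l + (i - 1)) ps"
  have 1: "ps ! j \<in> set ?qs \<longleftrightarrow> j < Suc l + (i - 1)"
    using d j by (rule nth_in_set_take_iff)
  have 2: "ps ! j \<in> set (drop (i - 1) ?qs) \<longleftrightarrow> i - 1 \<le> j" if "j < Suc l + (i - 1)"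
    using nth_in_set_drop_iff[of ?qs j "i - 1"] that d j by simp
  have "ps ! j \<in> set (drop (i - 1) ?qs) \<longleftrightarrow> j < Suc l + (i - 1) \<and> i - 1 \<le> j"
    using 1 2 by (meson in_set_dropD)
  then show "ps ! j \<in> set (take (Suc l) (drop (i - 1) ps)) \<longleftrightarrow> j \<notin> - {i - 1..i + l - 1}"
    unfolding take_drop using assms(4) by auto
qed (auto dest: in_set_takeD in_set_dropD)

section \<open>Graded multilinear maps\<close>

lemma sum_additive:
  fixes f :: "'v::ab_group_add \<Rightarrow> 'w::ab_group_add"
  assumes "\<And>x y. f (x + y) = f x + f y"
  shows "f (sum g A) = (\<Sum>a\<in>A. f (g a))"
proof -
  interpret additive f by unfold_locales (rule assms)
  show ?thesis by (rule sum)
qed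

lemma Sum_any_additive:
  fixes f :: "'v::ab_group_add \<Rightarrow> 'w::ab_group_add"
  assumes "\<And>x y. f (x + y) = f x + f y" and "finite {a. g a \<noteq> 0}"
  shows "f (Sum_any g) = Sum_any (\<lambda>a. f (g a))"
proof -
  interpret additive f by unfold_locales (rule assms)
  have "{a. f (g a) \<noteq> 0} \<subseteq> {a. g a \<noteq> 0}" by (auto simp: zero)
  then show ?thesis
    using assms(2) by (subst Sum_any.expand_superset[of "{a. g a \<noteq> 0}"]) (auto simp: Sum_any.expand_set sum)
qed

context
  fixes s :: "'k::field \<Rightarrow> 'v::ab_group_add \<Rightarrow> 'v" and G :: "int \<Rightarrow> 'v set"
  assumes gvs: "graded_vector_space s G"
begin

interpretation vector_space s using gvs by (simp add: graded_vector_space_def)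

lemma homogeneous_subspace: "subspace (G i)"
  using gvs by (simp add: graded_vector_space_def)

lemma is_decomposition_component: "is_decomposition G v (component G v)"
proof -
  have "\<exists>!c. is_decomposition G v c" using gvs by (simp add: graded_vector_space_def)
  then show ?thesis unfolding component_def by (rule theI')
qed

lemma component_unique: "is_decomposition G v c \<Longrightarrow> component G v = c"
proof -
  have "\<exists>!c. is_decomposition G v c" using gvs by (simp add: graded_vector_space_def)
  then show "is_decomposition G v c \<Longrightarrow> component G v = c"
    using is_decomposition_component by blast
qed

lemma component_add: "component G (x + y) = (\<lambda>d. component G x d + component G y d)"
proof (rule component_unique)
  note x = is_decomposition_component[of x, unfolded is_decomposition_def]
  note y = is_decomposition_component[of y, unfolded is_decomposition_def]
  have "{d. component G x d + component G y d \<noteq> 0} \<subseteq> {d. component G x d \<noteq> 0} \<union> {d. component G y d \<noteq> 0}"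
    by auto
  then show "is_decomposition G (x + y) (\<lambda>d. component G x d + component G y d)"
    using x y subspace_add[OF homogeneous_subspace]
    unfolding is_decomposition_def by (auto simp: Sum_any.distrib intro: finite_subset)
qed

lemma component_scale: "component G (s a x) = (\<lambda>d. s a (component G x d))"
proof (rule component_unique)
  note x = is_decomposition_component[of x, unfolded is_decomposition_def]
  have "{d. s a (component G x d) \<noteq> 0} \<subseteq> {d. component G x d \<noteq> 0}"
    by auto
  then show "is_decomposition G (s a x) (\<lambda>d. s a (component G x d))"
    using x finite_subset[of "{d. s a (component G x d) \<noteq> 0}" "{d. component G x d \<noteq> 0}"]
      subspace_scale[OF homogeneous_subspace] Sum_any_additive[of "s a" "component G x"]
    unfolding is_decomposition_def by (simp add: scale_right_distrib)
qed

lemma finite_component: "finite {d. component G x d \<noteq> 0}"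
  using is_decomposition_component by (simp add: is_decomposition_def)

lemma finite_scaled_component: "finite {d. s (f d) (component G x d) \<noteq> 0}"
  by (rule finite_subset[OF _ finite_component[of x]]) auto

lemma linear_sign_op: "Vector_Spaces.linear s s (sign_op s G n)"
  unfolding Vector_Spaces.linear_iff sign_op_def
proof (intro conjI allI)
  show "vector_space s" "vector_space s" by (rule vector_space_axioms)+
next
  fix x y
  show "Sum_any (\<lambda>d. s ((-1) powi (n * d)) (component G (x + y) d)) =
    Sum_any (\<lambda>d. s ((-1) powi (n * d)) (component G x d)) + Sum_any (\<lambda>d. s ((-1) powi (n * d)) (component G y d))"
    unfolding component_add scale_right_distrib
    by (rule Sum_any.distrib) (rule finite_scaled_component)+
next
  fix c x
  have "Sum_any (\<lambda>d. s c (s ((-1) powi (n * d)) (component G x d))) = s c (Sum_any (\<lambda>d. s ((-1) powi (n * d)) (component G x d)))"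
    by (rule Sum_any_additive[symmetric]) (simp_all add: scale_right_distrib finite_component del: scale_scale)
  then show "Sum_any (\<lambda>d. s ((-1) powi (n * d)) (component G (s c x) d)) =
    s c (Sum_any (\<lambda>d. s ((-1) powi (n * d)) (component G x d)))"
    by (simp add: component_scale mult.commute)
qed

lemma sign_op_0: "sign_op s G 0 = (\<lambda>x. x)"
  using is_decomposition_component by (auto simp: sign_op_def is_decomposition_def)

lemma sign_op_in: "x \<in> G d \<Longrightarrow> sign_op s G n x \<in> G d"
  by (simp add: sign_op_homogeneous[OF gvs] subspace_scale[OF homogeneous_subspace])

end


section \<open>Multilinearity in single slots and its stability under insertion\<close>

lemma graded_multilinear_iff:
  "graded_multilinear s G s' G' d k f \<longleftrightarrow>
    (\<forall>u w. length u + length w + 1 = k \<longrightarrow> Vector_Spaces.linear s s' (\<lambda>v. f (u @ v # w))) \<and>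
    (\<forall>ds xs. length xs = k \<longrightarrow> homogeneous G ds xs \<longrightarrow> f xs \<in> G' (sum_list ds + d))"
    (is "_ \<longleftrightarrow> ?lin \<and> ?hom")
proof -
  have "(\<forall>xs. length xs = k \<longrightarrow> (\<forall>j<k. Vector_Spaces.linear s s' (\<lambda>v. f (xs[j := v])))) \<longleftrightarrow> ?lin"
  proof (intro iffI allI impI)
    fix u w :: "'b list"
    assume *: "\<forall>xs. length xs = k \<longrightarrow> (\<forall>j<k. Vector_Spaces.linear s s' (\<lambda>v. f (xs[j := v])))"
      and k: "length u + length w + 1 = k"
    from *[rule_format, of "u @ 0 # w" "length u"] k
    show "Vector_Spaces.linear s s' (\<lambda>v. f (u @ v # w))" by simp
  next
    fix xs :: "'b list" and j
    assume *: ?lin and "length xs = k" "j < k"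
    with *[rule_format, of "take j xs" "drop (Suc j) xs"]
    show "Vector_Spaces.linear s s' (\<lambda>v. f (xs[j := v]))"
      by (simp add: upd_conv_take_nth_drop)
  qed
  then show ?thesis by (simp add: graded_multilinear_def)
qed

lemma graded_multilinear_slot:
  "graded_multilinear s G s' G' d k f \<Longrightarrow> length u + length w + 1 = k \<Longrightarrow>
    Vector_Spaces.linear s s' (\<lambda>v. f (u @ v # w))"
  by (simp add: graded_multilinear_iff)

lemma graded_multilinear_in:
  "graded_multilinear s G s' G' d k f \<Longrightarrow> length xs = k \<Longrightarrow> homogeneous G ds xs \<Longrightarrow> f xs \<in> G' (sum_list ds + d)"
  by (simp add: graded_multilinear_iff)

lemma linear_const_0: "vector_space s \<Longrightarrow> vector_space s' \<Longrightarrow> Vector_Spaces.linear s s' (\<lambda>v. 0)"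
  by (simp add: Vector_Spaces.linear_iff module.scale_zero_right module_iff_vector_space)

lemma graded_multilinear_add:
  assumes "graded_vector_space s' G'"
    and "graded_multilinear s G s' G' d k f" and "graded_multilinear s G s' G' d k g"
  shows "graded_multilinear s G s' G' d k (\<lambda>xs. f xs + g xs)"
proof -
  interpret vector_space s' using assms(1) by (simp add: graded_vector_space_def)
  show ?thesis
    using assms(2,3) subspace_add[OF homogeneous_subspace[OF assms(1)]]
    by (simp add: graded_multilinear_iff Vector_Spaces.linear_iff scale_right_distrib)
qed

lemma graded_multilinear_scale:
  assumes "graded_vector_space s' G'" and "graded_multilinear s G s' G' d k f"
  shows "graded_multilinear s G s' G' d k (\<lambda>xs. s' c (f xs))"
proof -
  interpret vector_space s' using assms(1) by (simp add: graded_vector_space_def)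
  show ?thesis
    using assms(2) subspace_scale[OF homogeneous_subspace[OF assms(1)]]
    by (simp add: graded_multilinear_iff Vector_Spaces.linear_iff scale_right_distrib mult.commute)
qed

lemma graded_multilinear_0:
  assumes "graded_vector_space s G" and "graded_vector_space s' G'"
  shows "graded_multilinear s G s' G' d k (\<lambda>xs. 0)"
  using assms homogeneous_subspace[OF assms(2)] module.subspace_0[of s']
  by (simp add: graded_multilinear_iff linear_const_0 graded_vector_space_def module_iff_vector_space)

lemma graded_multilinear_sum:
  assumes "graded_vector_space s G" and "graded_vector_space s' G'"
    and "\<And>a. a \<in> A \<Longrightarrow> graded_multilinear s G s' G' d k (f a)"
  shows "graded_multilinear s G s' G' d k (\<lambda>xs. \<Sum>a\<in>A. f a xs)"
  using assms(3)
  by (induction A rule: infinite_finite_induct)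
    (auto intro: graded_multilinear_0[OF assms(1,2)] graded_multilinear_add[OF assms(2)])

lemma graded_multilinear_diff:
  assumes "graded_vector_space s' G'"
    and "graded_multilinear s G s' G' d k f" and "graded_multilinear s G s' G' d k g"
  shows "graded_multilinear s G s' G' d k (\<lambda>xs. f xs - g xs)"
proof -
  interpret vector_space s' using assms(1) by (simp add: graded_vector_space_def)
  show ?thesis
    using graded_multilinear_add[OF assms(1,2) graded_multilinear_scale[OF assms(1,3), of "-1"]]
    by simp
qed

lemma insert_op_append:
  "length a + 1 = i \<Longrightarrow> length b = l \<Longrightarrow> insert_op i l g (a @ b @ c) = a @ g b # c"
  by (auto simp: insert_op_def)

lemma homogeneous_append:
  "homogeneous G ds (a @ b) \<longleftrightarrow> (\<exists>da db. ds = da @ db \<and> homogeneous G da a \<and> homogeneous G db b)"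
  by (simp add: homogeneous_def list_all2_append2) (metis list_all2_lengthD)

lemma homogeneous_append_Cons:
  "homogeneous G da a \<Longrightarrow> x \<in> G d \<Longrightarrow> homogeneous G db b \<Longrightarrow> homogeneous G (da @ d # db) (a @ x # b)"
  by (auto simp: homogeneous_def intro: list_all2_appendI)

lemma graded_multilinear_insert:
  assumes gvs: "graded_vector_space s G"
    and f: "graded_multilinear s G s G m k f" and g: "graded_multilinear s G s G n l g"
    and "1 \<le> i" "i \<le> k"
  shows "graded_multilinear s G s G (m + n) (k + l - 1)
    (\<lambda>xs. f (insert_op i l g (map (sign_op s G j) (take (i - 1) xs) @ drop (i - 1) xs)))"
    (is "graded_multilinear s G s G (m + n) (k + l - 1) ?t")
proof -
  let ?\<sigma> = "sign_op s G j"
  have \<sigma>: "Vector_Spaces.linear s s ?\<sigma>" using gvs by (rule linear_sign_op)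
  have t: "?t (a @ b @ c) = f (map ?\<sigma> a @ g b # c)" if "length a = i - 1" "length b = l" for a b c
    using that assms(4) insert_op_append[of "map ?\<sigma> a" i b l g c] by simp
  have split: "\<exists>a b c. xs = a @ b @ c \<and> length a = i - 1 \<and> length b = l \<and> length c = k - i"
    if "length xs = k + l - 1" for xs :: "'b list"
    using that assms(4,5)
    by (intro exI[of _ "take (i - 1) xs"] exI[of _ "take l (drop (i - 1) xs)"] exI[of _ "drop (i - 1 + l) xs"])
      (auto simp: drop_take simp flip: append_assoc take_add)
  show ?thesis unfolding graded_multilinear_iff
  proof (intro conjI allI impI)
    fix u w :: "'b list" assume len: "length u + length w + 1 = k + l - 1"
    \<comment> \<open>The slot lies to the left of the block, inside it, or to its right; only in
      the first case does the sign operator act on it.\<close>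
    consider "length u < i - 1" | "i - 1 \<le> length u" "length u < i - 1 + l" | "i - 1 + l \<le> length u" by linarith
    then show "Vector_Spaces.linear s s (\<lambda>v. ?t (u @ v # w))"
    proof cases
      case 1
      \<comment> \<open>The \<open>i - 1\<close> letters before the block are \<open>u\<close>, the
        slot and \<open>?a\<close>.\<close>
      let ?a = "take (i - 2 - length u) w" and ?w = "drop (i - 2 - length u) w"
      let ?b = "take l ?w" and ?c = "drop l ?w"
      have "u @ v # w = (u @ v # ?a) @ ?b @ ?c" for v
        by (simp only: append_take_drop_id append_assoc append_Cons)
      then have "?t (u @ v # w) = f (map ?\<sigma> u @ ?\<sigma> v # (map ?\<sigma> ?a @ g ?b # ?c))" for v
        using 1 len assms(5) by (simp only:) (subst t; simp)
      moreover have "Vector_Spaces.linear s s (\<lambda>v. f (map ?\<sigma> u @ v # (map ?\<sigma> ?a @ g ?b # ?c)))"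
        using 1 len assms(4,5) by (intro graded_multilinear_slot[OF f]) simp
      ultimately show ?thesis using \<sigma> by (simp add: Vector_Spaces.linear_iff)
    next
      case 2
      let ?a = "take (i - 1) u" and ?b = "drop (i - 1) u"
      let ?b' = "take (l - 1 - length ?b) w" and ?c = "drop (l - 1 - length ?b) w"
      have "u @ v # w = ?a @ (?b @ v # ?b') @ ?c" for v
        by (metis append_take_drop_id append_assoc append_Cons)
      then have "?t (u @ v # w) = f (map ?\<sigma> ?a @ g (?b @ v # ?b') # ?c)" for v
        using 2 len assms(4,5) by (simp only:) (subst t; auto simp: min_def)
      moreover have "Vector_Spaces.linear s s (\<lambda>v. f (map ?\<sigma> ?a @ v # ?c))"
        using 2 len assms(4,5) by (intro graded_multilinear_slot[OF f]) simp
      moreover have "Vector_Spaces.linear s s (\<lambda>v. g (?b @ v # ?b'))"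
        using 2 len assms(4,5) by (intro graded_multilinear_slot[OF g]) simp
      ultimately show ?thesis by (simp add: Vector_Spaces.linear_iff)
    next
      case 3
      let ?a = "take (i - 1) u" and ?u = "drop (i - 1) u"
      let ?b = "take l ?u" and ?c = "drop l ?u"
      have "u @ v # w = ?a @ ?b @ (?c @ v # w)" for v
        by (metis append_take_drop_id append_assoc)
      then have "?t (u @ v # w) = f ((map ?\<sigma> ?a @ g ?b # ?c) @ v # w)" for v
        using 3 len assms(5) by (simp only:) (subst t; simp)
      moreover have "Vector_Spaces.linear s s (\<lambda>v. f ((map ?\<sigma> ?a @ g ?b # ?c) @ v # w))"
        using 3 len assms(4,5) by (intro graded_multilinear_slot[OF f]) simp
      ultimately show ?thesis by simp
    qed
  next
    fix ds and xs :: "'b list" assume len: "length xs = k + l - 1" and hom: "homogeneous G ds xs"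
    obtain a b c where xs: "xs = a @ b @ c" "length a = i - 1" "length b = l" "length c = k - i"
      using split[OF len] by blast
    obtain da db dc where ds: "ds = da @ db @ dc" "homogeneous G da a" "homogeneous G db b" "homogeneous G dc c"
      using hom by (auto simp: xs(1) homogeneous_append)
    have "g b \<in> G (sum_list db + n)"
      by (rule graded_multilinear_in[OF g xs(3) ds(3)])
    moreover have "homogeneous G da (map ?\<sigma> a)"
      using ds(2) sign_op_in[OF gvs] by (auto simp: homogeneous_def list_all2_conv_all_nth)
    ultimately have "f (map ?\<sigma> a @ g b # c) \<in> G (sum_list (da @ (sum_list db + n) # dc) + m)"
      using xs ds assms(4,5) by (intro graded_multilinear_in[OF f] homogeneous_append_Cons) auto
    then show "?t xs \<in> G (sum_list ds + (m + n))"
      by (simp only: t[OF xs(2,3)] xs(1) ds(1)) (simp add: algebra_simps)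
  qed
qed

text \<open>A tree is its own restriction to all its leaves, so the formulas for restrictions
  apply.\<close>

lemma sublist_trees:
  assumes "T \<in> trees n" and "k + l = n + 1" and "1 \<le> l" and "1 \<le> i" and "i \<le> k"
  shows "R0 i l T \<in> trees k" and "Ri i l T \<in> trees l"
proof -
  have ps: "set [0..<Suc n] \<subseteq> {..n}" "sorted_wrt (<) [0..<Suc n]"
    by (auto simp del: upt_Suc)
  let ?qs = "take i [0..<Suc n] @ drop (i + l - 1) [0..<Suc n]"
  let ?rs = "take (Suc l) (drop (i - 1) [0..<Suc n])"
  have "R0 i l T = restr T ?qs"
    using R0_restr[OF assms(1) ps assms(4,3)] assms by (simp add: restr_all del: upt_Suc)
  moreover have "restr T ?qs \<in> trees k"
    using assms by (intro restr_in_trees[OF assms(1)]) (auto simp: sorted_wrt_append take_upt simp del: upt_Suc)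
  ultimately show "R0 i l T \<in> trees k" by simp
  have "Ri i l T = restr T ?rs"
    using Ri_restr[OF assms(1) ps assms(4,3)] assms by (simp add: restr_all del: upt_Suc)
  moreover have "restr T ?rs \<in> trees l"
    using assms by (intro restr_in_trees[OF assms(1)]) (auto simp: take_upt simp del: upt_Suc)
  ultimately show "Ri i l T \<in> trees l" by simp
qed

lemma tree_hom_diamond:
  assumes gvs: "graded_vector_space s G" and "tree_hom s G s G m \<pi>" and "tree_hom s G s G n \<phi>"
    and "T \<in> trees r" and "(k, l) \<in> arity_splits r"
  shows "graded_multilinear s G s G (m + n) r (diamond s G j k l \<pi> \<phi> T)"
proof -
  have r: "r = k + l - 1" "1 \<le> k" "1 \<le> l" "k + l = r + 1" using assms(5) by (auto simp: arity_splits_def)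
  show ?thesis
    unfolding diamond_def
  proof (rule graded_multilinear_sum[OF gvs gvs])
    fix i assume i: "i \<in> {1..k}"
    then show "graded_multilinear s G s G (m + n) r (\<lambda>xs. \<pi> k (R0 i l T)
        (insert_op i l (\<phi> l (Ri i l T)) (map (sign_op s G j) (take (i - 1) xs) @ drop (i - 1) xs)))"
      unfolding r(1)
      using sublist_trees[OF assms(4) r(4,3), of i] assms(2,3) r(2,3)
      by (intro graded_multilinear_insert[OF gvs]) (auto simp: tree_hom_def)
  qed
qed

lemma tree_hom_bracket:
  assumes gvs: "graded_vector_space s G" and "tree_hom s G s G m \<pi>" and "tree_hom s G s G n \<phi>"
  shows "tree_hom s G s G (m + n) (bracket s G m n \<pi> \<phi>)"
  unfolding tree_hom_def bracket_def
proof (intro allI impI ballI graded_multilinear_sum[OF gvs gvs])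
  fix r T and kl :: "nat \<times> nat" assume T: "T \<in> trees r" and kl: "kl \<in> arity_splits r"
  obtain k l where [simp]: "kl = (k, l)" by (cases kl)
  have "(l, k) \<in> arity_splits r" using kl by (auto simp: arity_splits_def)
  from tree_hom_diamond[OF assms(1,3,2) T this, of m] tree_hom_diamond[OF assms T, of k l n] kl
  show "graded_multilinear s G s G (m + n) r (\<lambda>xs. case kl of (k, l) \<Rightarrow>
      diamond s G n k l \<pi> \<phi> T xs - s ((- 1) powi (m * n)) (diamond s G m l k \<phi> \<pi> T xs))"
    by (auto intro!: graded_multilinear_diff[OF gvs] graded_multilinear_scale[OF gvs] simp: add.commute)
qed

section \<open>The direct sum of two graded vector spaces\<close>

lemma linear_Pair:
  assumes "Vector_Spaces.linear s sA f" and "Vector_Spaces.linear s sB g"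
  shows "Vector_Spaces.linear s (prod_scale sA sB) (\<lambda>v. (f v, g v))"
proof -
  interpret vector_space_prod sA sB
    using assms by (simp add: vector_space_prod_def vector_space_pair_def Vector_Spaces.linear_iff)
  show ?thesis using assms p.vector_space_axioms by (simp add: Vector_Spaces.linear_iff scale_prod)
qed

context
  fixes sA :: "'k::field \<Rightarrow> 'a::ab_group_add \<Rightarrow> 'a" and GA :: "int \<Rightarrow> 'a set"
    and sB :: "'k \<Rightarrow> 'b::ab_group_add \<Rightarrow> 'b" and GB :: "int \<Rightarrow> 'b set"
  assumes gvsA: "graded_vector_space sA GA" and gvsB: "graded_vector_space sB GB"
begin

interpretation vector_space_prod sA sB
  using gvsA gvsB by (simp add: vector_space_prod_def vector_space_pair_def graded_vector_space_def)

lemma prod_scale_Pair [simp]: "prod_scale sA sB c (a, b) = (sA c a, sB c b)"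
  by (rule scale_prod)

lemma is_decomposition_prod:
  "is_decomposition (prod_grading GA GB) v c \<longleftrightarrow>
    is_decomposition GA (fst v) (\<lambda>d. fst (c d)) \<and> is_decomposition GB (snd v) (\<lambda>d. snd (c d))"
proof -
  have "{d. c d \<noteq> 0} = {d. fst (c d) \<noteq> 0} \<union> {d. snd (c d) \<noteq> 0}"
    by (auto simp: prod_eq_iff)
  then have fin: "finite {d. c d \<noteq> 0} \<longleftrightarrow> finite {d. fst (c d) \<noteq> 0} \<and> finite {d. snd (c d) \<noteq> 0}"
    by simp
  moreover have "fst (Sum_any c) = Sum_any (\<lambda>d. fst (c d))" "snd (Sum_any c) = Sum_any (\<lambda>d. snd (c d))"
    if "finite {d. c d \<noteq> 0}"
    using that by (auto intro: Sum_any_additive)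
  ultimately show ?thesis
    unfolding is_decomposition_def mem_Times_iff prod_eq_iff[of v] by metis
qed

lemma component_prod:
  "is_decomposition (prod_grading GA GB) v (\<lambda>d. (component GA (fst v) d, component GB (snd v) d))"
  by (simp add: is_decomposition_prod is_decomposition_component[OF gvsA] is_decomposition_component[OF gvsB])

lemma graded_vector_space_prod: "graded_vector_space (prod_scale sA sB) (prod_grading GA GB)"
  unfolding graded_vector_space_def
proof (intro conjI allI)
  fix v show "\<exists>!c. is_decomposition (prod_grading GA GB) v c"
  proof (rule ex1I, rule component_prod)
    fix c assume "is_decomposition (prod_grading GA GB) v c"
    then show "c = (\<lambda>d. (component GA (fst v) d, component GB (snd v) d))"
      by (auto simp: is_decomposition_prod component_unique[OF gvsA] component_unique[OF gvsB])
  qed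
next
  show "vector_space (prod_scale sA sB)" by (rule p.vector_space_axioms)
  show "p.subspace (GA i \<times> GB i)" for i
    by (rule subspace_Times) (rule homogeneous_subspace[OF gvsA] homogeneous_subspace[OF gvsB])+
qed

lemma sign_op_prod:
  "sign_op (prod_scale sA sB) (prod_grading GA GB) n v = (sign_op sA GA n (fst v), sign_op sB GB n (snd v))"
proof -
  let ?f = "\<lambda>d. prod_scale sA sB ((-1) powi (n * d)) (component (prod_grading GA GB) v d)"
  have c: "component (prod_grading GA GB) v = (\<lambda>d. (component GA (fst v) d, component GB (snd v) d))"
    by (rule component_unique[OF graded_vector_space_prod component_prod])
  have "finite {d. ?f d \<noteq> 0}"
    by (rule finite_scaled_component[OF graded_vector_space_prod])
  then have "fst (Sum_any ?f) = Sum_any (\<lambda>d. fst (?f d))" "snd (Sum_any ?f) = Sum_any (\<lambda>d. snd (?f d))"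
    by (auto intro: Sum_any_additive)
  then show ?thesis by (simp add: sign_op_def c prod_eq_iff)
qed

end

section \<open>Tree operations as operations on words\<close>

text \<open>For adjoining intervals these are all end points, one more than there are letters,
  matching the \<open>k + 1\<close> leaves of a tree in \<open>trees k\<close>.\<close>

fun points :: "'v letter list \<Rightarrow> nat list" where
  "points [] = []"
| "points (x # xs) = src x # map tgt (x # xs)"

text \<open>A chain is a word whose intervals are nonempty, adjoin one another and end at or before leaf \<open>n\<close>.
  With the tree \<open>T\<close> fixed, \<open>lift\<close> replaces the tree argument of an operation by the restriction of
  \<open>T\<close> to the end points of the intervals; \<open>R0\<close> and \<open>Ri\<close> then disappear from all formulas.\<close>

definition chain :: "nat \<Rightarrow> 'v letter list \<Rightarrow> bool" where
  "chain n w \<longleftrightarrow> (\<forall>x\<in>set w. src x < tgt x \<and> tgt x \<le> n) \<and> successively (\<lambda>x y. tgt x = src y) w"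

definition lift :: "nat \<Rightarrow> ptree \<Rightarrow> ('v, 'w::zero) tree_ops \<Rightarrow> 'v letter list \<Rightarrow> 'w" where
  "lift n T \<phi> w = (if chain n w \<and> w \<noteq> [] then \<phi> (length w) (restr T (points w)) (map snd w) else 0)"

lemma chain_sublist: "chain n (u @ v @ w) \<Longrightarrow> chain n v"
  by (auto simp: chain_def successively_append_iff)

lemma chain_src_tgt: "chain n v \<Longrightarrow> v \<noteq> [] \<Longrightarrow> src (hd v) < tgt (last v)"
proof (induction v)
  case (Cons x v)
  show ?case
  proof (cases v)
    case (Cons y ys)
    then have "chain n v" "tgt x = src (hd v)" "src x < tgt x"
      using Cons.prems by (auto simp: chain_def)
    then show ?thesis using Cons.IH Cons by simp
  qed (use Cons.prems in \<open>simp add: chain_def\<close>)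
qed simp

lemma contract_sel [simp]:
  "src (contract j g v) = src (hd v)" "tgt (contract j g v) = tgt (last v)"
  "dg (contract j g v) = degs v + j" "snd (contract j g v) = g v"
  by (auto simp: contract_def label_def src_def tgt_def dg_def)

lemma chain_contract:
  assumes "chain n (u @ v @ w)" and "v \<noteq> []"
  shows "chain n (u @ contract j g v # w)"
proof -
  have "src (hd v) < tgt (last v)" "tgt (last v) \<le> n"
    using assms chain_src_tgt[OF chain_sublist[OF assms(1)]] by (auto simp: chain_def)
  then show ?thesis
    using assms by (auto simp: chain_def successively_append_iff successively_Cons)
qed

lemma points_sorted:
  assumes "chain n w"
  shows "sorted_wrt (<) (points w)" and "set (points w) \<subseteq> {..n}"
proof -
  have "sorted_wrt (<) (points w) \<and> (w \<noteq> [] \<longrightarrow> hd (points w) = src (hd w))"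
    using assms
  proof (induction w)
    case (Cons x w)
    show ?case
    proof (cases w)
      case (Cons y ys)
      then have c: "chain n w" "tgt x = src y" "src x < tgt x"
        using Cons.prems by (auto simp: chain_def)
      then have "sorted_wrt (<) (src y # map tgt w)" using Cons.IH Cons by simp
      then show ?thesis using c Cons by auto
    qed (use Cons.prems in \<open>simp add: chain_def\<close>)
  qed simp
  then show "sorted_wrt (<) (points w)" by simp
  show "set (points w) \<subseteq> {..n}"
    using assms by (cases w) (auto simp: chain_def dest: order_less_le_trans less_imp_le_nat)
qed

lemma length_points: "w \<noteq> [] \<Longrightarrow> length (points w) = Suc (length w)"
  by (cases w) auto

text \<open>Only the end points inside the block disappear, exactly as under \<open>R0\<close> in
  \<open>R0_restr\<close>.\<close>

lemma points_contract:
  "v \<noteq> [] \<Longrightarrow> points (u @ contract j g v # w) =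
    take (Suc (length u)) (points (u @ v @ w)) @ drop (length u + length v) (points (u @ v @ w))"
proof -
  assume v: "v \<noteq> []"
  then obtain v' y where "v = v' @ [y]" by (metis rev_exhaust)
  then show ?thesis by (cases u; cases v') auto
qed

text \<open>A block starts where the letter before it ends, so its end points are consecutive in
  those of the whole word; this is the list in \<open>Ri_restr\<close>.\<close>

lemma points_sublist:
  assumes "chain n (u @ v @ w)" and "v \<noteq> []"
  shows "points v = take (Suc (length v)) (drop (length u) (points (u @ v @ w)))"
proof (cases u rule: rev_cases)
  case Nil
  then show ?thesis using assms(2) by (cases v) auto
next
  case (snoc u' x)
  moreover obtain y v' where v: "v = y # v'" using assms(2) by (cases v) auto
  ultimately have "tgt x = src y" using assms(1) by (auto simp: chain_def successively_append_iff)
  then show ?thesis using snoc v by (cases u') auto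
qed

text \<open>Ties the formal degrees, which fix the signs, to the grading.\<close>

definition homog :: "(int \<Rightarrow> 'v set) \<Rightarrow> 'v letter list \<Rightarrow> bool" where
  "homog G w \<longleftrightarrow> (\<forall>x\<in>set w. snd x \<in> G (dg x))"

lemma homog_iff: "homog G w \<longleftrightarrow> homogeneous G (map dg w) (map snd w)"
  by (auto simp: homog_def homogeneous_def list_all2_map1 list_all2_map2 list_all2_same)

section \<open>Sums over arities and positions as sums over blocks of a word\<close>

lemma cuts_eq_sum: "cuts \<Phi> xs = (\<Sum>m\<le>length xs. \<Phi> (take m xs) (drop m xs))"
  by (induction xs arbitrary: \<Phi>) (simp_all add: sum.atMost_Suc_shift del: sum.atMost_Suc)

lemma insertions_eq_sum:
  "insertions j g F xs = (\<Sum>i<length xs. \<Sum>m<length xs - i.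
     sg (j * degs (take i xs)) (F (take i xs @ contract j g (take (Suc m) (drop i xs)) # drop (i + Suc m) xs)))"
proof (induction xs arbitrary: F)
  case (Cons x xs)
  have "insertions j g F (x # xs) = (\<Sum>m\<le>length xs. F (contract j g (x # take m xs) # drop m xs))
    + (\<Sum>i<length xs. \<Sum>m<length xs - i. sg (j * dg x)
      (sg (j * degs (take i xs)) (F (x # take i xs @ contract j g (take (Suc m) (drop i xs)) # drop (i + Suc m) xs))))"
    by (simp only: insertions.simps cuts_eq_sum Cons sum_additive[of "sg _", OF sg_add])
  also have "\<dots> = (\<Sum>i<length (x # xs). \<Sum>m<length (x # xs) - i. sg (j * degs (take i (x # xs)))
      (F (take i (x # xs) @ contract j g (take (Suc m) (drop i (x # xs))) # drop (i + Suc m) (x # xs))))"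
    using sum.lessThan_Suc_shift[of "\<lambda>i. \<Sum>m<length (x # xs) - i. sg (j * degs (take i (x # xs)))
      (F (take i (x # xs) @ contract j g (take (Suc m) (drop i (x # xs))) # drop (i + Suc m) (x # xs)))" "length xs"]
    by (simp add: lessThan_Suc_atMost distrib_left)
  finally show ?case .
qed simp

text \<open>With \<open>j = 1\<close> and equal operations this is the left-hand side of the
  identities of a Triass-infinity algebra.\<close>

definition compose_sum :: "('k::field \<Rightarrow> 'v::ab_group_add \<Rightarrow> 'v) \<Rightarrow> int \<Rightarrow>
    ('v, 'v) tree_ops \<Rightarrow> ('v, 'v) tree_ops \<Rightarrow> nat \<Rightarrow> ptree \<Rightarrow> int list \<Rightarrow> 'v list \<Rightarrow> 'v" where
  "compose_sum s j \<pi> \<phi> r T ds xs = (\<Sum>(k, l)\<in>arity_splits r. \<Sum>i=1..k.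
     s ((-1) powi (j * sum_list (take (i - 1) ds))) (\<pi> k (R0 i l T) (insert_op i l (\<phi> l (Ri i l T)) xs)))"

text \<open>A pair of arities with a position is the same as a nonempty block of the word. For that
  block \<open>R0\<close> and \<open>Ri\<close> give the restrictions of \<open>T\<close> to the end
  points of the contracted word and of the block, which are the trees that \<open>lift\<close>
  supplies.\<close>

lemma compose_sum_eq_insertions:
  assumes T: "T \<in> trees n" and w: "chain n w" "w \<noteq> []" and s: "vector_space s"
  shows "compose_sum s j \<pi> \<phi> (length w) (restr T (points w)) (map dg w) (map snd w) =
    insertions j (lift n T \<phi>) (lift n T \<pi>) w"
proof -
  interpret vector_space s by (rule s)
  let ?r = "length w"
  \<comment> \<open>The outer arity is eliminated as \<open>?r + 1 - l\<close>. The sum is then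
    reindexed by the number \<open>i\<close> of letters before the block and its length
    \<open>Suc m\<close>.\<close>
  let ?t = "\<lambda>i l. s ((-1) powi (j * sum_list (take (i - 1) (map dg w))))
      (\<pi> (?r + 1 - l) (R0 i l (restr T (points w))) (insert_op i l (\<phi> l (Ri i l (restr T (points w)))) (map snd w)))"
  have t: "?t (Suc i) (Suc m) = sg (j * degs (take i w)) (lift n T \<pi>
      (take i w @ contract j (lift n T \<phi>) (take (Suc m) (drop i w)) # drop (i + Suc m) w))"
    if "i < ?r" "m < ?r - i" for i m
  proof -
    define u v z where uvz: "u = take i w" "v = take (Suc m) (drop i w)" "z = drop (i + Suc m) w"
    have weq: "w = u @ v @ z" unfolding uvz
      by (metis append_take_drop_id drop_drop add.commute)
    have len: "length u = i" "length v = Suc m" "v \<noteq> []" "?r = i + Suc m + length z" using that by (auto simp: uvz)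
    have ch: "chain n (u @ v @ z)" using w weq by simp
    note ps = points_sorted[OF w(1)]
    have "R0 (Suc i) (Suc m) (restr T (points w)) = restr T (points (u @ contract j (lift n T \<phi>) v # z))"
      by (subst R0_restr[OF T ps(2,1)])
        (use len w points_contract[OF len(3), of u j _ z, folded weq] in \<open>simp_all add: length_points\<close>)
    moreover have "Ri (Suc i) (Suc m) (restr T (points w)) = restr T (points v)"
      by (subst Ri_restr[OF T ps(2,1)])
        (use len w points_sublist[OF ch len(3), folded weq] in \<open>simp_all add: length_points\<close>)
    moreover have "lift n T \<phi> v = \<phi> (Suc m) (restr T (points v)) (map snd v)"
      using len chain_sublist[OF ch] by (simp add: lift_def)
    moreover have "insert_op (Suc i) (Suc m) h (map snd w) = map snd u @ h (map snd v) # map snd z" for h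
      using len insert_op_append[of "map snd u" "Suc i" "map snd v" "Suc m" h "map snd z"] by (simp add: weq)
    moreover have "?r + 1 - Suc m = length (u @ contract j (lift n T \<phi>) v # z)"
      using len by simp
    moreover have "s ((-1) powi a) x = sg a x" for a x
      by (cases "even a") (auto simp: sg_def power_int_minus_one_minus)
    moreover have "take (Suc i - 1) (map dg w) = map dg u" by (simp add: uvz take_map)
    ultimately show ?thesis
      unfolding uvz[symmetric] lift_def[of n T \<pi>]
      using chain_contract[OF ch len(3)] by simp
  qed
  have "compose_sum s j \<pi> \<phi> ?r (restr T (points w)) (map dg w) (map snd w) =
    (\<Sum>(p, i)\<in>(SIGMA p:arity_splits ?r. {1..fst p}). ?t i (snd p))"
    unfolding compose_sum_def
    by (subst sum.Sigma[symmetric]) (auto intro!: sum.cong simp: arity_splits_def intro: finite_subset[of _ "{..?r} \<times> {..?r}"],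
      metis add_diff_cancel_right')
  also have "\<dots> = (\<Sum>(i, m)\<in>(SIGMA i:{..<?r}. {..<?r - i}). ?t (Suc i) (Suc m))"
    by (rule sum.reindex_bij_witness[of _ "\<lambda>(i, m). ((?r - m, Suc m), Suc i)" "\<lambda>(p, i). (i - 1, snd p - 1)"])
      (auto simp: arity_splits_def)
  also have "\<dots> = (\<Sum>i<?r. \<Sum>m<?r - i. ?t (Suc i) (Suc m))"
    by (subst sum.Sigma) auto
  also have "\<dots> = insertions j (lift n T \<phi>) (lift n T \<pi>) w"
    unfolding insertions_eq_sum by (intro sum.cong refl t) auto
  finally show ?thesis .
qed

section \<open>The Jacobi identity and the exponential\<close>

lemma chain_cong: "map fst w = map fst w' \<Longrightarrow> chain n w = chain n w'"
proof -
  have "chain n w \<longleftrightarrow> (\<forall>x\<in>set (map fst w). fst x < fst (snd x) \<and> fst (snd x) \<le> n) \<and>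
    successively (\<lambda>x y. fst (snd x) = fst y) (map fst w)" for w :: "'v letter list"
    by (simp add: chain_def src_def tgt_def successively_map)
  then show "map fst w = map fst w' \<Longrightarrow> ?thesis" by metis
qed

lemma points_cong: "map fst w = map fst w' \<Longrightarrow> points w = points w'"
proof -
  have "points w = (if map fst w = [] then [] else fst (hd (map fst w)) # map (\<lambda>x. fst (snd x)) (map fst w))"
    for w :: "'v letter list"
    by (cases w) (auto simp: src_def tgt_def)
  then show "map fst w = map fst w' \<Longrightarrow> ?thesis" by metis
qed

lemma lift_slot:
  assumes "tree_hom s G s G m \<phi>" and "T \<in> trees n"
  obtains f where "Vector_Spaces.linear s s f" and "\<And>x. lift n T \<phi> (u @ (l, x) # w) = f x"
proof (cases "chain n (u @ (l, 0) # w)")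
  case True
  let ?T = "restr T (points (u @ (l, 0) # w))" and ?k = "length u + length w + 1"
  have "?T \<in> trees ?k"
    using points_sorted[OF True] by (intro restr_in_trees[OF assms(2)]) (auto simp: length_points)
  then have "Vector_Spaces.linear s s (\<lambda>x. \<phi> ?k ?T (map snd u @ x # map snd w))"
    using assms(1) by (intro graded_multilinear_slot) (auto simp: tree_hom_def)
  moreover have "lift n T \<phi> (u @ (l, x) # w) = \<phi> ?k ?T (map snd u @ x # map snd w)" for x
    using True chain_cong[of "u @ (l, x) # w" "u @ (l, 0) # w" n] points_cong[of "u @ (l, x) # w" "u @ (l, 0) # w"]
    by (simp add: lift_def)
  ultimately show ?thesis using that by blast
next
  case False
  \<comment> \<open>Here only the zero map is needed, but its linearity presupposes a vector space.
    This is extracted from multilinearity at the tree with two leaves.\<close>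
  have "graded_multilinear s G s G m 1 (\<phi> 1 (Node [Leaf, Leaf]))"
    using assms(1) by (auto simp: tree_hom_def trees_def)
  then have "Vector_Spaces.linear s s (\<lambda>v. \<phi> 1 (Node [Leaf, Leaf]) ([] @ v # []))"
    by (rule graded_multilinear_slot) simp
  then have "vector_space s" by (simp add: Vector_Spaces.linear_iff)
  then have "Vector_Spaces.linear s s (\<lambda>v. 0)" by (simp add: linear_const_0)
  moreover have "lift n T \<phi> (u @ (l, x) # w) = 0" for x
    using False chain_cong[of "u @ (l, x) # w" "u @ (l, 0) # w" n] by (simp add: lift_def)
  ultimately show ?thesis using that by blast
qed

lemma slot_additive_lift:
  assumes "tree_hom s G s G m \<phi>" and "T \<in> trees n"
  shows "slot_additive (lift n T \<phi>)"
  unfolding slot_additive_def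
proof (intro allI)
  fix u :: "'b letter list" and l w x y
  show "lift n T \<phi> (u @ (l, x + y) # w) = lift n T \<phi> (u @ (l, x) # w) + lift n T \<phi> (u @ (l, y) # w)"
    by (rule lift_slot[OF assms, of u l w]) (simp add: Vector_Spaces.linear_iff)
qed

lemma lift_slot_sum:
  assumes "tree_hom s G s G m \<phi>" and "T \<in> trees n"
  shows "lift n T \<phi> (u @ (l, \<Sum>a\<in>A. s (c a) (y a)) # w) = (\<Sum>a\<in>A. s (c a) (lift n T \<phi> (u @ (l, y a) # w)))"
proof (rule lift_slot[OF assms, of u l w])
  fix f assume "Vector_Spaces.linear s s f" and *: "\<And>x. lift n T \<phi> (u @ (l, x) # w) = f x"
  then have "f (x + y) = f x + f y" "f (s c x) = s c (f x)" for x y c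
    by (simp_all add: Vector_Spaces.linear_iff)
  then show ?thesis by (simp add: * sum_additive)
qed

lemma insertions_diff: "insertions j g (\<lambda>z. F z - F' z) w = insertions j g F w - insertions j g F' w"
  by (simp add: insertions_eq_sum sum_subtractf sg_diff)

lemma insertions_sum:
  "insertions j g (\<lambda>z. \<Sum>a\<in>A. F a z) w = (\<Sum>a\<in>A. insertions j g (F a) w)"
proof (induction A rule: infinite_finite_induct)
  case (insert x A)
  then show ?case by (simp add: insertions_add)
qed (simp_all add: insertions_eq_sum)

lemma insertions_scale:
  assumes "vector_space s"
  shows "insertions j g (\<lambda>z. s c (F z)) w = s c (insertions j g F w)"
proof -
  interpret vector_space s by (rule assms)
  show ?thesis by (rule insertions_additive[symmetric]) (rule scale_right_distrib)
qed

lemma sg_scale: "vector_space s \<Longrightarrow> sg n (s c x) = s c (sg n x)"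
  by (rule additive_sg[of "s c" n x, symmetric]) (simp add: vector_space_def)

lemma insertions_sum_left:
  assumes "tree_hom s G s G m \<phi>" and "T \<in> trees n" and s: "vector_space s"
  shows "insertions j (\<lambda>v. \<Sum>a\<in>A. s (c a) (g a v)) (lift n T \<phi>) w =
    (\<Sum>a\<in>A. s (c a) (insertions j (g a) (lift n T \<phi>) w))"
proof -
  interpret vector_space s by (rule s)
  show ?thesis
    by (simp add: insertions_eq_sum contract_def lift_slot_sum[OF assms(1,2)] sum_additive[of "sg _", OF sg_add]
        sg_scale[OF s] scale_sum_right sum.swap[of _ A])
qed

section \<open>Words with matching degrees and the bracket on them\<close>

definition good :: "nat \<Rightarrow> (int \<Rightarrow> 'v set) \<Rightarrow> 'v letter list \<Rightarrow> bool" where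
  "good n G w \<longleftrightarrow> chain n w \<and> homog G w"

lemma good_sublist: "good n G (u @ v @ w) \<Longrightarrow> good n G v"
  using chain_sublist by (auto simp: good_def homog_def)

lemma good_contract:
  "good n G (u @ v @ w) \<Longrightarrow> v \<noteq> [] \<Longrightarrow> g v \<in> G (degs v + j) \<Longrightarrow> good n G (u @ contract j g v # w)"
  using chain_contract by (auto simp: good_def homog_def)

text \<open>Tree and word brackets are compared on good words only. The degree condition on
  \<open>g\<close> keeps the contracted word good, so that the hypothesis on \<open>F\<close>
  applies to it.\<close>

lemma good_insertions_cong:
  assumes "good n G w"
    and "\<And>z. good n G z \<Longrightarrow> F z = F' z"
    and "\<And>v. good n G v \<Longrightarrow> v \<noteq> [] \<Longrightarrow> g v = g' v"
    and "\<And>v. good n G v \<Longrightarrow> v \<noteq> [] \<Longrightarrow> g v \<in> G (degs v + j)"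
  shows "insertions j g F w = insertions j g' F' w"
proof (rule insertions_cong)
  fix u v z assume *: "u @ v @ z = w" "v \<noteq> []"
  then have v: "good n G v" using assms(1) good_sublist by blast
  have "F (u @ contract j g v # z) = F' (u @ contract j g v # z)"
    using * assms v by (intro assms(2) good_contract) auto
  then show "F (u @ contract j g v # z) = F' (u @ contract j g' v # z)"
    using assms(3)[OF v *(2)] by (simp add: contract_def)
qed

lemma lift_in:
  assumes "tree_hom s G s G m \<phi>" and "T \<in> trees n" and "good n G v" and "v \<noteq> []"
  shows "lift n T \<phi> v \<in> G (degs v + m)"
proof -
  have ch: "chain n v" "homogeneous G (map dg v) (map snd v)"
    using assms(3) by (auto simp: good_def homog_iff)
  have "restr T (points v) \<in> trees (length v)"
    using points_sorted[OF ch(1)] length_points[OF assms(4)] by (intro restr_in_trees[OF assms(2)])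
  moreover have "1 \<le> length v" using assms(4) by (cases v) auto
  ultimately have "graded_multilinear s G s G m (length v) (\<phi> (length v) (restr T (points v)))"
    using assms(1) by (simp add: tree_hom_def)
  from graded_multilinear_in[OF this length_map ch(2)] show ?thesis
    using assms(4) ch(1) by (simp add: lift_def)
qed

lemma compose_sum_eq_diamond:
  assumes gvs: "graded_vector_space s G" and "tree_hom s G s G m \<pi>"
    and "T \<in> trees r" and "length xs = r" and "homogeneous G ds xs"
  shows "(\<Sum>(k, l)\<in>arity_splits r. diamond s G j k l \<pi> \<phi> T xs) = compose_sum s j \<pi> \<phi> r T ds xs"
  unfolding compose_sum_def
proof (intro sum.cong refl, clarsimp)
  fix k l assume kl: "(k, l) \<in> arity_splits r"
  then have "graded_multilinear s G s G m k (\<pi> k (R0 i l T))" if "i \<in> {1..k}" for i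
    using sublist_trees(1)[OF assms(3), of k l i] assms(2) that by (auto simp: arity_splits_def tree_hom_def)
  then show "diamond s G j k l \<pi> \<phi> T xs = (\<Sum>i = Suc 0..k. s ((- 1) powi (j * sum_list (take (i - Suc 0) ds)))
         (\<pi> k (R0 i l T) (insert_op i l (\<phi> l (Ri i l T)) xs)))"
    using diamond_homogeneous[OF gvs, of k m \<pi> l T xs ds j \<phi>] kl assms(4,5) by (auto simp: arity_splits_def)
qed

text \<open>On good words the formal degrees are actual degrees, so the signs in
  \<open>diamond\<close> and in \<open>insertions\<close> agree.\<close>

lemma lift_bracket:
  assumes gvs: "graded_vector_space s G" and \<pi>: "tree_hom s G s G m \<pi>" and \<phi>: "tree_hom s G s G j \<phi>"
    and T: "T \<in> trees n" and w: "good n G w"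
  shows "lift n T (bracket s G m j \<pi> \<phi>) w = word_bracket m j (lift n T \<pi>) (lift n T \<phi>) w"
proof (cases "w = []")
  case True
  then show ?thesis by (simp add: lift_def word_bracket_def)
next
  case False
  interpret vector_space s using gvs by (simp add: graded_vector_space_def)
  have ch: "chain n w" "homogeneous G (map dg w) (map snd w)"
    using w by (auto simp: good_def homog_iff)
  let ?r = "length w" and ?T = "restr T (points w)" and ?xs = "map snd w"
  have T': "?T \<in> trees ?r"
    using points_sorted[OF ch(1)] length_points[OF False] by (intro restr_in_trees[OF T])
  have sg: "s ((-1) powi a) x = sg a x" for a x
    by (cases "even a") (auto simp: sg_def power_int_minus_one_minus)
  \<comment> \<open>The second product in \<open>bracket\<close> runs over the splits with the
    arities exchanged.\<close>
  have swap: "(\<Sum>(k, l)\<in>arity_splits ?r. diamond s G m l k \<phi> \<pi> ?T ?xs) = (\<Sum>(k, l)\<in>arity_splits ?r. diamond s G m k l \<phi> \<pi> ?T ?xs)"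
    by (rule sum.reindex_bij_witness[of _ prod.swap prod.swap]) (auto simp: arity_splits_def)
  have "bracket s G m j \<pi> \<phi> ?r ?T ?xs =
    (\<Sum>(k, l)\<in>arity_splits ?r. diamond s G j k l \<pi> \<phi> ?T ?xs)
    - sg (m * j) (\<Sum>(k, l)\<in>arity_splits ?r. diamond s G m l k \<phi> \<pi> ?T ?xs)"
    by (simp add: bracket_def sg sum_subtractf case_prod_beta sum_additive[of "sg _", OF sg_add])
  also have "\<dots> = word_bracket m j (lift n T \<pi>) (lift n T \<phi>) w"
    unfolding swap compose_sum_eq_diamond[OF gvs \<pi> T' length_map ch(2)]
      compose_sum_eq_diamond[OF gvs \<phi> T' length_map ch(2)]
    by (simp add: compose_sum_eq_insertions[OF T ch(1) False vector_space_axioms] word_bracket_def)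
  finally show ?thesis using ch(1) False by (simp add: lift_def)
qed

section \<open>Iterated brackets with \<open>P\<close> and their exponential\<close>

definition ad_iter :: "('k::field \<Rightarrow> 'v::ab_group_add \<Rightarrow> 'v) \<Rightarrow> (int \<Rightarrow> 'v set) \<Rightarrow>
    ('v, 'v) tree_ops \<Rightarrow> ('v, 'v) tree_ops \<Rightarrow> nat \<Rightarrow> ('v, 'v) tree_ops" where
  "ad_iter s G \<pi> P a = ((\<lambda>X. bracket s G 1 0 X P) ^^ a) \<pi>"

text \<open>A truncation stands in for the series; in bounded arity a large \<open>N\<close> gives
  the same value.\<close>

definition exp_ad :: "('k::field_char_0 \<Rightarrow> 'v::ab_group_add \<Rightarrow> 'v) \<Rightarrow> (int \<Rightarrow> 'v set) \<Rightarrow>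
    ('v, 'v) tree_ops \<Rightarrow> ('v, 'v) tree_ops \<Rightarrow> nat \<Rightarrow> ('v, 'v) tree_ops" where
  "exp_ad s G \<pi> P N k T xs = (\<Sum>a\<le>N. s (1 / fact a) (ad_iter s G \<pi> P a k T xs))"

lemma tree_hom_ad_iter:
  assumes "graded_vector_space s G" and "tree_hom s G s G 1 \<pi>" and "tree_hom s G s G 0 P"
  shows "tree_hom s G s G 1 (ad_iter s G \<pi> P a)"
  using tree_hom_bracket[OF assms(1) _ assms(3), of 1] by (induction a) (simp_all add: ad_iter_def assms(2))

lemma tree_hom_exp_ad:
  assumes "graded_vector_space s G" and "tree_hom s G s G 1 \<pi>" and "tree_hom s G s G 0 P"
  shows "tree_hom s G s G 1 (exp_ad s G \<pi> P N)"
  using tree_hom_ad_iter[OF assms] unfolding tree_hom_def exp_ad_def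
  by (auto intro!: graded_multilinear_sum[OF assms(1,1)] graded_multilinear_scale[OF assms(1)])

context
  fixes s :: "'k::field_char_0 \<Rightarrow> 'v::ab_group_add \<Rightarrow> 'v" and G :: "int \<Rightarrow> 'v set"
    and \<pi> P :: "('v, 'v) tree_ops" and T :: ptree and n :: nat
  assumes gvs: "graded_vector_space s G"
    and \<pi>: "tree_hom s G s G 1 \<pi>" and P: "tree_hom s G s G 0 P"
    and T: "T \<in> trees n"
begin

interpretation vector_space s using gvs by (simp add: graded_vector_space_def)

lemmas hom_ad_iter = tree_hom_ad_iter[OF gvs \<pi> P]

definition ad_word :: "nat \<Rightarrow> 'v letter list \<Rightarrow> 'v" where "ad_word a = lift n T (ad_iter s G \<pi> P a)"

definition "P_word = lift n T P"

lemma ad_word_Suc: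
  "good n G w \<Longrightarrow> ad_word (Suc a) w = word_bracket 1 0 (ad_word a) P_word w"
  using lift_bracket[OF gvs hom_ad_iter P T] by (simp add: ad_word_def P_word_def ad_iter_def)

lemma slot_additive_words: "slot_additive (ad_word a)" "slot_additive P_word"
  by (simp_all add: ad_word_def P_word_def slot_additive_lift[OF hom_ad_iter T] slot_additive_lift[OF P T])

lemma ad_P_words_in:
  "good n G v \<Longrightarrow> v \<noteq> [] \<Longrightarrow> ad_word a v \<in> G (degs v + 1)"
  "good n G v \<Longrightarrow> v \<noteq> [] \<Longrightarrow> P_word v \<in> G (degs v + 0)"
  unfolding ad_word_def P_word_def by (rule lift_in[OF hom_ad_iter T] lift_in[OF P T]; assumption)+

definition "ad_word_bracket a b = word_bracket 1 1 (ad_word a) (ad_word b)"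

lemma word_bracket_1_1: "word_bracket 1 1 g h w = insertions 1 h g w + insertions 1 g h w"
  by (simp add: word_bracket_def sg_def)

lemma word_bracket_1_0: "word_bracket 1 0 g h w = insertions 0 h g w - insertions 1 g h w"
  by (simp add: word_bracket_def sg_def)

text \<open>As outer operation the bracket expands by additivity; as inserted operation it needs the
  pre-Lie identity.\<close>

lemma insertions_ad_Suc:
  assumes "good n G w"
  shows "insertions 1 (ad_word b) (ad_word (Suc a)) w = insertions 1 (ad_word b) (insertions 0 P_word (ad_word a)) w
      - insertions 1 (ad_word b) (insertions 1 (ad_word a) P_word) w"
    and "insertions 1 (ad_word (Suc a)) (ad_word b) w = insertions 0 P_word (insertions 1 (ad_word a) (ad_word b)) w
      - insertions 1 (ad_word a) (insertions 0 P_word (ad_word b)) w"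
proof -
  have "insertions 1 (ad_word b) (ad_word (Suc a)) w = insertions 1 (ad_word b) (word_bracket 1 0 (ad_word a) P_word) w"
    by (intro good_insertions_cong[OF assms]) (auto simp: ad_word_Suc ad_P_words_in(1))
  then show "insertions 1 (ad_word b) (ad_word (Suc a)) w = insertions 1 (ad_word b) (insertions 0 P_word (ad_word a)) w
      - insertions 1 (ad_word b) (insertions 1 (ad_word a) P_word) w"
    by (simp add: word_bracket_1_0[abs_def] insertions_diff)
  have "insertions 1 (ad_word (Suc a)) (ad_word b) w = insertions (1 + 0) (word_bracket 1 0 (ad_word a) P_word) (ad_word b) w"
    by (simp, intro good_insertions_cong[OF assms]) (auto simp: ad_word_Suc[symmetric] ad_P_words_in(1))
  then show "insertions 1 (ad_word (Suc a)) (ad_word b) w = insertions 0 P_word (insertions 1 (ad_word a) (ad_word b)) w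
      - insertions 1 (ad_word a) (insertions 0 P_word (ad_word b)) w"
    unfolding insertions_pre_lie[OF slot_additive_words(1)] by simp
qed

text \<open>Bracketing with \<open>P\<close> is a derivation of the bracket. After expansion the
  terms that insert one operation into the other with \<open>P\<close> already composed into the
  latter, such as \<open>insertions 1 (ad_word b) (insertions 0 P_word (ad_word a))\<close>, cancel
  between the two summands.\<close>

lemma jacobi_words:
  assumes "good n G w"
  shows "insertions 0 P_word (ad_word_bracket a b) w - insertions 2 (ad_word_bracket a b) P_word w = ad_word_bracket (Suc a) b w + ad_word_bracket a (Suc b) w"
proof -
  have "insertions 2 (ad_word_bracket a b) P_word w = insertions 1 (ad_word b) (insertions 1 (ad_word a) P_word) w
      + insertions 1 (ad_word a) (insertions 1 (ad_word b) P_word) w"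
    using insertions_pre_lie[OF slot_additive_words(2), of 1 1 "ad_word a" "ad_word b" w]
    by (simp add: ad_word_bracket_def sg_def)
  moreover have "insertions 0 P_word (ad_word_bracket a b) w = insertions 0 P_word (insertions 1 (ad_word b) (ad_word a)) w
      + insertions 0 P_word (insertions 1 (ad_word a) (ad_word b)) w"
    by (simp add: ad_word_bracket_def word_bracket_1_1[abs_def] insertions_add)
  ultimately show ?thesis
    by (simp add: ad_word_bracket_def word_bracket_1_1 insertions_ad_Suc[OF assms])
qed

private abbreviation (input) "inv_facts a b \<equiv> (1 :: 'k) / (fact a * fact b)"

lemma sum_ad_word_bracket_eq_0:
  assumes mc: "\<And>w. good n G w \<Longrightarrow> insertions 1 (lift n T \<pi>) (lift n T \<pi>) w = 0"
    and "good n G w"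
  shows "(\<Sum>a\<le>m. s (inv_facts a (m - a)) (ad_word_bracket a (m - a) w)) = 0"
  using assms(2)
proof (induction m arbitrary: w)
  case 0
  then show ?case using mc[OF 0] by (simp add: ad_word_bracket_def word_bracket_1_1 ad_word_def ad_iter_def)
next
  case (Suc m)
  let ?S = "\<lambda>w. \<Sum>a\<le>m. s (inv_facts a (m - a)) (ad_word_bracket a (m - a) w)"
  let ?c = "\<lambda>a. inv_facts a (Suc m - a)"
  have G0: "0 \<in> G d" for d using homogeneous_subspace[OF gvs] subspace_0 by blast
  have "insertions 0 P_word ?S w = insertions 0 P_word (\<lambda>z. 0) w"
    using Suc.IH ad_P_words_in(2) by (intro good_insertions_cong[OF Suc.prems]) auto
  \<comment> \<open>The zero operation is written as an empty sum, so that
    \<open>insertions_sum_left\<close> evaluates its insertions to zero.\<close>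
  moreover have "insertions 2 ?S P_word w = insertions 2 (\<lambda>v. \<Sum>a\<in>({} :: nat set). s 1 0) P_word w"
    using Suc.IH G0 by (intro good_insertions_cong[OF Suc.prems]) auto
  ultimately have "0 = insertions 0 P_word ?S w - insertions 2 ?S P_word w"
    unfolding P_word_def insertions_sum_left[OF P T vector_space_axioms] by (simp add: insertions_eq_sum)
  also have "\<dots> = (\<Sum>a\<le>m. s (inv_facts a (m - a)) (insertions 0 P_word (ad_word_bracket a (m - a)) w - insertions 2 (ad_word_bracket a (m - a)) P_word w))"
    unfolding insertions_sum insertions_scale[OF vector_space_axioms] scale_right_diff_distrib sum_subtractf
    unfolding P_word_def insertions_sum_left[OF P T vector_space_axioms] ..
  also have "\<dots> = (\<Sum>a\<le>m. s (inv_facts a (m - a)) (ad_word_bracket (Suc a) (m - a) w)) + (\<Sum>a\<le>m. s (inv_facts a (m - a)) (ad_word_bracket a (Suc m - a) w))"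
    by (simp add: jacobi_words[OF Suc.prems] scale_right_distrib sum.distrib Suc_diff_le)
  \<comment> \<open>After the index shift the new term at \<open>a = 0\<close> has coefficient zero;
    in the other sum the same happens at \<open>a = Suc m\<close>. The two factors \<open>a\<close>
    and \<open>Suc m - a\<close> add up to \<open>Suc m\<close>.\<close>
  also have "(\<Sum>a\<le>m. s (inv_facts a (m - a)) (ad_word_bracket (Suc a) (m - a) w)) = (\<Sum>a\<le>Suc m. s (of_nat a * ?c a) (ad_word_bracket a (Suc m - a) w))"
    by (simp add: sum.atMost_Suc_shift del: sum.atMost_Suc of_nat_Suc)
  also have "(\<Sum>a\<le>m. s (inv_facts a (m - a)) (ad_word_bracket a (Suc m - a) w)) = (\<Sum>a\<le>Suc m. s (of_nat (Suc m - a) * ?c a) (ad_word_bracket a (Suc m - a) w))"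
  proof -
    have "of_nat (Suc m - a) * ?c a = inv_facts a (m - a)" if "a \<le> m" for a
      using that by (simp add: Suc_diff_le del: of_nat_Suc of_nat_diff)
    then show ?thesis by simp
  qed
  also have "(\<Sum>a\<le>Suc m. s (of_nat a * ?c a) (ad_word_bracket a (Suc m - a) w)) + \<dots> = (\<Sum>a\<le>Suc m. s (of_nat (Suc m)) (s (?c a) (ad_word_bracket a (Suc m - a) w)))"
    unfolding sum.distrib[symmetric]
  proof (intro sum.cong refl)
    fix a assume "a \<in> {..Suc m}"
    then have "of_nat a + of_nat (Suc m - a) = (of_nat (Suc m) :: 'k)" by (simp flip: of_nat_add)
    then show "s (of_nat a * ?c a) (ad_word_bracket a (Suc m - a) w) + s (of_nat (Suc m - a) * ?c a) (ad_word_bracket a (Suc m - a) w) =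
      s (of_nat (Suc m)) (s (?c a) (ad_word_bracket a (Suc m - a) w))"
      by (simp only: scale_left_distrib[symmetric] distrib_right[symmetric] scale_scale)
  qed
  also have "\<dots> = s (of_nat (Suc m)) (\<Sum>a\<le>Suc m. s (?c a) (ad_word_bracket a (Suc m - a) w))"
    by (simp only: scale_sum_right)
  finally have "s (of_nat (Suc m)) (\<Sum>a\<le>Suc m. s (?c a) (ad_word_bracket a (Suc m - a) w)) = 0" ..
  then show ?case by (simp only: scale_eq_0_iff of_nat_eq_0_iff) simp
qed

lemma lift_exp_ad: "lift n T (exp_ad s G \<pi> P N) w = (\<Sum>a\<le>N. s (1 / fact a) (ad_word a w))"
  by (cases "chain n w \<and> w \<noteq> []") (auto simp: lift_def exp_ad_def ad_word_def)

text \<open>The end points of a chain are distinct leaves among \<open>0\<close> to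
  \<open>n\<close>, and there is one more of them than letters. Hence a bound valid in arities up to
  \<open>n\<close> covers all chains.\<close>

lemma length_le_chain: "chain n w \<Longrightarrow> length w \<le> n"
proof (cases "w = []")
  case False
  assume "chain n w"
  note ps = points_sorted[OF this]
  have "distinct (points w)" using ps(1) strict_sorted_iff by blast
  then have "Suc (length w) \<le> card {..n}"
    using card_mono[OF _ ps(2)] length_points[OF False] distinct_card by fastforce
  then show ?thesis by simp
qed simp

lemma insertions_exp_ad:
  assumes mc: "\<And>w. good n G w \<Longrightarrow> insertions 1 (lift n T \<pi>) (lift n T \<pi>) w = 0"
    and N: "\<And>a k U xs. a > N \<Longrightarrow> 1 \<le> k \<Longrightarrow> k \<le> n \<Longrightarrow> U \<in> trees k \<Longrightarrow> length xs = k \<Longrightarrow> ad_iter s G \<pi> P a k U xs = 0"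
    and w: "good n G w"
  shows "insertions 1 (lift n T (exp_ad s G \<pi> P N)) (lift n T (exp_ad s G \<pi> P N)) w = 0"
proof -
  have zero: "ad_word a v = 0" if "a > N" for a v
  proof (cases "chain n v \<and> v \<noteq> []")
    case True
    moreover have "restr T (points v) \<in> trees (length v)"
      using points_sorted[of n v] length_points[of v] True by (intro restr_in_trees[OF T]) simp_all
    moreover have "1 \<le> length v" "length v \<le> n"
      using length_le_chain[of v] True by (auto simp: Suc_le_eq)
    ultimately show ?thesis using N[OF that, of "length v"] by (simp add: ad_word_def lift_def)
  qed (auto simp: ad_word_def lift_def)
  have L0: "insertions 1 (ad_word b) (ad_word a) w = 0" if "a > N \<or> b > N" for a b
  proof (cases "a > N")
    case True
    then have "ad_word a = (\<lambda>z. 0)" using zero by auto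
    then show ?thesis by (simp add: insertions_eq_sum)
  next
    case False
    then have "ad_word b = (\<lambda>z. 0)" using zero that by auto
    then show ?thesis unfolding ad_word_def[of a]
      using insertions_sum_left[OF hom_ad_iter T vector_space_axioms, where A = "{} :: nat set"] by simp
  qed
  let ?f = "\<lambda>a b. s (inv_facts a b) (insertions 1 (ad_word b) (ad_word a) w)"
  let ?h = "\<lambda>a b. s (inv_facts a b) (ad_word_bracket a b w)"
  have "insertions 1 (lift n T (exp_ad s G \<pi> P N)) (lift n T (exp_ad s G \<pi> P N)) w = (\<Sum>a\<le>N. \<Sum>b\<le>N. ?f a b)"
    unfolding lift_exp_ad[abs_def] insertions_sum insertions_scale[OF vector_space_axioms]
    unfolding ad_word_def insertions_sum_left[OF hom_ad_iter T vector_space_axioms]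
    by (simp add: scale_sum_right mult.commute)
  \<comment> \<open>Both operations have degree one, so their bracket is a sum of two compositions;
    exchanging the summation indices makes the two totals equal.\<close>
  moreover have "(\<Sum>a\<le>N. \<Sum>b\<le>N. ?f a b) + (\<Sum>a\<le>N. \<Sum>b\<le>N. ?f a b) = (\<Sum>a\<le>N. \<Sum>b\<le>N. ?h a b)"
    by (subst (2) sum.swap)
      (simp add: sum.distrib[symmetric] ad_word_bracket_def word_bracket_1_1 scale_right_distrib mult.commute add.commute)
  \<comment> \<open>Terms outside the square vanish by \<open>L0\<close>, so the square may be
    enlarged to a triangle, a union of full antidiagonals, on each of which
    \<open>sum_ad_word_bracket_eq_0\<close> applies.\<close>
  moreover have "(\<Sum>a\<le>N. \<Sum>b\<le>N. ?h a b) = (\<Sum>(a, b)\<in>{(a, b). a + b \<le> 2 * N}. ?h a b)"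
    unfolding sum.cartesian_product
  proof (rule sum.mono_neutral_left)
    show "finite {(a, b). a + b \<le> 2 * N}"
      by (rule finite_subset[of _ "{..2 * N} \<times> {..2 * N}"]) auto
    show "\<forall>i\<in>{(a, b). a + b \<le> 2 * N} - {..N} \<times> {..N}. (case i of (a, b) \<Rightarrow> ?h a b) = 0"
    proof
      fix p assume "p \<in> {(a, b). a + b \<le> 2 * N} - {..N} \<times> {..N}"
      then obtain a b where p: "p = (a, b)" and "a > N \<or> b > N" by (cases p) auto
      then show "(case p of (a, b) \<Rightarrow> ?h a b) = 0"
        using L0[of a b] L0[of b a] by (auto simp: ad_word_bracket_def word_bracket_1_1)
    qed
  qed auto
  moreover have "(\<Sum>(a, b)\<in>{(a, b). a + b \<le> 2 * N}. ?h a b) = 0"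
    unfolding sum.triangle_reindex_eq using sum_ad_word_bracket_eq_0[OF mc w] by simp
  ultimately have "s 2 (insertions 1 (lift n T (exp_ad s G \<pi> P N)) (lift n T (exp_ad s G \<pi> P N)) w) = 0"
    using scale_left_distrib[of 1 1] by simp
  then show ?thesis by simp
qed

end

text \<open>The word of the elementary intervals, on which \<open>lift\<close> recovers the operation itself.\<close>

definition std_word :: "int list \<Rightarrow> 'v list \<Rightarrow> 'v letter list" where
  "std_word ds xs = map (\<lambda>i. ((i, Suc i, ds ! i), xs ! i)) [0..<length xs]"

lemma std_word_props:
  assumes "homogeneous G ds xs"
  shows "good (length xs) G (std_word ds xs)" and "map snd (std_word ds xs) = xs"
    and "map dg (std_word ds xs) = ds" and "length (std_word ds xs) = length xs"
    and "xs \<noteq> [] \<Longrightarrow> points (std_word ds xs) = [0..<Suc (length xs)]"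
proof -
  have len: "length ds = length xs" using assms by (simp add: homogeneous_def list_all2_lengthD)
  show 1: "map snd (std_word ds xs) = xs" "map dg (std_word ds xs) = ds" "length (std_word ds xs) = length xs"
    using len by (auto simp: std_word_def o_def map_nth intro: nth_equalityI)
  have "chain (length xs) (std_word ds xs)"
    by (auto simp: chain_def std_word_def successively_conv_nth)
  then show "good (length xs) G (std_word ds xs)"
    using assms 1 by (simp add: good_def homog_iff)
  show "points (std_word ds xs) = [0..<Suc (length xs)]" if "xs \<noteq> []"
  proof (rule nth_equalityI)
    have "std_word ds xs \<noteq> []" using that by (simp add: std_word_def)
    then show "length (points (std_word ds xs)) = length [0..<Suc (length xs)]" by (simp add: length_points 1)
    have "points (std_word ds xs) = 0 # map Suc [0..<length xs]"
      using that by (cases "std_word ds xs") (auto simp: std_word_def upt_conv_Cons Cons_eq_map_conv o_def)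
    also have "\<dots> = [0..<Suc (length xs)]" by (simp add: map_Suc_upt upt_conv_Cons del: upt_Suc)
    finally show "points (std_word ds xs) ! i = [0..<Suc (length xs)] ! i" for i by simp
  qed
qed

section \<open>Grafting positions under deletion of leaves\<close>

lemma image_minus_eq: "(\<And>x. f x \<notin> Z \<longleftrightarrow> x \<in> M) \<Longrightarrow> f ` A - Z = f ` (A \<inter> M)"
  by auto

lemma image_minus_self: "(\<And>x. x \<in> A \<Longrightarrow> f x \<notin> Z) \<Longrightarrow> f ` A - Z = f ` A"
  by auto

lemma image_eq_singleton: "(\<And>x. x \<in> M \<Longrightarrow> f x = i) \<Longrightarrow> M \<noteq> {} \<Longrightarrow> f ` M = {i}"
  by auto

lemma mem_image_iff: "(\<And>x. x \<in> A \<Longrightarrow> f x = j \<longleftrightarrow> x \<in> M) \<Longrightarrow> j \<in> f ` A \<longleftrightarrow> A \<inter> M \<noteq> {}"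
  by auto

text \<open>A cut is recorded by the number of leaves to its left. Unlike in
  \<open>graft_positions\<close> both outer ends are included, which makes the set compatible with
  deletions that remove whole subtrees.\<close>

fun partial_sums :: "ptree list \<Rightarrow> nat set" where
  "partial_sums [] = {0}"
| "partial_sums (t # ts) = insert 0 ((+) (leaves t) ` partial_sums ts)"

lemma zero_in_partial_sums [simp]: "0 \<in> partial_sums ts"
  by (cases ts) auto

text \<open>If a subtree disappears, the relabelling takes the same value at both of its ends, and
  the two cuts become one.\<close>

lemma partial_sums_prune_list:
  assumes c: "\<And>x. c (Suc x) = (if x \<in> S then c x else Suc (c x))"
  shows "c ` (+) m ` partial_sums ts = (+) (c m) ` partial_sums (prune_list S m ts)"
proof (induction ts arbitrary: m)
  case (Cons t ts)
  have "c ` (+) m ` partial_sums (t # ts) = insert (c m) (c ` (+) (m + leaves t) ` partial_sums ts)"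
    by (simp add: image_image add.assoc)
  also have "\<dots> = insert (c m) ((+) (c (m + leaves t)) ` partial_sums (prune_list S (m + leaves t) ts))"
    by (simp only: Cons)
  also have "\<dots> = (+) (c m) ` partial_sums (prune_list S m (t # ts))"
  proof (cases "prune S m t")
    case None
    then have "c (m + leaves t) = c m" using prune_prune_aux(1)[of c S m t, OF c] by simp
    moreover have "c m \<in> (+) (c m) ` partial_sums us" for us
      by (rule image_eqI[of _ _ 0]) auto
    ultimately show ?thesis using None by auto
  next
    case (Some u)
    then have "c (m + leaves t) = c m + leaves u" using prune_prune_aux(1)[of c S m t, OF c] by simp
    then show ?thesis using Some by (simp add: image_image add.assoc)
  qed
  finally show ?case .
qed simp

lemma partial_sums_le: "x \<in> partial_sums ts \<Longrightarrow> x \<le> sum_list (map leaves ts)"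
  by (induction ts arbitrary: x) auto

lemma graft_positions_Node_Cons:
  "graft_positions (Node (t # ts)) = (+) (leaves t) ` (partial_sums ts - {sum_list (map leaves ts)})"
  if "\<forall>t\<in>set ts. reduced t"
proof -
  have eq: "{sum_list (map leaves (take m ts)) | m. m < length ts} = partial_sums ts - {sum_list (map leaves ts)}"
    using that
  proof (induction ts)
    case (Cons t ts)
    have "{sum_list (map leaves (take m (t # ts))) | m. m < length (t # ts)} =
      insert 0 ((+) (leaves t) ` {sum_list (map leaves (take m ts)) | m. m < length ts})"
      (is "?L = ?R")
    proof (intro equalityI subsetI)
      fix x assume "x \<in> ?L"
      then obtain m where "m < length (t # ts)" "x = sum_list (map leaves (take m (t # ts)))" by blast
      then show "x \<in> ?R" by (cases m) auto
    next
      fix x assume "x \<in> ?R"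
      then consider "x = 0" | m where "m < length ts" "x = leaves t + sum_list (map leaves (take m ts))" by auto
      then show "x \<in> ?L"
      proof cases
        case 1
        then show ?thesis by (intro CollectI exI[of _ 0]) simp
      next
        case (2 m)
        then show ?thesis by (intro CollectI exI[of _ "Suc m"]) simp
      qed
    qed
    then show ?case using Cons leaves_pos[of t] by auto
  qed simp
  have "graft_positions (Node (t # ts)) = (+) (leaves t) ` {sum_list (map leaves (take m ts)) | m. m < length ts}"
    (is "?L = ?R")
  proof (intro equalityI subsetI)
    fix x assume "x \<in> ?L"
    then obtain m where "1 \<le> m" "m < length (t # ts)" "x = sum_list (map leaves (take m (t # ts)))"
      by (auto simp: graft_positions_def)
    then show "x \<in> ?R" by (cases m) auto
  next
    fix x assume "x \<in> ?R"
    then obtain m where "m < length ts" "x = leaves t + sum_list (map leaves (take m ts))" by auto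
    then show "x \<in> ?L" unfolding graft_positions_def by (intro CollectI exI[of _ "Suc m"]) simp
  qed
  with eq show ?thesis by simp
qed

lemma graft_positions_Node:
  assumes "\<forall>t\<in>set ts. reduced t" and "ts \<noteq> []"
  shows "graft_positions (Node ts) = partial_sums ts - {0, sum_list (map leaves ts)}"
proof (cases ts)
  case (Cons t ts')
  then show ?thesis using graft_positions_Node_Cons[of ts' t] assms leaves_pos[of t] by auto
qed (use assms in simp)

lemma partial_sums_eq_graft:
  assumes "\<forall>t\<in>set ts. reduced t" and "ts \<noteq> []"
  shows "partial_sums ts = insert 0 (insert (sum_list (map leaves ts)) (graft_positions (Node ts)))"
proof -
  have "sum_list (map leaves ts) \<in> partial_sums ts" for ts by (induction ts) auto
  then show ?thesis using graft_positions_Node[OF assms] by auto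
qed

text \<open>Every subtree has a leaf, so distinct cuts have distinct positions.\<close>

lemma card_graft_positions_Node:
  "\<forall>t\<in>set ts. reduced t \<Longrightarrow> ts \<noteq> [] \<Longrightarrow> card (graft_positions (Node ts)) + 1 = length ts"
proof (induction ts)
  case (Cons t ts)
  show ?case
  proof (cases "ts = []")
    case True
    then show ?thesis using graft_positions_Node_Cons[of "[]" t] by simp
  next
    case False
    have fin: "finite (partial_sums ts)" for ts by (induction ts) auto
    have gt: "graft_positions (Node ts) = partial_sums ts - {0, sum_list (map leaves ts)}"
      using False Cons.prems by (intro graft_positions_Node) auto
    obtain t' ts' where "ts = t' # ts'" using False by (cases ts) auto
    then have "0 < sum_list (map leaves ts)" using leaves_pos[of t'] Cons.prems by auto
    then have "partial_sums ts - {sum_list (map leaves ts)} = insert 0 (graft_positions (Node ts))"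
      unfolding gt by auto
    then have "graft_positions (Node (t # ts)) = (+) (leaves t) ` insert 0 (graft_positions (Node ts))"
      using graft_positions_Node_Cons[of ts t] Cons.prems by simp
    moreover have "card ((+) (leaves t) ` A) = card A" for A
      by (rule card_image) simp
    ultimately have "card (graft_positions (Node (t # ts))) = card (insert 0 (graft_positions (Node ts)))"
      by (simp only:)
    also have "\<dots> = Suc (card (graft_positions (Node ts)))"
      using fin[of ts] by (simp add: gt)
    finally have "card (graft_positions (Node (t # ts))) = Suc (card (graft_positions (Node ts)))" .
    then show ?thesis using Cons False by simp
  qed
qed simp

lemma tree_Node:
  assumes "T \<in> trees n" and "1 \<le> n"
  obtains ts where "T = Node ts" and "2 \<le> length ts" and "\<forall>t\<in>set ts. reduced t"
    and "sum_list (map leaves ts) = n + 1"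
  using assms by (cases T) (auto simp: trees_def)

lemma graft_positions_props:
  assumes "T \<in> trees n" and "1 \<le> n"
  shows "graft_positions T \<subseteq> {1..n}" and "card (graft_positions T) + 1 = length (subtrees T)"
    and "graft_positions T \<noteq> {}"
proof -
  obtain ts where T: "T = Node ts" "2 \<le> length ts" "\<forall>t\<in>set ts. reduced t" "sum_list (map leaves ts) = n + 1"
    using tree_Node[OF assms] by metis
  then have "ts \<noteq> []" by auto
  show "graft_positions T \<subseteq> {1..n}"
    using graft_positions_Node[OF T(3) \<open>ts \<noteq> []\<close>] partial_sums_le[of _ ts] T by fastforce
  show c: "card (graft_positions T) + 1 = length (subtrees T)"
    using card_graft_positions_Node[OF T(3) \<open>ts \<noteq> []\<close>] T(1) by simp
  show "graft_positions T \<noteq> {}"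
    using c T by auto
qed

text \<open>By \<open>ne\<close> some cut still has surviving leaves on both sides. So at least two
  branches remain and the root is not suppressed; otherwise the cuts would be those of a deeper
  vertex.\<close>

lemma graft_positions_delete_leaves:
  assumes "T \<in> trees n" and "1 \<le> n" and c: "\<And>x. c (Suc x) = (if x \<in> S then c x else Suc (c x))"
    and "c 0 = 0" and ne: "c ` graft_positions T - {0, c (n + 1)} \<noteq> {}"
  shows "graft_positions (delete_leaves S T) = c ` graft_positions T - {0, c (n + 1)}"
proof -
  obtain ts where T: "T = Node ts" "2 \<le> length ts" "\<forall>t\<in>set ts. reduced t" "sum_list (map leaves ts) = n + 1"
    using tree_Node[OF assms(1,2)] by metis
  then have "ts \<noteq> []" by auto
  let ?us = "prune_list S 0 ts"
  have ps: "partial_sums ?us = c ` partial_sums ts"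
    using partial_sums_prune_list[of c S 0 ts, OF c] assms(4) by simp
  have tot: "sum_list (map leaves ?us) = c (n + 1)"
    using prune_prune_aux(2)[of c S "{}" 0 ts, OF c] assms(4) T(4) by simp
  have eq: "partial_sums ?us - {0, c (n + 1)} = c ` graft_positions T - {0, c (n + 1)}"
    using partial_sums_eq_graft[OF T(3) \<open>ts \<noteq> []\<close>] assms(4) T(1,4) by (auto simp: ps)
  have "2 \<le> length ?us"
  proof (rule ccontr)
    assume "\<not> 2 \<le> length ?us"
    then consider "?us = []" | u where "?us = [u]" by (cases ?us; cases "tl ?us") auto
    then have "partial_sums ?us - {0, c (n + 1)} = {}" using tot by cases auto
    then show False using ne by (simp only: eq)
  qed
  then have "delete_leaves S T = Node ?us"
    using T(1) by (cases ?us rule: regraft.cases) (auto simp: delete_leaves_def)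
  moreover have "\<forall>u\<in>set ?us. reduced u" using reduced_prune(2)[OF T(3)] by blast
  moreover have "?us \<noteq> []" using \<open>2 \<le> length ?us\<close> by auto
  ultimately show ?thesis using graft_positions_Node[of ?us] tot eq by simp
qed

text \<open>The leaves \<open>0\<close> and \<open>n\<close> are never deleted, so every cut
  survives; those inside the block all move to \<open>i\<close>.\<close>

lemma graft_positions_R0:
  assumes "T \<in> trees n" and "k + l = n + 1" and "1 \<le> l" and "1 \<le> i" and "i \<le> k"
  shows "graft_positions (R0 i l T) = (\<lambda>x. if x \<le> i then x else if x \<le> i + l - 1 then i else x - (l - 1)) ` graft_positions T"
    (is "_ = ?c ` _")
proof -
  have n: "1 \<le> n" using assms by simp
  note g = graft_positions_props[OF assms(1) n]
  have c: "?c (Suc x) = (if x \<in> {i..<i + l - 1} then ?c x else Suc (?c x))" for x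
    using assms by auto
  have r: "?c x \<notin> {0, ?c (n + 1)}" if "x \<in> graft_positions T" for x
    using subsetD[OF g(1) that] assms by auto
  then have eq: "?c ` graft_positions T - {0, ?c (n + 1)} = ?c ` graft_positions T" by (rule image_minus_self)
  then have ne: "?c ` graft_positions T - {0, ?c (n + 1)} \<noteq> {}"
    using g(3) by (simp only: image_is_empty simp_thms)
  have "graft_positions (delete_leaves {i..<i + l - 1} T) = ?c ` graft_positions T - {0, ?c (n + 1)}"
    by (rule graft_positions_delete_leaves[OF assms(1) n c _ ne]) simp
  then show ?thesis unfolding R0_def eq .
qed

text \<open>Only the cuts in the block separate kept leaves. Without any such cut the block would
  lie in a single subtree and the root of \<open>T\<close> would be lost.\<close>

lemma graft_positions_Ri:
  assumes "T \<in> trees n" and "k + l = n + 1" and "1 \<le> l" and "1 \<le> i" and "i \<le> k"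
    and ne: "graft_positions T \<inter> {i..i + l - 1} \<noteq> {}"
  shows "graft_positions (Ri i l T) = (\<lambda>x. x - (i - 1)) ` (graft_positions T \<inter> {i..i + l - 1})"
proof -
  let ?c = "\<lambda>x. min (x - (i - 1)) (l + 1)"
  have n: "1 \<le> n" using assms by simp
  have c: "?c (Suc x) = (if x \<in> - {i - 1..i + l - 1} then ?c x else Suc (?c x))" for x
    using assms by auto
  have "?c (n + 1) = l + 1" using assms by auto
  moreover have "?c x \<notin> {0, l + 1} \<longleftrightarrow> x \<in> {i..i + l - 1}" for x
    using assms by auto
  then have "?c ` graft_positions T - {0, l + 1} = ?c ` (graft_positions T \<inter> {i..i + l - 1})" by (rule image_minus_eq)
  moreover have "?c ` (graft_positions T \<inter> {i..i + l - 1}) = (\<lambda>x. x - (i - 1)) ` (graft_positions T \<inter> {i..i + l - 1})"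
    by (intro image_cong refl) auto
  ultimately show ?thesis
    unfolding Ri_def
    using graft_positions_delete_leaves[OF assms(1) n, of ?c, OF c] ne by simp
qed

text \<open>The cuts in the block pass injectively to the inner tree and collapse to the single cut
  \<open>i\<close> of the outer one, whereas cuts outside the block stay distinct.\<close>

lemma card_graft_positions:
  assumes "T \<in> trees n" and "k + l = n + 1" and "1 \<le> l" and "1 \<le> i" and "i \<le> k"
  shows "graft_positions T \<inter> {i..i + l - 1} = {} \<Longrightarrow> card (graft_positions (R0 i l T)) = card (graft_positions T)"
    and "graft_positions T \<inter> {i..i + l - 1} \<noteq> {} \<Longrightarrow>
      card (graft_positions (R0 i l T)) + card (graft_positions (Ri i l T)) = card (graft_positions T) + 1"
proof -
  let ?c = "\<lambda>x. if x \<le> i then x else if x \<le> i + l - 1 then i else x - (l - 1)"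
  let ?M = "graft_positions T \<inter> {i..i + l - 1}" and ?N = "graft_positions T - {i..i + l - 1}"
  have n: "1 \<le> n" using assms by simp
  have fin: "finite (graft_positions T)"
    using graft_positions_props(1)[OF assms(1) n] finite_subset by blast
  have inj: "inj_on ?c ?N" using assms by (auto simp: inj_on_def)
  then have cN: "card (?c ` ?N) = card ?N" by (rule card_image)
  have un: "graft_positions T = ?M \<union> ?N" by blast
  note R0 = graft_positions_R0[OF assms]
  show "card (graft_positions (R0 i l T)) = card (graft_positions T)" if "?M = {}"
  proof -
    have "?N = graft_positions T" using that by blast
    then show ?thesis using R0 cN by simp
  qed
  assume M: "?M \<noteq> {}"
  have "?c x = i" if "x \<in> ?M" for x using that by auto
  then have "?c ` ?M = {i}" using M by (rule image_eq_singleton)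
  then have "graft_positions (R0 i l T) = insert i (?c ` ?N)"
    unfolding R0 by (subst un) (simp only: image_Un, simp)
  moreover have "i \<notin> ?c ` ?N" using assms by auto
  ultimately have 1: "card (graft_positions (R0 i l T)) = Suc (card ?N)" using cN fin by simp
  have "inj_on (\<lambda>x. x - (i - 1)) ?M" using assms by (auto simp: inj_on_def)
  then have "card (graft_positions (Ri i l T)) = card ?M"
    unfolding graft_positions_Ri[OF assms M] by (rule card_image)
  moreover have "card (graft_positions T) = card ?M + card ?N"
    by (subst un, rule card_Un_disjoint) (use fin in auto)
  ultimately show "card (graft_positions (R0 i l T)) + card (graft_positions (Ri i l T)) = card (graft_positions T) + 1"
    using 1 by simp
qed

lemma mem_graft_positions_R0:
  assumes "T \<in> trees n" and "k + l = n + 1" and "1 \<le> l" and "1 \<le> i" and "i \<le> k"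
  shows "j < i \<Longrightarrow> j \<in> graft_positions (R0 i l T) \<longleftrightarrow> j \<in> graft_positions T"
    and "i \<in> graft_positions (R0 i l T) \<longleftrightarrow> graft_positions T \<inter> {i..i + l - 1} \<noteq> {}"
    and "i < j \<Longrightarrow> j \<in> graft_positions (R0 i l T) \<longleftrightarrow> j + l - 1 \<in> graft_positions T"
proof -
  show "j \<in> graft_positions (R0 i l T) \<longleftrightarrow> j \<in> graft_positions T" if "j < i"
    unfolding graft_positions_R0[OF assms] using that assms by (subst mem_image_iff[of _ _ j "{j}"]) auto
  show "i \<in> graft_positions (R0 i l T) \<longleftrightarrow> graft_positions T \<inter> {i..i + l - 1} \<noteq> {}"
    unfolding graft_positions_R0[OF assms] using assms by (intro mem_image_iff) auto
  show "j \<in> graft_positions (R0 i l T) \<longleftrightarrow> j + l - 1 \<in> graft_positions T" if "i < j"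
    unfolding graft_positions_R0[OF assms] using that assms by (subst mem_image_iff[of _ _ j "{j + l - 1}"]) auto
qed

lemma mem_graft_positions_Ri:
  assumes "T \<in> trees n" and "k + l = n + 1" and "1 \<le> l" and "1 \<le> i" and "i \<le> k"
    and "graft_positions T \<inter> {i..i + l - 1} \<noteq> {}" and "j < l"
  shows "Suc j \<in> graft_positions (Ri i l T) \<longleftrightarrow> i + j \<in> graft_positions T"
  unfolding graft_positions_Ri[OF assms(1-6)]
  using assms by (subst mem_image_iff[of _ _ "Suc j" "{i + j}"]) auto

section \<open>The Maurer-Cartan element of a representation\<close>

definition graft_word :: "ptree \<Rightarrow> ('a \<times> 'b) list \<Rightarrow> ('a + 'b) list" where
  "graft_word T ys = map (\<lambda>j. if j \<in> graft_positions T then Inr (snd (ys ! (j - 1)))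
     else Inl (fst (ys ! (j - 1)))) [1..<length ys + 1]"

lemma length_graft_word [simp]: "length (graft_word T ys) = length ys"
  by (simp add: graft_word_def del: upt_Suc)

lemma nth_graft_word:
  "j < length ys \<Longrightarrow> graft_word T ys ! j = (if Suc j \<in> graft_positions T then Inr (snd (ys ! j)) else Inl (fst (ys ! j)))"
  by (simp add: graft_word_def del: upt_Suc)

lemma graft_word_update:
  "j < length ys \<Longrightarrow> graft_word T (ys[j := v]) =
    (graft_word T ys)[j := if Suc j \<in> graft_positions T then Inr (snd v) else Inl (fst v)]"
  by (rule nth_equalityI) (auto simp: nth_graft_word nth_list_update)

lemma graft_word_not_all_Inl:
  assumes "T \<in> trees (length ys)" and "1 \<le> length ys"
  shows "\<exists>x\<in>set (graft_word T ys). \<not> isl x"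
proof -
  note g = graft_positions_props[OF assms]
  then obtain x where "x \<in> graft_positions T" by blast
  then have "x - 1 < length ys" "Suc (x - 1) \<in> graft_positions T" using g(1) by (auto dest!: subsetD)
  then show ?thesis by (metis nth_graft_word isl_def sum.disc(2) nth_mem length_graft_word)
qed

lemma homogeneous_graft_word:
  "homogeneous (prod_grading GA GB) ds ys \<Longrightarrow> homogeneous (sum_grading GA GB) ds (graft_word T ys)"
  by (auto simp: homogeneous_def list_all2_conv_all_nth nth_graft_word sum_grading_def mem_Times_iff)

lemma bex_update_iff:
  fixes w :: "('c + 'd) list"
  shows "(\<exists>x\<in>set (w[j := Inr b]). isl x) \<longleftrightarrow> (\<exists>i<length w. i \<noteq> j \<and> isl (w ! i))"
proof -
  have "(\<exists>x\<in>set xs. isl x) \<longleftrightarrow> (\<exists>i<length xs. isl (xs ! i))" for xs :: "('c + 'd) list"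
    by (metis in_set_conv_nth)
  moreover have "isl (w[j := Inr b] ! i) \<longleftrightarrow> i \<noteq> j \<and> isl (w ! i)" if "i < length w" for i
    using that by (cases "i = j") auto
  ultimately show ?thesis by auto
qed

lemma insert_op_nth:
  assumes "1 \<le> i" and "1 \<le> l" and "i + l \<le> length xs + 1" and "j < length xs + 1 - l"
  shows "insert_op i l g xs ! j =
    (if j < i - 1 then xs ! j else if j = i - 1 then g (take l (drop (i - 1) xs)) else xs ! (j + l - 1))"
  using assms by (auto simp: insert_op_def nth_append nth_Cons' intro!: arg_cong[of _ _ "(!) xs"])

lemma length_insert_op:
  "1 \<le> i \<Longrightarrow> 1 \<le> l \<Longrightarrow> i + l \<le> length xs + 1 \<Longrightarrow> length (insert_op i l g xs) = length xs + 1 - l"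
  by (auto simp: insert_op_def)

lemma map_insert_op:
  assumes "f (g (take l (drop (i - 1) xs))) = g' (map f (take l (drop (i - 1) xs)))"
  shows "map f (insert_op i l g xs) = insert_op i l g' (map f xs)"
  using assms by (simp add: insert_op_def take_map drop_map)

lemma insert_op_cong:
  "g (take l (drop (i - 1) xs)) = g' (take l (drop (i - 1) xs)) \<Longrightarrow> insert_op i l g xs = insert_op i l g' xs"
  by (simp add: insert_op_def)

lemma linear_compose_fst:
  assumes "Vector_Spaces.linear sA sC f" and "vector_space sB"
  shows "Vector_Spaces.linear (prod_scale sA sB) sC (\<lambda>v. f (fst v))"
proof -
  interpret vector_space_prod sA sB
    using assms by (simp add: vector_space_prod_def vector_space_pair_def Vector_Spaces.linear_iff)
  show ?thesis using assms p.vector_space_axioms by (simp add: Vector_Spaces.linear_iff scale_def)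
qed

lemma linear_compose_snd:
  assumes "Vector_Spaces.linear sB sC f" and "vector_space sA"
  shows "Vector_Spaces.linear (prod_scale sA sB) sC (\<lambda>v. f (snd v))"
proof -
  interpret vector_space_prod sA sB
    using assms by (simp add: vector_space_prod_def vector_space_pair_def Vector_Spaces.linear_iff)
  show ?thesis using assms p.vector_space_axioms by (simp add: Vector_Spaces.linear_iff scale_def)
qed

section \<open>The square of the Maurer-Cartan element\<close>

context
  fixes sA :: "'k::field_char_0 \<Rightarrow> 'a::ab_group_add \<Rightarrow> 'a" and GA :: "int \<Rightarrow> 'a set"
    and sB :: "'k \<Rightarrow> 'b::ab_group_add \<Rightarrow> 'b" and GB :: "int \<Rightarrow> 'b set"
    and \<mu> :: "nat \<Rightarrow> 'a list \<Rightarrow> 'a" and \<nu> :: "nat \<Rightarrow> 'b list \<Rightarrow> 'b"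
    and \<eta> :: "nat \<Rightarrow> ('a + 'b) list \<Rightarrow> 'b" and wt :: 'k
  assumes A: "a_infinity_algebra sA GA \<mu>"
    and B: "a_infinity_representation sA GA \<mu> sB GB \<nu> \<eta>"
begin

lemma graded_A: "graded_vector_space sA GA"
  using A by (simp add: a_infinity_algebra_def)

lemma graded_B: "graded_vector_space sB GB"
  using B by (simp add: a_infinity_representation_def a_infinity_algebra_def)

interpretation vsA: vector_space sA using graded_A by (simp add: graded_vector_space_def)

interpretation vsB: vector_space sB using graded_B by (simp add: graded_vector_space_def)

private abbreviation (input) "pi_op \<equiv> pi_element sB wt \<mu> \<nu> \<eta>"
private abbreviation (input) "eta_nu \<equiv> eta_plus_nu \<nu> \<eta>"

lemma multilinear_mu: "1 \<le> k \<Longrightarrow> graded_multilinear sA GA sA GA 1 k (\<mu> k)"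
  using A by (simp add: a_infinity_algebra_def)

lemma multilinear_nu: "1 \<le> k \<Longrightarrow> graded_multilinear sB GB sB GB 1 k (\<nu> k)"
  using B by (simp add: a_infinity_representation_def a_infinity_algebra_def)

lemma multilinear_eta: "1 \<le> k \<Longrightarrow> mixed_graded_multilinear sA GA sB GB 1 k (\<eta> k)"
  using B by (simp add: a_infinity_representation_def)

text \<open>The slot holds a letter in \<open>B\<close>, so the other letters alone decide between
  \<open>\<eta>\<close> and \<open>\<nu>\<close>.\<close>

lemma linear_eta_nu_Inr:
  assumes "1 \<le> k" and "length w = k" and "j < k"
  shows "Vector_Spaces.linear sB sB (\<lambda>b. eta_nu k (w[j := Inr b]))"
proof (cases "\<exists>x\<in>set (w[j := Inr 0]). isl x")
  case True
  then have mixed: "\<exists>x\<in>set (w[j := Inr b]). isl x" for b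
    by (simp add: bex_update_iff)
  have j: "w[j := Inr 0] ! j = Inr 0" using assms by simp
  have "Inr 0 \<in> set (w[j := Inr 0])" using assms by (simp add: set_update_memI)
  from bexI[OF _ this, of "\<lambda>x. \<not> isl x"] have "mixed_word (w[j := Inr 0])"
    using True unfolding mixed_word_def by simp
  then have "Vector_Spaces.linear sB sB (\<lambda>b. \<eta> k (w[j := Inr 0, j := Inr b]))"
    using multilinear_eta[OF assms(1)] j assms unfolding mixed_graded_multilinear_def
    by (metis length_list_update sum.disc(2))
  moreover have "eta_nu k (w[j := Inr b]) = \<eta> k (w[j := Inr b])" for b
    using mixed[of b] by (auto simp: eta_plus_nu_def)
  ultimately show ?thesis by (simp only: list_update_overwrite)
next
  case False
  then have "\<not> (\<exists>x\<in>set (w[j := Inr b]). isl x)" for b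
    by (simp only: bex_update_iff simp_thms)
  then have all: "\<forall>x\<in>set (w[j := Inr b]). \<not> isl x" for b
    by blast
  have "Vector_Spaces.linear sB sB (\<lambda>b. \<nu> k ((map projr w)[j := b]))"
    using multilinear_nu[OF assms(1)] assms unfolding graded_multilinear_def by simp
  moreover have "eta_nu k (w[j := Inr b]) = \<nu> k ((map projr w)[j := b])" for b
    using all[of b] by (simp add: eta_plus_nu_def map_update)
  ultimately show ?thesis by simp
qed

lemma linear_eta_nu_Inl:
  assumes "1 \<le> k" and "length w = k" and "j < k" and "\<exists>x\<in>set (w[j := Inl 0]). \<not> isl x"
  shows "Vector_Spaces.linear sA sB (\<lambda>a. eta_nu k (w[j := Inl a]))"
proof -
  have isl: "Inl a \<in> set (w[j := Inl a])" for a using assms by (simp add: set_update_memI)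
  have "mixed_word (w[j := Inl 0])"
    using bexI[OF _ isl[of 0], of isl] assms(4) unfolding mixed_word_def by simp
  moreover have "w[j := Inl 0] ! j = Inl 0" using assms by simp
  ultimately have "Vector_Spaces.linear sA sB (\<lambda>a. \<eta> k (w[j := Inl 0, j := Inl a]))"
    using multilinear_eta[OF assms(1)] assms unfolding mixed_graded_multilinear_def
    by (metis length_list_update sum.disc(1))
  moreover have "eta_nu k (w[j := Inl a]) = \<eta> k (w[j := Inl a])" for a
    using bexI[OF _ isl[of a], of isl] by (auto simp: eta_plus_nu_def)
  ultimately show ?thesis by (simp only: list_update_overwrite)
qed

lemma eta_nu_in:
  assumes "1 \<le> k" and "length w = k" and "\<exists>x\<in>set w. \<not> isl x" and hom: "homogeneous (sum_grading GA GB) ds w"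
  shows "eta_nu k w \<in> GB (sum_list ds + 1)"
proof (cases "\<exists>x\<in>set w. isl x")
  case True
  then show ?thesis
    using multilinear_eta[OF assms(1)] assms unfolding mixed_graded_multilinear_def
    by (auto simp: eta_plus_nu_def mixed_word_def)
next
  case False
  have "projr (w ! j) \<in> GB (ds ! j)" if "j < length w" for j
  proof -
    have "w ! j \<in> sum_grading GA GB (ds ! j)"
      using hom that by (simp add: homogeneous_def list_all2_conv_all_nth)
    moreover have "\<not> isl (w ! j)" using False that by (meson nth_mem)
    ultimately show ?thesis by (auto simp: sum_grading_def)
  qed
  then have "homogeneous GB ds (map projr w)"
    using hom by (simp add: homogeneous_def list_all2_conv_all_nth)
  then have "\<nu> k (map projr w) \<in> GB (sum_list ds + 1)"
    using multilinear_nu[OF assms(1)] assms(2) by (intro graded_multilinear_in) auto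
  then show ?thesis using False by (auto simp: eta_plus_nu_def)
qed

text \<open>Counting cuts instead of branches gives an exponent that can be compared by
  \<open>card_graft_positions\<close>.\<close>

lemma pi_element_eq:
  assumes "T \<in> trees k" and "1 \<le> k" and "length ys = k"
  shows "pi_op k T ys = (\<mu> k (map fst ys), sB (wt ^ (card (graft_positions T) - 1)) (eta_nu k (graft_word T ys)))"
proof -
  have "length (subtrees T) - 2 = card (graft_positions T) - 1"
    using graft_positions_props(2)[OF assms(1,2)] by linarith
  then show ?thesis using assms(3) by (simp only: pi_element_def graft_word_def)
qed

lemma tree_hom_pi_element:
  "tree_hom (prod_scale sA sB) (prod_grading GA GB) (prod_scale sA sB) (prod_grading GA GB) 1 pi_op"
  unfolding tree_hom_def graded_multilinear_def
proof (intro allI impI ballI conjI)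
  fix k T and ys :: "('a \<times> 'b) list" and j
  assume k: "1 \<le> k" and T: "T \<in> trees k" and ys: "length ys = k" and j: "j < k"
  let ?c = "wt ^ (card (graft_positions T) - 1)"
  have "Vector_Spaces.linear (prod_scale sA sB) sA (\<lambda>v. \<mu> k ((map fst ys)[j := fst v]))"
    using multilinear_mu[OF k] j ys unfolding graded_multilinear_def
    by (intro linear_compose_fst[OF _ vsB.vector_space_axioms]) simp
  moreover have lin: "Vector_Spaces.linear (prod_scale sA sB) sB (\<lambda>v. eta_nu k (graft_word T (ys[j := v])))"
  proof (cases "Suc j \<in> graft_positions T")
    case True
    have "Vector_Spaces.linear (prod_scale sA sB) sB (\<lambda>v. eta_nu k ((graft_word T ys)[j := Inr (snd v)]))"
      using k j ys by (intro linear_compose_snd[OF linear_eta_nu_Inr vsA.vector_space_axioms]) auto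
    then show ?thesis using True j ys by (simp add: graft_word_update)
  next
    case False
    have "\<exists>x\<in>set (graft_word T (ys[j := (0, 0)])). \<not> isl x"
      using T k ys by (intro graft_word_not_all_Inl) auto
    then have "Vector_Spaces.linear (prod_scale sA sB) sB (\<lambda>v. eta_nu k ((graft_word T ys)[j := Inl (fst v)]))"
      using k j ys False
      by (intro linear_compose_fst[OF linear_eta_nu_Inl vsB.vector_space_axioms]) (auto simp: graft_word_update)
    then show ?thesis using False j ys by (simp add: graft_word_update)
  qed
  moreover have "Vector_Spaces.linear (prod_scale sA sB) sB (\<lambda>v. sB ?c (eta_nu k (graft_word T (ys[j := v]))))"
    using lin by (simp add: Vector_Spaces.linear_iff vsB.scale_right_distrib mult.commute)
  ultimately have "Vector_Spaces.linear (prod_scale sA sB) (prod_scale sA sB)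
      (\<lambda>v. (\<mu> k ((map fst ys)[j := fst v]), sB ?c (eta_nu k (graft_word T (ys[j := v])))))"
    by (intro linear_Pair)
  then show "Vector_Spaces.linear (prod_scale sA sB) (prod_scale sA sB) (\<lambda>v. pi_op k T (ys[j := v]))"
    using pi_element_eq[OF T k] ys by (simp add: map_update)
next
  fix k T ds and ys :: "('a \<times> 'b) list"
  assume k: "1 \<le> k" and T: "T \<in> trees k" and ys: "length ys = k" and hom: "homogeneous (prod_grading GA GB) ds ys"
  have "homogeneous GA ds (map fst ys)"
    using hom by (auto simp: homogeneous_def list_all2_conv_all_nth mem_Times_iff)
  then have "\<mu> k (map fst ys) \<in> GA (sum_list ds + 1)"
    using ys by (intro graded_multilinear_in[OF multilinear_mu[OF k]]) auto
  moreover have "eta_nu k (graft_word T ys) \<in> GB (sum_list ds + 1)"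
    using k T ys homogeneous_graft_word[OF hom] graft_word_not_all_Inl by (intro eta_nu_in) auto
  then have "sB c (eta_nu k (graft_word T ys)) \<in> GB (sum_list ds + 1)" for c
    using vsB.subspace_scale[OF homogeneous_subspace[OF graded_B]] by blast
  ultimately show "pi_op k T ys \<in> GA (sum_list ds + 1) \<times> GB (sum_list ds + 1)"
    using pi_element_eq[OF T k] ys by simp
qed

text \<open>The powers of the weight match up because the block that is inserted contains a cut between two
  subtrees of \<open>T\<close> exactly if the letter at its place in the outer word is taken from \<open>B\<close>.\<close>

lemma snd_pi_element_insert:
  assumes T: "T \<in> trees n" and kl: "k + l = n + 1" "1 \<le> l" "1 \<le> i" "i \<le> k" and ys: "length ys = n"
  shows "snd (pi_op k (R0 i l T) (insert_op i l (pi_op l (Ri i l T)) ys)) =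
    sB (wt ^ (card (graft_positions T) - 1)) (eta_nu k (insert_op i l (total_op \<mu> \<nu> \<eta> l) (graft_word T ys)))"
proof -
  let ?W = "graft_word T ys" and ?sub = "take l (drop (i - 1) ys)"
  let ?zs = "insert_op i l (pi_op l (Ri i l T)) ys"
  define x where "x = pi_op l (Ri i l T) ?sub"
  \<comment> \<open>The letter that the outer tree reads at the place of the block.\<close>
  define y where "y = (if i \<in> graft_positions (R0 i l T) then Inr (snd x) else Inl (fst x))"
  have k: "1 \<le> k" using kl by simp
  note sub = sublist_trees[OF T kl]
  have lz: "length ?zs = k" using kl ys by (subst length_insert_op) auto
  have ls: "length ?sub = l" using kl ys by simp
  have x: "x = (\<mu> l (map fst ?sub), sB (wt ^ (card (graft_positions (Ri i l T)) - 1)) (eta_nu l (graft_word (Ri i l T) ?sub)))"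
    unfolding x_def by (rule pi_element_eq[OF sub(2) kl(2) ls])
  have word: "graft_word (R0 i l T) ?zs = insert_op i l (\<lambda>_. y) ?W"
  proof (rule nth_equalityI)
    show "length (graft_word (R0 i l T) ?zs) = length (insert_op i l (\<lambda>_. y) ?W)"
      using kl ys lz by (subst length_insert_op) auto
    fix j assume "j < length (graft_word (R0 i l T) ?zs)"
    then have j: "j < k" using lz by simp
    then show "graft_word (R0 i l T) ?zs ! j = insert_op i l (\<lambda>_. y) ?W ! j"
      using kl ys lz mem_graft_positions_R0(1)[OF T kl, of "Suc j"] mem_graft_positions_R0(3)[OF T kl, of "Suc j"]
      by (auto simp: nth_graft_word insert_op_nth y_def x_def)
  qed
  have snd: "snd (pi_op k (R0 i l T) ?zs) = sB (wt ^ (card (graft_positions (R0 i l T)) - 1)) (eta_nu k (insert_op i l (\<lambda>_. y) ?W))"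
    using pi_element_eq[OF sub(1) k lz] word by simp
  have ne: "graft_positions U \<noteq> {}" "finite (graft_positions U)" if "U \<in> trees m" "1 \<le> m" for U m
    using graft_positions_props[OF that] finite_subset by auto
  show ?thesis
  proof (cases "graft_positions T \<inter> {i..i + l - 1} = {}")
    case True
    \<comment> \<open>Without a cut in the block only the \<open>A\<close>-component of the inner
      value is read. It does not depend on the tree, so the cuts of \<open>Ri i l T\<close> do not
      matter here.\<close>
    have no: "Suc (i - 1 + j) \<notin> graft_positions T" if "j < l" for j
    proof -
      have "Suc (i - 1 + j) \<in> {i..i + l - 1}" using kl that by auto
      then show ?thesis using True by blast
    qed
    have "take l (drop (i - 1) ?W) = map (\<lambda>v. Inl (fst v)) ?sub"
      using kl ys no by (intro nth_equalityI) (auto simp: nth_graft_word)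
    then have "total_op \<mu> \<nu> \<eta> l (take l (drop (i - 1) ?W)) = Inl (\<mu> l (map fst ?sub))"
      by (simp add: total_op_def o_def)
    moreover have "y = Inl (\<mu> l (map fst ?sub))"
      using True mem_graft_positions_R0(2)[OF T kl] by (simp add: y_def x)
    ultimately have "insert_op i l (\<lambda>_. y) ?W = insert_op i l (total_op \<mu> \<nu> \<eta> l) ?W"
      by (intro insert_op_cong) simp
    then show ?thesis using snd card_graft_positions(1)[OF T kl True] by simp
  next
    case False
    have Wsub: "take l (drop (i - 1) ?W) = graft_word (Ri i l T) ?sub"
    proof (rule nth_equalityI)
      show "length (take l (drop (i - 1) ?W)) = length (graft_word (Ri i l T) ?sub)" using kl ys by simp
      fix j assume "j < length (take l (drop (i - 1) ?W))"
      then have j: "j < l" "i - 1 + j < length ys" using kl ys by auto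
      have "Suc (i - 1 + j) = i + j" using kl by simp
      then show "take l (drop (i - 1) ?W) ! j = graft_word (Ri i l T) ?sub ! j"
        using j kl ys mem_graft_positions_Ri[OF T kl False j(1)] by (simp add: nth_graft_word)
    qed
    let ?e = "card (graft_positions (Ri i l T)) - 1" and ?v = "eta_nu l (graft_word (Ri i l T) ?sub)"
    have "\<exists>z\<in>set (graft_word (Ri i l T) ?sub). \<not> isl z"
      using sub(2) ls kl(2) by (intro graft_word_not_all_Inl) auto
    then have tot: "total_op \<mu> \<nu> \<eta> l (take l (drop (i - 1) ?W)) = Inr ?v"
      unfolding Wsub by (auto simp: total_op_def)
    have y: "y = Inr (sB (wt ^ ?e) ?v)"
      using False mem_graft_positions_R0(2)[OF T kl] by (simp add: y_def x)
    \<comment> \<open>Linearity in this slot moves the power of the weight out of the inner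
      operation.\<close>
    have upd: "insert_op i l (\<lambda>_. Inr b) ?W = (insert_op i l (\<lambda>_. Inr 0) ?W)[i - 1 := Inr b]" for b
      using kl ys by (simp add: insert_op_def list_update_append)
    have "length (insert_op i l (\<lambda>_. Inr 0) ?W) = k" using kl ys by (subst length_insert_op) auto
    then have "Vector_Spaces.linear sB sB (\<lambda>b. eta_nu k ((insert_op i l (\<lambda>_. Inr 0) ?W)[i - 1 := Inr b]))"
      using kl by (intro linear_eta_nu_Inr) auto
    then have "eta_nu k (insert_op i l (\<lambda>_. y) ?W) = sB (wt ^ ?e) (eta_nu k (insert_op i l (\<lambda>_. Inr ?v) ?W))"
      unfolding upd[symmetric] by (simp add: y Vector_Spaces.linear_iff)
    moreover have "insert_op i l (\<lambda>_. Inr ?v) ?W = insert_op i l (total_op \<mu> \<nu> \<eta> l) ?W"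
      by (intro insert_op_cong) (simp only: tot)
    moreover have "card (graft_positions (R0 i l T)) - 1 + ?e = card (graft_positions T) - 1"
    proof -
      have "card (graft_positions (R0 i l T)) \<noteq> 0" "card (graft_positions (Ri i l T)) \<noteq> 0"
        using ne[OF sub(1) k] ne[OF sub(2) kl(2)] by auto
      then show ?thesis using card_graft_positions(2)[OF T kl False] by linarith
    qed
    ultimately show ?thesis using snd by (simp flip: power_add)
  qed
qed

text \<open>Mixed words are covered by the representation, words in \<open>B\<close> alone by the
  A-infinity algebra \<open>B\<close>.\<close>

lemma eta_nu_identity:
  assumes "1 \<le> n" and w: "length w = n" and "\<exists>x\<in>set w. \<not> isl x" and hom: "homogeneous (sum_grading GA GB) ds w"
  shows "(\<Sum>(k, l)\<in>arity_splits n. \<Sum>i=1..k. sB ((-1) powi sum_list (take (i - 1) ds))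
           (eta_nu k (insert_op i l (total_op \<mu> \<nu> \<eta> l) w))) = 0"
proof (cases "\<exists>x\<in>set w. isl x")
  case True
  then show ?thesis
    using B assms unfolding a_infinity_representation_def mixed_word_def by blast
next
  case False
  define zs where "zs = map projr w"
  have wz: "w = map Inr zs"
    using False unfolding zs_def map_map by (intro map_idI[symmetric]) (auto simp: o_def)
  have "homogeneous GB ds zs"
    using hom by (auto simp: wz homogeneous_def list_all2_conv_all_nth sum_grading_def)
  moreover have "length zs = n" using w by (simp add: zs_def)
  ultimately have "(\<Sum>(k, l)\<in>arity_splits n. \<Sum>i=1..k. sB ((-1) powi sum_list (take (i - 1) ds))
           (\<nu> k (insert_op i l (\<nu> l) zs))) = 0"
    using B assms(1) unfolding a_infinity_representation_def a_infinity_algebra_def by blast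
  moreover have eq: "eta_nu k (insert_op i l (total_op \<mu> \<nu> \<eta> l) w) = \<nu> k (insert_op i l (\<nu> l) zs)"
    if "(k, l) \<in> arity_splits n" "i \<in> {1..k}" for k l i
  proof -
    \<comment> \<open>On the empty word \<open>total_op\<close> would take the branch for
      \<open>A\<close>.\<close>
    have "take l (drop (i - 1) zs) \<noteq> []" using that \<open>length zs = n\<close> by (auto simp: arity_splits_def)
    then have "insert_op i l (total_op \<mu> \<nu> \<eta> l) w = map Inr (insert_op i l (\<nu> l) zs)"
      unfolding wz by (intro map_insert_op[symmetric]) (auto simp: total_op_def eta_plus_nu_def o_def take_map drop_map)
    then show ?thesis by (simp add: eta_plus_nu_def o_def)
  qed
  have "(\<Sum>(k, l)\<in>arity_splits n. \<Sum>i=1..k. sB ((-1) powi sum_list (take (i - 1) ds))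
           (eta_nu k (insert_op i l (total_op \<mu> \<nu> \<eta> l) w))) =
    (\<Sum>(k, l)\<in>arity_splits n. \<Sum>i=1..k. sB ((-1) powi sum_list (take (i - 1) ds))
           (\<nu> k (insert_op i l (\<nu> l) zs)))"
    unfolding case_prod_beta by (intro sum.cong refl) (simp add: eq)
  ultimately show ?thesis by simp
qed

text \<open>The \<open>A\<close>-component is the identity for \<open>\<mu>\<close>, whatever the
  tree. The \<open>B\<close>-component is the identity of the representation on
  \<open>graft_word T ys\<close>, multiplied by one common power of the weight.\<close>

lemma compose_sum_pi_element:
  assumes T: "T \<in> trees n" and n: "1 \<le> n" and ys: "length ys = n" and hom: "homogeneous (prod_grading GA GB) ds ys"
  shows "compose_sum (prod_scale sA sB) 1 pi_op pi_op n T ds ys = 0"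
proof -
  note prod = prod_scale_Pair[OF graded_A graded_B]
  have fst: "fst (prod_scale sA sB c v) = sA c (fst v)" and snd: "snd (prod_scale sA sB c v) = sB c (snd v)" for c v
    using prod[of c "fst v" "snd v"] by simp_all
  have "fst (compose_sum (prod_scale sA sB) 1 pi_op pi_op n T ds ys) =
    (\<Sum>(k, l)\<in>arity_splits n. \<Sum>i=1..k. sA ((-1) powi sum_list (take (i - 1) ds)) (\<mu> k (insert_op i l (\<mu> l) (map fst ys))))"
  proof -
    have "fst (pi_op k (R0 i l T) (insert_op i l (pi_op l (Ri i l T)) ys)) = \<mu> k (insert_op i l (\<mu> l) (map fst ys))" for k l i
      using map_insert_op[of fst "pi_op l (Ri i l T)" l i ys "\<mu> l"] by (simp add: pi_element_def)
    then show ?thesis by (simp add: compose_sum_def fst_sum fst case_prod_beta)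
  qed
  also have "\<dots> = 0"
  proof -
    have "homogeneous GA ds (map fst ys)"
      using hom by (auto simp: homogeneous_def list_all2_conv_all_nth mem_Times_iff)
    moreover have "length (map fst ys) = n" using ys by simp
    ultimately show ?thesis using A n unfolding a_infinity_algebra_def by blast
  qed
  finally have 1: "fst (compose_sum (prod_scale sA sB) 1 pi_op pi_op n T ds ys) = 0" .
  let ?c = "wt ^ (card (graft_positions T) - 1)"
  have "snd (compose_sum (prod_scale sA sB) 1 pi_op pi_op n T ds ys) =
    (\<Sum>(k, l)\<in>arity_splits n. \<Sum>i=1..k. sB ((-1) powi sum_list (take (i - 1) ds))
      (sB ?c (eta_nu k (insert_op i l (total_op \<mu> \<nu> \<eta> l) (graft_word T ys)))))"
    unfolding compose_sum_def snd_sum case_prod_beta snd mult_1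
    using snd_pi_element_insert[OF T _ _ _ _ ys]
    by (intro sum.cong refl arg_cong[of _ _ "sB _"]) (auto simp: arity_splits_def)
  also have "\<dots> = sB ?c (\<Sum>(k, l)\<in>arity_splits n. \<Sum>i=1..k. sB ((-1) powi sum_list (take (i - 1) ds))
      (eta_nu k (insert_op i l (total_op \<mu> \<nu> \<eta> l) (graft_word T ys))))"
    by (simp add: vsB.scale_sum_right case_prod_beta mult.commute)
  also have "\<dots> = 0"
    using eta_nu_identity[OF n _ _ homogeneous_graft_word[OF hom, of T]] graft_word_not_all_Inl[of T ys] T n ys by simp
  finally show ?thesis using 1 by (simp add: prod_eq_iff)
qed

end

section \<open>Twisting by a homotopy relative averaging operator\<close>

lemma linear_zero: "Vector_Spaces.linear s s' f \<Longrightarrow> f 0 = 0"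
  by (metis Vector_Spaces.linear_iff add_cancel_right_right)

lemma graded_multilinear_zero_entry:
  assumes "graded_multilinear s G s' G' d k f" and "length xs = k" and "0 \<in> set xs"
  shows "f xs = 0"
proof -
  obtain u w where xs: "xs = u @ 0 # w" using assms(3) by (meson split_list)
  have "Vector_Spaces.linear s s' (\<lambda>v. f (u @ v # w))"
    using assms xs by (intro graded_multilinear_slot) auto
  then show ?thesis unfolding xs by (rule linear_zero)
qed

fun summand_embed :: "'a::zero + 'b::zero \<Rightarrow> 'a \<times> 'b" where
  "summand_embed (Inl a) = (a, 0)"
| "summand_embed (Inr b) = (0, b)"

lemma snd_summand_embed: "isl x \<Longrightarrow> snd (summand_embed x) = 0"
  by (cases x) auto

abbreviation count_Inl :: "('a + 'b) list \<Rightarrow> nat" where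
  "count_Inl w \<equiv> length (filter isl w)"

text \<open>Each entry splits as \<open>(a, 0) + (0, b)\<close>; the induction carries a prefix of
  entries already split.\<close>

lemma graded_multilinear_eq_0:
  assumes "graded_multilinear (prod_scale sA sB) G s' G' d k f"
    and 0: "\<And>w. length w = k \<Longrightarrow> f (map summand_embed w) = 0"
    and "length ys = k"
  shows "f ys = 0"
proof -
  have "f (map summand_embed w @ ys) = 0" if "length w + length ys = k" for w ys
    using that
  proof (induction ys arbitrary: w)
    case Nil
    then show ?case using 0 by simp
  next
    case (Cons y ys)
    have "Vector_Spaces.linear (prod_scale sA sB) s' (\<lambda>v. f (map summand_embed w @ v # ys))"
      using Cons.prems by (intro graded_multilinear_slot[OF assms(1)]) simp
    then have "f (map summand_embed w @ (a + b) # ys) =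
        f (map summand_embed w @ a # ys) + f (map summand_embed w @ b # ys)" for a b
      unfolding Vector_Spaces.linear_iff by blast
    from this[of "(fst y, 0)" "(0, snd y)"]
    show ?case using Cons.IH[of "w @ [Inl (fst y)]"] Cons.IH[of "w @ [Inr (snd y)]"] Cons.prems by simp
  qed
  from this[of "[]" ys] assms(3) show ?thesis by simp
qed

lemma iterated_bracket_replicate:
  "iterated_bracket s G 1 \<phi> (replicate a (0, P)) = ad_iter s G \<phi> P a"
proof -
  have "iterated_bracket s G 1 X (replicate a (0, P)) = ((\<lambda>X. bracket s G 1 0 X P) ^^ a) X" for X
    by (induction a arbitrary: X) (simp_all add: funpow_Suc_right del: funpow.simps(2))
  then show ?thesis by (simp add: ad_iter_def)
qed

lemma length_filter_sublist:
  "length (filter p xs) = length (filter p (take i xs)) + length (filter p (take l (drop i xs))) + length (filter p (drop (i + l) xs))"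
proof -
  have "take i xs @ take l (drop i xs) @ drop (i + l) xs = xs"
    using append_take_drop_id[of i xs] append_take_drop_id[of l "drop i xs"] by (simp add: add.commute)
  then have "length (filter p xs) = length (filter p (take i xs @ take l (drop i xs) @ drop (i + l) xs))"
    by (simp only:)
  then show ?thesis by (simp only: filter_append length_append add.assoc)
qed

section \<open>Finiteness of the exponential and its restriction to \<open>B\<close>\<close>

context
  fixes sA :: "'k::field_char_0 \<Rightarrow> 'a::ab_group_add \<Rightarrow> 'a" and GA :: "int \<Rightarrow> 'a set"
    and sB :: "'k \<Rightarrow> 'b::ab_group_add \<Rightarrow> 'b" and GB :: "int \<Rightarrow> 'b set"
    and \<phi> :: "('a \<times> 'b, 'a \<times> 'b) tree_ops" and P :: "('b, 'a) tree_ops"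
  assumes gvsA: "graded_vector_space sA GA" and gvsB: "graded_vector_space sB GB"
    and \<phi>: "tree_hom (prod_scale sA sB) (prod_grading GA GB) (prod_scale sA sB) (prod_grading GA GB) 1 \<phi>"
    and P: "tree_hom sB GB sA GA 0 P"
begin

interpretation vsA: vector_space sA using gvsA by (simp add: graded_vector_space_def)

interpretation vsB: vector_space sB using gvsB by (simp add: graded_vector_space_def)

private abbreviation (input) "S \<equiv> prod_scale sA sB"
private abbreviation (input) "G \<equiv> prod_grading GA GB"
private abbreviation (input) "X \<equiv> ad_iter S G \<phi> (extend_by_zero P)"

lemma graded_prod: "graded_vector_space S G"
  by (rule graded_vector_space_prod[OF gvsA gvsB])

lemma tree_hom_extend_by_zero: "tree_hom S G S G 0 (extend_by_zero P)"
  unfolding tree_hom_def graded_multilinear_iff extend_by_zero_def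
proof (intro allI impI ballI conjI)
  fix k T and u w :: "('a \<times> 'b) list"
  assume *: "1 \<le> k" "T \<in> trees k" "length u + length w + 1 = k"
  then have "Vector_Spaces.linear sB sA (\<lambda>v. P k T (map snd u @ v # map snd w))"
    using P by (intro graded_multilinear_slot) (auto simp: tree_hom_def)
  then show "Vector_Spaces.linear S S (\<lambda>v. (P k T (map snd (u @ v # w)), 0))"
    using linear_Pair[OF linear_compose_snd[OF _ vsA.vector_space_axioms] linear_const_0, of sB sA] graded_prod vsB.vector_space_axioms
    by (simp add: graded_vector_space_def)
next
  fix k T ds and ys :: "('a \<times> 'b) list"
  assume *: "1 \<le> k" "T \<in> trees k" "length ys = k" "homogeneous G ds ys"
  then have "homogeneous GB ds (map snd ys)"
    by (auto simp: homogeneous_def list_all2_conv_all_nth mem_Times_iff)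
  then have "P k T (map snd ys) \<in> GA (sum_list ds + 0)"
    using * P by (intro graded_multilinear_in) (auto simp: tree_hom_def)
  then show "(P k T (map snd ys), 0) \<in> GA (sum_list ds + 0) \<times> GB (sum_list ds + 0)"
    using vsB.subspace_0[OF homogeneous_subspace[OF gvsB]] by simp
qed

lemmas tree_hom_X = tree_hom_ad_iter[OF graded_prod \<phi> tree_hom_extend_by_zero]

text \<open>An operation has weight at least \<open>d\<close> if its components with \<open>j\<close> inputs in \<open>A\<close> vanish
  as soon as \<open>1 - j < d\<close> (values in \<open>A\<close>) resp. \<open>- j < d\<close> (values in \<open>B\<close>). The weight is additive under
  composition and that of \<open>P\<close> is one, so the weight of \<open>X a\<close> in arity \<open>k\<close> is at least \<open>a - k\<close>.\<close>

lemma ad_iter_weight: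
  assumes "1 \<le> k" and "T \<in> trees k" and "length w = k"
  shows "(k + 1 < a + count_Inl w \<longrightarrow> fst (X a k T (map summand_embed w)) = 0) \<and>
    (k < a + count_Inl w \<longrightarrow> snd (X a k T (map summand_embed w)) = 0)"
  using assms
proof (induction a arbitrary: k T w)
  case 0
  have "count_Inl w \<le> k" using 0(3) length_filter_le[of isl w] by simp
  then show ?case by simp
next
  case (Suc a)
  let ?P = "extend_by_zero P" and ?ys = "map summand_embed w"
  have Pzero: "?P l U zs = 0" if "0 \<in> snd ` set zs" "U \<in> trees l" "1 \<le> l" "length zs = l" for l U zs
  proof -
    have "P l U (map snd zs) = 0"
      using P that by (intro graded_multilinear_zero_entry[of sB GB sA GA 0 l]) (auto simp: tree_hom_def)
    then show ?thesis by (simp add: extend_by_zero_def zero_prod_def)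
  qed
  have inner: "(k < a + count_Inl w \<longrightarrow> fst (diamond S G 0 m l (X a) ?P T ?ys) = 0) \<and>
      (k < Suc a + count_Inl w \<longrightarrow> snd (diamond S G 0 m l (X a) ?P T ?ys) = 0)"
    if ml: "(m, l) \<in> arity_splits k" for m l
  proof -
    have "(k < a + count_Inl w \<longrightarrow> fst (X a m (R0 i l T) (insert_op i l (?P l (Ri i l T)) ?ys)) = 0) \<and>
        (k < Suc a + count_Inl w \<longrightarrow> snd (X a m (R0 i l T) (insert_op i l (?P l (Ri i l T)) ?ys)) = 0)"
      if i: "i \<in> {1..m}" for i
    proof -
      have kl: "m + l = k + 1" "1 \<le> l" "1 \<le> i" "i \<le> m" using ml i by (auto simp: arity_splits_def)
      note sub = sublist_trees[OF Suc.prems(2) kl]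
      let ?v = "take l (drop (i - 1) w)"
      have lv: "length ?v = l" using kl Suc.prems(3) by simp
      have li: "length (insert_op i l g ?ys) = m" for g using kl Suc.prems(3) by (subst length_insert_op) auto
      have tv: "take l (drop (i - 1) ?ys) = map summand_embed ?v" by (simp add: take_map drop_map)
      show ?thesis
      \<comment> \<open>\<open>P\<close> kills a block with a letter from \<open>A\<close>. Any
        other block is replaced by one letter from \<open>A\<close>, which raises the count by one
        and makes up for the smaller index \<open>a\<close>.\<close>
      proof (cases "\<exists>x\<in>set ?v. isl x")
        case True
        then obtain x where x: "x \<in> set ?v" "isl x" by blast
        then have "snd (summand_embed x) = 0" by (simp add: snd_summand_embed)
        then have "0 \<in> snd ` set (map summand_embed ?v)" using x(1) by (metis imageI image_set)
        then have "?P l (Ri i l T) (take l (drop (i - 1) ?ys)) = 0"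
          unfolding tv using lv kl sub by (intro Pzero) auto
        then have "0 \<in> set (insert_op i l (?P l (Ri i l T)) ?ys)" by (simp add: insert_op_def)
        then have "X a m (R0 i l T) (insert_op i l (?P l (Ri i l T)) ?ys) = 0"
          using tree_hom_X kl sub li
          by (intro graded_multilinear_zero_entry[of S G S G 1 m]) (auto simp: tree_hom_def)
        then show ?thesis by simp
      next
        case False
        define p where "p = P l (Ri i l T) (map snd (map summand_embed ?v))"
        have ins: "insert_op i l (?P l (Ri i l T)) ?ys = map summand_embed (insert_op i l (\<lambda>_. Inl p) w)"
          using tv by (simp add: insert_op_def extend_by_zero_def p_def take_map drop_map)
        have "count_Inl ?v = 0" using False by (simp add: filter_empty_conv)
        moreover have "i + l - 1 = i - 1 + l" using kl by simp
        ultimately have "count_Inl (insert_op i l (\<lambda>_. Inl p) w) = Suc (count_Inl w)"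
          using length_filter_sublist[of isl w "i - 1" l] by (simp add: insert_op_def)
        moreover have "length (insert_op i l (\<lambda>_. Inl p) w) = m" using li[of "?P l (Ri i l T)"] unfolding ins by simp
        ultimately show ?thesis unfolding ins using Suc.IH[OF _ sub(1), of "insert_op i l (\<lambda>_. Inl p) w"] kl by auto
      qed
    qed
    then show ?thesis
      by (simp add: diamond_def sign_op_0[OF graded_prod] fst_sum snd_sum)
  qed
  have outer: "(k < a + count_Inl w \<longrightarrow> fst (diamond S G 1 l m ?P (X a) T ?ys) = 0) \<and>
      snd (diamond S G 1 l m ?P (X a) T ?ys) = 0" if ml: "(m, l) \<in> arity_splits k" for m l
  proof -
    have "k < a + count_Inl w \<longrightarrow> ?P l (R0 i m T) (insert_op i m (X a m (Ri i m T))
        (map (sign_op S G 1) (take (i - 1) ?ys) @ drop (i - 1) ?ys)) = 0"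
      if i: "i \<in> {1..l}" for i
    proof
      assume less: "k < a + count_Inl w"
      have kl: "l + m = k + 1" "1 \<le> m" "1 \<le> i" "i \<le> l" using ml i by (auto simp: arity_splits_def)
      note sub = sublist_trees[OF Suc.prems(2) kl]
      let ?u = "take (i - 1) w" and ?v = "take m (drop (i - 1) w)" and ?z = "drop (i - 1 + m) w"
      have lv: "length ?v = m" "length ?u = i - 1" using kl Suc.prems(3) by auto
      have "?v @ ?z = drop (i - 1) w"
        using append_take_drop_id[of m "drop (i - 1) w"] by (simp add: add.commute)
      then have dr: "drop (i - 1) ?ys = map summand_embed ?v @ map summand_embed ?z"
        by (simp only: drop_map map_append[symmetric])
      have tk: "take (i - 1) ?ys = map summand_embed ?u" by (simp only: take_map)
      have ins: "insert_op i m (X a m (Ri i m T)) (map (sign_op S G 1) (take (i - 1) ?ys) @ drop (i - 1) ?ys)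
        = map (sign_op S G 1) (map summand_embed ?u) @ X a m (Ri i m T) (map summand_embed ?v) # map summand_embed ?z"
        unfolding dr tk
        by (rule insert_op_append) (use kl lv in simp_all)
      let ?L = "map (sign_op S G 1) (map summand_embed ?u) @ X a m (Ri i m T) (map summand_embed ?v) # map summand_embed ?z"
      have len: "length ?L = l" using kl Suc.prems(3) by auto
      have s0: "sign_op sB GB 1 0 = 0" by (rule linear_zero[OF linear_sign_op[OF gvsB]])
      \<comment> \<open>One entry without \<open>B\<close>-component makes \<open>P\<close> vanish.
        Such an entry is any letter from \<open>A\<close> outside the block; if there is none, all
        letters from \<open>A\<close> lie in the block and the induction hypothesis removes the
        \<open>B\<close>-component of the inner value.\<close>
      have "0 \<in> snd ` set ?L"
      proof (cases "(\<exists>x\<in>set ?u. isl x) \<or> (\<exists>x\<in>set ?z. isl x)")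
        case True
        then obtain x where x: "isl x" "x \<in> set ?u \<or> x \<in> set ?z" by blast
        have x0: "snd (summand_embed x) = 0" using x(1) by (rule snd_summand_embed)
        then have "snd (sign_op S G 1 (summand_embed x)) = 0" by (simp add: sign_op_prod[OF gvsA gvsB] s0)
        with x0 x(2) show ?thesis by (force simp: image_iff)
      next
        case False
        then have "count_Inl ?u = 0" "count_Inl ?z = 0" by (auto simp: filter_empty_conv)
        then have "count_Inl ?v = count_Inl w"
          using length_filter_sublist[of isl w "i - 1" m] by simp
        then have "snd (X a m (Ri i m T) (map summand_embed ?v)) = 0"
          using Suc.IH[OF kl(2) sub(2) lv(1)] less kl by simp
        then show ?thesis by (force simp: image_iff)
      qed
      then show "?P l (R0 i m T) (insert_op i m (X a m (Ri i m T))
        (map (sign_op S G 1) (take (i - 1) ?ys) @ drop (i - 1) ?ys)) = 0"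
        unfolding ins using sub(1) kl len by (intro Pzero) auto
    qed
    moreover have "snd (?P l U zs) = 0" for U zs by (simp add: extend_by_zero_def)
    ultimately show ?thesis by (simp add: diamond_def fst_sum snd_sum)
  qed
  have scale1: "S 1 v = v" for v
    using prod_scale_Pair[OF gvsA gvsB, of 1 "fst v" "snd v"] by simp
  have eq: "X (Suc a) k T ?ys = (\<Sum>(m, l)\<in>arity_splits k.
      diamond S G 0 m l (X a) ?P T ?ys - diamond S G 1 l m ?P (X a) T ?ys)"
    by (simp add: ad_iter_def bracket_def scale1)
  show ?case
    unfolding eq fst_sum snd_sum case_prod_beta
    using inner outer by (auto intro!: sum.neutral simp: case_prod_beta)
qed

text \<open>No component has weight above one, whereas \<open>X a\<close> in arity \<open>k\<close>
  has weight at least \<open>a - k\<close>.\<close>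

lemma ad_iter_eq_0:
  assumes "1 \<le> k" and "T \<in> trees k" and "k + 1 < a" and "length ys = k"
  shows "X a k T ys = 0"
proof (rule graded_multilinear_eq_0[OF _ _ assms(4)])
  show "graded_multilinear S G S G 1 k (X a k T)"
    using tree_hom_X assms(1,2) by (simp add: tree_hom_def)
  show "X a k T (map summand_embed w) = 0" if "length w = k" for w
    using ad_iter_weight[OF assms(1,2) that, of a] assms(3) by (simp add: prod_eq_iff)
qed

lemma exp_twist_eq_exp_ad:
  assumes "1 \<le> k" and "T \<in> trees k" and "k + 1 \<le> N" and "length ys = k"
  shows "exp_twist sA GA sB GB \<phi> (extend_by_zero P) k T ys = exp_ad S G \<phi> (extend_by_zero P) N k T ys"
  unfolding exp_twist_def exp_ad_def iterated_bracket_replicate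
proof (rule Sum_any.expand_superset)
  have "a \<le> N" if "S (1 / fact a) (X a k T ys) \<noteq> 0" for a
  proof (rule ccontr)
    assume "\<not> a \<le> N"
    then have "X a k T ys = 0" using assms by (intro ad_iter_eq_0) auto
    then show False using that prod_scale_Pair[OF gvsA gvsB, of _ 0 0] by (simp add: zero_prod_def)
  qed
  then show "{a. S (1 / fact a) (X a k T ys) \<noteq> 0} \<subseteq> {..N}" by blast
qed simp

lemma fst_exp_twist:
  assumes mc: "maurer_cartan sA GA sB GB \<phi> (extend_by_zero P)"
    and 0: "fst (\<phi> k T (map (Pair 0) xs)) = 0"
    and "1 \<le> k" and "T \<in> trees k" and "length xs = k"
  shows "fst (exp_twist sA GA sB GB \<phi> (extend_by_zero P) k T (map (Pair 0) xs)) = 0"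
proof -
  let ?ys = "map (Pair 0) xs :: ('a \<times> 'b) list"
  let ?f = "\<lambda>a. S (1 / fact a) (fst (X a k T ?ys), 0)"
  have scale: "fst (S c v) = sA c (fst v)" for c v
    using prod_scale_Pair[OF gvsA gvsB, of c "fst v" "snd v"] by simp
  have proj: "proj_abelian (X a) k T ?ys = (fst (X a k T ?ys), 0)" for a
    by (simp add: proj_abelian_def extend_by_zero_def o_def)
  have "Sum_any (\<lambda>a. if a \<ge> 1 then ?f a else 0) = 0"
    using mc[unfolded maurer_cartan_def derived_bracket_def iterated_bracket_replicate, rule_format, of k T ?ys] assms(3-5)
    unfolding proj by simp
  moreover have "Sum_any (\<lambda>a. if a \<ge> 1 then ?f a else 0) = (\<Sum>a\<le>k + 1. if a \<ge> 1 then ?f a else 0)"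
  proof (rule Sum_any.expand_superset)
    have "a \<le> k + 1" if "?f a \<noteq> 0" for a
    proof (rule ccontr)
      assume "\<not> a \<le> k + 1"
      then have "X a k T ?ys = 0" using assms by (intro ad_iter_eq_0) auto
      then show False using that prod_scale_Pair[OF gvsA gvsB, of _ 0 0] by (simp add: zero_prod_def)
    qed
    then show "{a. (if a \<ge> 1 then ?f a else 0) \<noteq> 0} \<subseteq> {..k + 1}" by auto
  qed simp
  \<comment> \<open>The Maurer-Cartan series omits the index \<open>0\<close>; that term of the
    exponential is \<open>\<phi>\<close> itself, whose \<open>A\<close>-component vanishes by
    assumption.\<close>
  moreover have "(if a \<ge> 1 then ?f a else 0) = ?f a" for a
    using 0 prod_scale_Pair[OF gvsA gvsB] by (cases a) (simp_all add: ad_iter_def zero_prod_def)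
  ultimately have "fst (\<Sum>a\<le>k + 1. ?f a) = 0" by simp
  then show ?thesis
    using exp_twist_eq_exp_ad[OF assms(3,4) order_refl, of ?ys] assms(5)
    by (simp add: exp_ad_def fst_sum scale del: sum.atMost_Suc)
qed

lemma triass_exp_twist:
  assumes mc: "\<And>n T ds ys. 1 \<le> n \<Longrightarrow> T \<in> trees n \<Longrightarrow> length ys = n \<Longrightarrow> homogeneous G ds ys \<Longrightarrow>
      compose_sum S 1 \<phi> \<phi> n T ds ys = 0"
    and fst0: "\<And>k T xs. 1 \<le> k \<Longrightarrow> T \<in> trees k \<Longrightarrow> length xs = k \<Longrightarrow>
      fst (exp_twist sA GA sB GB \<phi> (extend_by_zero P) k T (map (Pair 0) xs)) = 0"
  shows "triass_infinity_algebra sB GB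
    (\<lambda>k T xs. snd (exp_twist sA GA sB GB \<phi> (extend_by_zero P) k T (map (Pair 0) xs)))"
    (is "triass_infinity_algebra sB GB ?\<rho>")
  unfolding triass_infinity_algebra_def
proof (intro conjI allI impI ballI)
  let ?E = "exp_ad S G \<phi> (extend_by_zero P)"
  note tree_hom_E = tree_hom_exp_ad[OF graded_prod \<phi> tree_hom_extend_by_zero]
  have E: "?E N k T (map (Pair 0) xs) = (0, ?\<rho> k T xs)"
    if "1 \<le> k" "T \<in> trees k" "length xs = k" "k + 1 \<le> N" for N k T xs
    using exp_twist_eq_exp_ad[OF that(1,2,4), of "map (Pair 0) xs"] fst0[OF that(1-3)] that(3)
    by (simp add: prod_eq_iff)
  have scale: "S c (a, b) = (sA c a, sB c b)" for c a b
    by (rule prod_scale_Pair[OF gvsA gvsB])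
  have hom0: "homogeneous G ds (map (Pair 0) xs)" if "homogeneous GB ds xs" for ds xs
    using that vsA.subspace_0[OF homogeneous_subspace[OF gvsA]]
    by (simp add: homogeneous_def list_all2_map2)
  show "graded_vector_space sB GB" by (rule gvsB)
  show "tree_hom sB GB sB GB 1 ?\<rho>"
    unfolding tree_hom_def graded_multilinear_iff
  proof (intro allI impI ballI conjI)
    fix k T and u w :: "'b list"
    assume *: "1 \<le> k" "T \<in> trees k" "length u + length w + 1 = k"
    let ?f = "\<lambda>v. ?E (k + 1) k T (map (Pair 0) u @ v # map (Pair 0) w)"
    have f: "Vector_Spaces.linear S S ?f"
      using * tree_hom_E by (intro graded_multilinear_slot) (auto simp: tree_hom_def)
    have eq: "?\<rho> k T (u @ b # w) = snd (?f (0, b))" for b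
      using E[of k T "u @ b # w" "k + 1"] * by simp
    have snd: "snd (S c v) = sB c (snd v)" for c v
      using scale[of c "fst v" "snd v"] by simp
    have "?f (x + y) = ?f x + ?f y" "?f (S c x) = S c (?f x)" for x y c
      using f unfolding Vector_Spaces.linear_iff by blast+
    from this(1)[of "(0, _)" "(0, _)"] this(2)[of _ "(0, _)"]
    have "?f (0, b + b') = ?f (0, b) + ?f (0, b')" "?f (0, sB c b) = S c (?f (0, b))" for b b' c
      by (simp_all add: scale)
    then show "Vector_Spaces.linear sB sB (\<lambda>b. ?\<rho> k T (u @ b # w))"
      unfolding eq Vector_Spaces.linear_iff by (simp add: snd vsB.vector_space_axioms)
  next
    fix k T ds and xs :: "'b list"
    assume *: "1 \<le> k" "T \<in> trees k" "length xs = k" "homogeneous GB ds xs"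
    have "?E (k + 1) k T (map (Pair 0) xs) \<in> G (sum_list ds + 1)"
      using * tree_hom_E hom0 by (intro graded_multilinear_in) (auto simp: tree_hom_def)
    then show "?\<rho> k T xs \<in> GB (sum_list ds + 1)" using E[of k T xs "k + 1"] * by simp
  qed
  fix n T ds and xs :: "'b list"
  assume n: "1 \<le> n" and T: "T \<in> trees n" and xs: "length xs = n" and hom: "homogeneous GB ds xs"
  \<comment> \<open>All operations in the identity of arity \<open>n\<close> have arity at most
    \<open>n\<close>, so one truncation serves them all.\<close>
  let ?E = "exp_ad S G \<phi> (extend_by_zero P) (n + 1)"
  let ?ys = "map (Pair 0) xs :: ('a \<times> 'b) list"
  note vs = graded_prod[unfolded graded_vector_space_def, THEN conjunct1]
  have comp: "compose_sum S 1 \<psi> \<psi> (length w) (restr T (points w)) (map dg w) (map snd w) =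
      insertions 1 (lift n T \<psi>) (lift n T \<psi>) w" if "good n G w" "w \<noteq> []" for w \<psi>
    using that by (intro compose_sum_eq_insertions[OF T _ _ vs]) (auto simp: good_def)
  have mc0: "insertions 1 (lift n T \<phi>) (lift n T \<phi>) w = 0" if w: "good n G w" for w
  proof (cases "w = []")
    case False
    have ch: "chain n w" "homogeneous G (map dg w) (map snd w)"
      using w by (auto simp: good_def homog_iff)
    have "restr T (points w) \<in> trees (length w)"
      using points_sorted[OF ch(1)] length_points[OF False] by (intro restr_in_trees[OF T])
    then show ?thesis
      using mc[of "length w" "restr T (points w)" "map snd w" "map dg w"] comp[OF w False] ch False
      by (simp add: Suc_le_eq)
  qed simp
  \<comment> \<open>The standard word carries the degrees \<open>ds\<close> and has all leaves of
    \<open>T\<close> as end points, so the word identity there is the tree identity at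
    \<open>T\<close>.\<close>
  note std = std_word_props[OF hom0[OF hom], unfolded length_map xs]
  have "std_word ds ?ys \<noteq> []" "xs \<noteq> []" using std(4) n xs by auto
  from comp[OF std(1) this(1), of ?E] this(2)
  have "compose_sum S 1 ?E ?E n T ds ?ys = insertions 1 (lift n T ?E) (lift n T ?E) (std_word ds ?ys)"
    using std(2-5) restr_all[OF T] by (simp del: upt_Suc)
  also have "\<dots> = 0"
    by (rule insertions_exp_ad[OF graded_prod \<phi> tree_hom_extend_by_zero T mc0 _ std(1)]) (auto intro: ad_iter_eq_0)
  finally have "compose_sum S 1 ?E ?E n T ds ?ys = 0" .
  moreover have "compose_sum S 1 ?E ?E n T ds ?ys = (\<Sum>(k, l)\<in>arity_splits n. \<Sum>i=1..k.
      (0, sB ((-1) powi sum_list (take (i - 1) ds)) (?\<rho> k (R0 i l T) (insert_op i l (?\<rho> l (Ri i l T)) xs))))"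
    unfolding compose_sum_def
  proof (intro sum.cong refl, clarify, intro sum.cong refl)
    fix k l i assume "(k, l) \<in> arity_splits n" "i \<in> {1..k}"
    then have kl: "k + l = n + 1" "1 \<le> l" "1 \<le> i" "i \<le> k" by (auto simp: arity_splits_def)
    note sub = sublist_trees[OF T kl]
    \<comment> \<open>The inner value again lies in \<open>B\<close>, so the outer operation is
      evaluated on a word in \<open>B\<close> as well.\<close>
    have "insert_op i l (?E l (Ri i l T)) ?ys = map (Pair 0) (insert_op i l (?\<rho> l (Ri i l T)) xs)"
      using kl xs E[OF kl(2) sub(2), of "take l (drop (i - 1) xs)" "n + 1"]
      by (intro map_insert_op[symmetric]) (simp add: take_map drop_map)
    moreover have "length (insert_op i l (?\<rho> l (Ri i l T)) xs) = k"
      using kl xs by (subst length_insert_op) auto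
    ultimately show "S ((-1) powi (1 * sum_list (take (i - 1) ds))) (?E k (R0 i l T) (insert_op i l (?E l (Ri i l T)) ?ys)) =
      (0, sB ((-1) powi sum_list (take (i - 1) ds)) (?\<rho> k (R0 i l T) (insert_op i l (?\<rho> l (Ri i l T)) xs)))"
      using E[OF _ sub(1), of _ "n + 1"] kl scale by simp
  qed
  ultimately have "snd (\<Sum>(k, l)\<in>arity_splits n. \<Sum>i=1..k.
      (0 :: 'a, sB ((-1) powi sum_list (take (i - 1) ds)) (?\<rho> k (R0 i l T) (insert_op i l (?\<rho> l (Ri i l T)) xs)))) = 0"
    by simp
  then show "(\<Sum>(k, l)\<in>arity_splits n. \<Sum>i=1..k.
      sB ((-1) powi sum_list (take (i - 1) ds)) (?\<rho> k (R0 i l T) (insert_op i l (?\<rho> l (Ri i l T)) xs))) = 0"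
    by (simp add: snd_sum case_prod_beta)
qed

end

theorem proposition8p7:
  fixes sA :: "'k::field_char_0 \<Rightarrow> 'a::ab_group_add \<Rightarrow> 'a" and GA :: "int \<Rightarrow> 'a set"
    and sB :: "'k \<Rightarrow> 'b::ab_group_add \<Rightarrow> 'b" and GB :: "int \<Rightarrow> 'b set"
    and \<mu> :: "nat \<Rightarrow> 'a list \<Rightarrow> 'a" and \<nu> :: "nat \<Rightarrow> 'b list \<Rightarrow> 'b"
    and \<eta> :: "nat \<Rightarrow> ('a + 'b) list \<Rightarrow> 'b"
    and wt :: 'k and P :: "('b, 'a) tree_ops"
  assumes "wt \<noteq> 0"
    and "a_infinity_algebra sA GA \<mu>"
    and "a_infinity_representation sA GA \<mu> sB GB \<nu> \<eta>"
    and "homotopy_rel_averaging_operator sA GA \<mu> sB GB \<nu> \<eta> wt P"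
  shows "\<exists>\<pi>P :: ('b, 'b) tree_ops.
    triass_infinity_algebra sB GB \<pi>P \<and>
    (\<forall>k\<ge>1. \<forall>T\<in>trees k. \<forall>xs. length xs = k \<longrightarrow>
       (0, \<pi>P k T xs) =
         exp_twist sA GA sB GB (pi_element sB wt \<mu> \<nu> \<eta>) (extend_by_zero P) k T (map (Pair 0) xs))"
proof -
  let ?\<phi> = "pi_element sB wt \<mu> \<nu> \<eta>"
  let ?e = "exp_twist sA GA sB GB ?\<phi> (extend_by_zero P)"
  note A = assms(2) and B = assms(3)
  have P: "tree_hom sB GB sA GA 0 P" and mc: "maurer_cartan sA GA sB GB ?\<phi> (extend_by_zero P)"
    using assms(4) by (auto simp: homotopy_rel_averaging_operator_def)
  note gvsA = A[unfolded a_infinity_algebra_def, THEN conjunct1]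
  have gvsB: "graded_vector_space sB GB"
    using B by (simp add: a_infinity_representation_def a_infinity_algebra_def)
  note \<phi> = tree_hom_pi_element[OF A B, of wt]
  have fst0: "fst (?e k T (map (Pair 0) xs)) = 0"
    if "1 \<le> k" "T \<in> trees k" "length xs = k" for k T and xs :: "'b list"
  proof (rule fst_exp_twist[OF gvsA gvsB \<phi> P mc _ that])
    \<comment> \<open>On words in \<open>B\<close> the \<open>A\<close>-component of
      \<open>?\<phi>\<close> is \<open>\<mu>\<close> with all entries zero.\<close>
    have "\<mu> k (map (\<lambda>_. 0) xs) = 0"
      using A that by (intro graded_multilinear_zero_entry[of sA GA sA GA 1 k])
        (cases xs; auto simp: a_infinity_algebra_def)+
    then show "fst (?\<phi> k T (map (Pair 0) xs)) = 0" by (simp add: pi_element_def o_def)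
  qed
  show ?thesis
  proof (intro exI conjI allI impI ballI)
    show "triass_infinity_algebra sB GB (\<lambda>k T xs. snd (?e k T (map (Pair 0) xs)))"
      using compose_sum_pi_element[OF A B] fst0 by (intro triass_exp_twist[OF gvsA gvsB \<phi> P])
    show "(0, snd (?e k T (map (Pair 0) xs))) = ?e k T (map (Pair 0) xs)"
      if "1 \<le> k" "T \<in> trees k" "length xs = k" for k T xs
      using fst0[OF that] by (simp add: prod_eq_iff)
  qed
qed

end
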